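(* Let $\{\lambda_{n,l}: n\ge 1\}$, $l=1,2,3$, be strictly increasing sequences of positive numbers such that the (finite) limits $$a_l:=\lim_{n\to\infty}\frac{\lambda_{n,l}}{n^{1/2}},\quad l=1,2,3,$$ exist. Let $$\Lambda=\bigcup_{l=1}^3\big\{(t_l,\omega_l)\pm\lambda_{n,l}(\sin\theta_0,\cos\theta_0): n\ge 1\big\},$$ where $\theta_0\in[0,2\pi]$ and $(t_1,\omega_1),(t_2,\omega_2),(t_3,\omega_3)\in\mathbb{R}^2$ are three points for which $$d_l:=|(\omega_l-\omega_3)\sin\theta_0-(t_l-t_3)\cos\theta_0|>0,\quad l=1,2.$$ If $d_1/d_2\notin\mathbb{Q}$ and $\max\{a_1,a_2,a_3\}<1$, then $\Lambda$ does Gabor phase retrieval. Moreover, $\Lambda$ does not do Gabor phase retrieval if $d_1/d_2\in\mathbb{Q}$ or $1/a_1^2+1/a_2^2+1/a_3^2<1/2$.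
   Context: Let $\varphi(x)=e^{-\pi x^2}$, $x\in\mathbb{R}$. For $f\in L^2(\mathbb{R})$ the Gabor transform is $V_\varphi f(t,\omega)=\int_{\mathbb{R}} f(x)\varphi(x-t)e^{-2\pi i x\omega}\,dx$, $(t,\omega)\in\mathbb{R}^2$. A set $\Lambda\subset\mathbb{R}^2$ does Gabor phase retrieval if, for all $f_1,f_2\in L^2(\mathbb{R})$, the condition $|V_\varphi f_1(t,\omega)|=|V_\varphi f_2(t,\omega)|$ for all $(t,\omega)\in\Lambda$ implies that there is a real constant $\alpha$ with $f_1=e^{i\alpha}f_2$ almost everywhere. Convention: $1/a_l^2=+\infty$ if $a_l=0$. *)

theory Defs
  imports "HOL-Analysis.Analysis"
begin

text \<open>
  Elements of \<open>L\<^sup>2(\<real>)\<close> are represented by complex-valued Lebesgue measurable functions, and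
  equality in \<open>L\<^sup>2(\<real>)\<close> is equality almost everywhere.
\<close>

definition square_integrable :: "(real \<Rightarrow> complex) \<Rightarrow> bool" where
  "square_integrable f \<longleftrightarrow>
     f \<in> borel_measurable lebesgue \<and> integrable lebesgue (\<lambda>x. (cmod (f x))\<^sup>2)"

definition gauss :: "real \<Rightarrow> real" where
  "gauss x = exp (- pi * x\<^sup>2)"

text \<open>
  For square-integrable \<open>f\<close> the integrand below is integrable, so the Bochner integral never
  takes its default value \<open>0\<close>.
\<close>

definition gabor_transform :: "(real \<Rightarrow> complex) \<Rightarrow> real \<times> real \<Rightarrow> complex" where
  "gabor_transform f = (\<lambda>(t, \<omega>).
     LINT x|lebesgue. f x * of_real (gauss (x - t)) * exp (- 2 * of_real pi * \<i> * of_real x * of_real \<omega>))"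

definition does_gabor_phase_retrieval :: "(real \<times> real) set \<Rightarrow> bool" where
  "does_gabor_phase_retrieval \<Lambda> \<longleftrightarrow>
     (\<forall>f1 f2. square_integrable f1 \<longrightarrow> square_integrable f2 \<longrightarrow>
        (\<forall>p\<in>\<Lambda>. cmod (gabor_transform f1 p) = cmod (gabor_transform f2 p)) \<longrightarrow>
        (\<exists>\<alpha>::real. AE x in lebesgue. f1 x = exp (\<i> * of_real \<alpha>) * f2 x))"

text \<open>\<open>1 / a\<^sup>2\<close> with the convention that it is \<open>+\<infinity>\<close> for \<open>a = 0\<close>.\<close>

definition inverse_square :: "real \<Rightarrow> ereal" where
  "inverse_square a = (if a = 0 then \<infinity> else ereal (1 / a\<^sup>2))"

end

theory Submission
  imports Defs "HOL-Complex_Analysis.Complex_Analysis" "HOL-Probability.Probability" "HOL-Real_Asymp.Real_Asymp"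
begin

text \<open>
  Up to a Gaussian factor and the identification of \<open>(t, \<omega>)\<close> with \<open>t - \<i> \<omega>\<close>, the Gabor transform is
  the Bargmann transform, an entire function \<open>F\<close>. On a line parametrized by \<open>s\<close>, the squared modulus of
  the Gabor transform extends to an entire function of \<open>s\<close> bounded by \<open>C exp (2 \<pi> (Im s)\<^sup>2)\<close>. After the
  substitution \<open>w = s\<^sup>2\<close> this is \<open>C exp (\<pi> \<bar>Im w\<bar>)\<close> in the right half plane, and a Carlson-type argument
  shows that such a function vanishes if it has zeros of density greater than one. Hence equality on
  the sampled points gives \<open>\<bar>F1\<bar> = \<bar>F2\<bar>\<close> on all three lines. Reflecting in two parallel lines shows that
  \<open>F1 / F2\<close> is periodic under twice their distance, so two incommensurable distances force \<open>F1 / F2\<close> to be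
  a unimodular constant, and the Bargmann transform is injective.

  Conversely, for commensurable distances there is an exponential \<open>E\<close> that is real on all three lines,
  and \<open>1 + \<i> E\<close>, \<open>1 - \<i> E\<close> (times \<open>exp (\<pi> z\<^sup>2 / 2)\<close>) are transforms of Gaussians with the same modulus
  there. If \<open>1 / a\<^sub>1\<^sup>2 + 1 / a\<^sub>2\<^sup>2 + 1 / a\<^sub>3\<^sup>2 < 1 / 2\<close>, a product of canonical products vanishing on the sampled
  points grows slower than \<open>exp (c \<bar>z\<bar>\<^sup>2)\<close> with \<open>c < \<pi> / 2\<close>, so it is in the range of the transform and
  its preimage cannot be distinguished from \<open>0\<close>.
\<close>

section \<open>A Carlson theorem for irregularly spaced zeros\<close>

text \<open>The threshold one for the limits is that of sin (\<pi> w): it has size exp (\<pi>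
  \<bar>Im w\<bar>) and zeros of density one, while the squares of the samples on a line have
  asymptotic density 1 / a^2. The square root has a branch cut, so the substitution w = s^2 yields
  an analytic function only off a half line; this is why the zero theorem is stated in a half plane.
  There two powers of the radius of a growing half disc compete, and the density of the zeros
  decides which one wins. The threshold 1 / 2 is a growth budget: up to an arbitrarily small loss,
  the product for one line is bounded by exp (\<pi> \<bar>z\<bar>^2 / a^2), the three exponents add
  up, and the range of the transform leaves room for \<pi> / 2. The reciprocals of the squared
  samples sum like a harmonic series, so zeros on the line alone give no convergent product of plain
  factors. Each product is therefore made to vanish on the perpendicular line as well, which
  restores convergence without a logarithmic loss in the growth.\<close>

lemma holomorphic_factor_finite_zeros:
  assumes "finite Z" "open S" "g holomorphic_on S" "Z \<subseteq> S" "\<And>a. a \<in> Z \<Longrightarrow> g a = (0::complex)"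
  shows "\<exists>h. h holomorphic_on S \<and> (\<forall>z\<in>S. g z = (\<Prod>a\<in>Z. z - a) * h z)"
  using assms(1,4,5)
proof (induction Z rule: finite_induct)
  case empty
  then show ?case using assms(3) by auto
next
  case (insert a Z)
  then obtain h where h: "h holomorphic_on S" "\<And>z. z \<in> S \<Longrightarrow> g z = (\<Prod>a\<in>Z. z - a) * h z"
    by auto
  have "(\<Prod>b\<in>Z. a - b) \<noteq> 0"
    using insert.hyps by auto
  then have ha: "h a = 0"
    using h(2)[of a] insert.prems by auto
  define k where "k = (\<lambda>z. if z = a then deriv h a else (h z - h a) / (z - a))"
  have "k holomorphic_on S"
    unfolding k_def by (rule pole_lemma_open[OF h(1) assms(2)])
  moreover have "g z = (\<Prod>b\<in>insert a Z. z - b) * k z" if "z \<in> S" for z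
    using insert.hyps h(2)[OF that] ha by (auto simp: k_def)
  ultimately show ?case by blast
qed

text \<open>The factors on the right are the Blaschke factors of the half disc of radius \<open>R\<close>: the factor
  with zero \<open>\<nu>\<close> has modulus one both on the imaginary axis and on the circle.\<close>

lemma half_disc_blaschke_bound:
  fixes f :: "complex \<Rightarrow> complex" and V :: "real set"
  assumes U: "open U" "{v. Re v \<ge> 0 \<and> norm v \<le> R} \<subseteq> U" and holf: "f holomorphic_on U"
    and V: "finite V" "V \<subseteq> {0<..<R}" "\<And>\<nu>. \<nu> \<in> V \<Longrightarrow> f (of_real \<nu>) = 0"
    and bound: "\<And>v. Re v \<ge> 0 \<Longrightarrow> norm v \<le> R \<Longrightarrow> norm (f v) \<le> C"
    and x: "0 < x" "x < R"
  shows "norm (f (of_real x)) \<le> C * (\<Prod>\<nu>\<in>V. \<bar>x - \<nu>\<bar> * (R\<^sup>2 + \<nu> * x) / ((x + \<nu>) * (R\<^sup>2 - \<nu> * x)))"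
proof -
  define D where "D = {v::complex. Re v > 0 \<and> norm v < R}"
  define D' where "D' = {v::complex. Re v \<ge> 0 \<and> norm v \<le> R}"
  have R: "R > 0" using x by simp
  have "\<exists>h. h holomorphic_on U \<and> (\<forall>z\<in>U. f z = (\<Prod>a\<in>of_real ` V. z - a) * h z)"
    by (rule holomorphic_factor_finite_zeros) (use V U holf in \<open>auto simp: subset_iff\<close>)
  then obtain h where h: "h holomorphic_on U"
    and fh: "\<And>z. z \<in> U \<Longrightarrow> f z = (\<Prod>a\<in>of_real ` V. z - a) * h z"
    by blast
  have fh: "f z = (\<Prod>\<nu>\<in>V. z - of_real \<nu>) * h z" if "z \<in> D'" for z
  proof -
    have "(\<Prod>a\<in>of_real ` V. z - a) = (\<Prod>\<nu>\<in>V. z - of_real \<nu>)"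
      by (subst prod.reindex) (auto simp: inj_on_def)
    then show ?thesis using fh[of z] that U(2) by (auto simp: D'_def)
  qed
  \<comment> \<open>\<open>h v * q v\<close> is \<open>f v\<close> divided by the Blaschke product,
    written so that it makes sense at the zeros too.\<close>
  define q where "q = (\<lambda>v. \<Prod>\<nu>\<in>V. (v + of_real \<nu>) * (of_real (R\<^sup>2) - of_real \<nu> * v) / (of_real (R\<^sup>2) + of_real \<nu> * v) :: complex)"
  have nz: "of_real (R\<^sup>2) + of_real \<nu> * v \<noteq> 0" "v + of_real \<nu> \<noteq> 0" "of_real (R\<^sup>2) - of_real \<nu> * v \<noteq> 0"
    if "v \<in> D'" "\<nu> \<in> V" for v \<nu>
  proof -
    have nu: "0 < \<nu>" "\<nu> < R" using that V by auto
    have "Re (of_real (R\<^sup>2) + of_real \<nu> * v) > 0"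
      using nu that R by (simp add: D'_def add_pos_nonneg)
    then show "of_real (R\<^sup>2) + of_real \<nu> * v \<noteq> 0" by (metis less_irrefl zero_complex.sel(1))
    have "Re (v + of_real \<nu>) > 0"
      using nu that R by (simp add: D'_def add_pos_nonneg)
    then show "v + of_real \<nu> \<noteq> 0" by (metis less_irrefl zero_complex.sel(1))
    have "norm (of_real \<nu> * v) \<le> \<nu> * R"
      using nu that by (simp add: norm_mult D'_def)
    also have "\<dots> < R\<^sup>2" using nu R by (simp add: power2_eq_square)
    finally show "of_real (R\<^sup>2) - of_real \<nu> * v \<noteq> 0"
      using R by (metis abs_of_nonneg eq_iff_diff_eq_0 less_irrefl norm_of_real zero_le_power2)
  qed
  have sub: "D \<subseteq> D'" by (auto simp: D_def D'_def)
  have D'cl: "closed D'"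
    unfolding D'_def by (intro closed_Collect_conj closed_Collect_le continuous_intros)
  have Dop: "open D"
    unfolding D_def by (intro open_Collect_conj open_Collect_less continuous_intros)
  have clD: "closure D \<subseteq> D'"
    using D'cl sub by (rule closure_minimal[rotated])
  have qhol: "(\<lambda>v. h v * q v) holomorphic_on D"
    unfolding q_def using h nz(1) sub U(2)
    by (intro holomorphic_intros holomorphic_on_subset[OF h]) (auto simp: D'_def)
  have qcont: "continuous_on D' (\<lambda>v. h v * q v)"
    unfolding q_def using nz(1) U(2)
    by (intro continuous_intros continuous_on_subset[OF holomorphic_on_imp_continuous_on[OF h]])
      (auto simp: D'_def)
  have bd: "norm (h v * q v) \<le> C" if "v \<in> frontier D" for v
  proof -
    have v: "v \<in> D'" "v \<notin> D"
      using that clD Dop by (auto simp: frontier_def interior_open)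
    have eq: "norm (v - of_real \<nu>) * norm (of_real (R\<^sup>2) + of_real \<nu> * v)
        = norm (v + of_real \<nu>) * norm (of_real (R\<^sup>2) - of_real \<nu> * v)" for \<nu>
    proof (cases "norm v = R")
      case True
      have "of_real (R\<^sup>2) = v * cnj v"
        using True complex_norm_square[of v] by simp
      then have "of_real (R\<^sup>2) + of_real \<nu> * v = v * cnj (v + of_real \<nu>)"
        "of_real (R\<^sup>2) - of_real \<nu> * v = v * cnj (v - of_real \<nu>)"
        by (simp_all add: algebra_simps)
      then show ?thesis
        by (simp only: norm_mult complex_mod_cnj) simp
    next
      case False
      then have "Re v = 0" using v by (auto simp: D_def D'_def)
      then show ?thesis
        by (simp add: cmod_def power2_eq_square)
    qed
    have "norm (q v) = (\<Prod>\<nu>\<in>V. norm (v - of_real \<nu>))"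
      unfolding q_def prod_norm[symmetric]
    proof (rule prod.cong)
      fix \<nu> assume "\<nu> \<in> V"
      have "norm (v - of_real \<nu>) = norm (v + of_real \<nu>) * norm (of_real (R\<^sup>2) - of_real \<nu> * v) / norm (of_real (R\<^sup>2) + of_real \<nu> * v)"
        using eq[of \<nu>] nz(1)[OF v(1) \<open>\<nu> \<in> V\<close>] by (simp add: field_simps)
      then show "norm ((v + of_real \<nu>) * (of_real (R\<^sup>2) - of_real \<nu> * v) / (of_real (R\<^sup>2) + of_real \<nu> * v)) = norm (v - of_real \<nu>)"
        by (simp add: norm_mult norm_divide)
    qed simp
    then have "norm (h v * q v) = norm (f v)"
      using fh[OF v(1)] by (simp add: norm_mult prod_norm)
    then show ?thesis using bound[of v] v by (auto simp: D'_def)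
  qed
  have xD: "of_real x \<in> D" using x by (simp add: D_def)
  have "norm (h (of_real x) * q (of_real x)) \<le> C"
  proof (rule maximum_modulus_frontier[OF _ _ _ bd xD])
    show "(\<lambda>v. h v * q v) holomorphic_on interior D" using qhol Dop by (simp add: interior_open)
    show "continuous_on (closure D) (\<lambda>v. h v * q v)" using qcont clD by (rule continuous_on_subset)
    show "bounded D" by (rule boundedI[of _ R]) (auto simp: D_def)
  qed
  define B where "B = (\<Prod>\<nu>\<in>V. \<bar>x - \<nu>\<bar> * (R\<^sup>2 + \<nu> * x) / ((x + \<nu>) * (R\<^sup>2 - \<nu> * x)))"
  have "norm (f (of_real x)) = norm (h (of_real x) * q (of_real x)) * B"
  proof -
    have "q (of_real x) = of_real (\<Prod>\<nu>\<in>V. (x + \<nu>) * (R\<^sup>2 - \<nu> * x) / (R\<^sup>2 + \<nu> * x))"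
      by (simp add: q_def)
    then have "norm (q (of_real x)) * B = (\<Prod>\<nu>\<in>V. \<bar>(x + \<nu>) * (R\<^sup>2 - \<nu> * x) / (R\<^sup>2 + \<nu> * x)\<bar>) * B"
      by (simp only: norm_of_real abs_prod)
    also have "\<dots> = (\<Prod>\<nu>\<in>V. \<bar>x - \<nu>\<bar>)"
      unfolding B_def prod.distrib[symmetric]
    proof (rule prod.cong)
      fix \<nu> assume nV: "\<nu> \<in> V"
      then have nu: "0 < \<nu>" "\<nu> < R" using V by auto
      have "\<nu> * x < R * R" using nu x by (intro mult_strict_mono) auto
      then have "R\<^sup>2 - \<nu> * x > 0" by (simp add: power2_eq_square)
      moreover have "x + \<nu> > 0" "R\<^sup>2 + \<nu> * x > 0" using nu x R by (auto intro: add_pos_pos)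
      ultimately show "\<bar>(x + \<nu>) * (R\<^sup>2 - \<nu> * x) / (R\<^sup>2 + \<nu> * x)\<bar> * (\<bar>x - \<nu>\<bar> * (R\<^sup>2 + \<nu> * x) / ((x + \<nu>) * (R\<^sup>2 - \<nu> * x))) = \<bar>x - \<nu>\<bar>"
        by (simp add: abs_mult)
    qed simp
    finally have q: "norm (q (of_real x)) * B = (\<Prod>\<nu>\<in>V. \<bar>x - \<nu>\<bar>)" .
    have "f (of_real x) = of_real (\<Prod>\<nu>\<in>V. x - \<nu>) * h (of_real x)"
      using fh[of "of_real x"] xD sub by auto
    then have "norm (f (of_real x)) = (\<Prod>\<nu>\<in>V. \<bar>x - \<nu>\<bar>) * norm (h (of_real x))"
      by (simp only: norm_mult norm_of_real abs_prod)
    with q show ?thesis by (simp add: norm_mult)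
  qed
  moreover have "B \<ge> 0"
    unfolding B_def
  proof (rule prod_nonneg)
    fix \<nu> assume nV: "\<nu> \<in> V"
    then have nu: "0 < \<nu>" "\<nu> < R" using V by auto
    have "\<nu> * x < R * R" using nu x by (intro mult_strict_mono) auto
    then have "R\<^sup>2 - \<nu> * x > 0" by (simp add: power2_eq_square)
    then show "0 \<le> \<bar>x - \<nu>\<bar> * (R\<^sup>2 + \<nu> * x) / ((x + \<nu>) * (R\<^sup>2 - \<nu> * x))"
      using nu x by simp
  qed
  ultimately show ?thesis
    using \<open>norm (h (of_real x) * q (of_real x)) \<le> C\<close> B_def by (simp add: mult_right_mono)
qed

text \<open>The right-hand side is harmonic and equals \<open>\<bar>Im u\<bar>\<close> on the imaginary axis; it plays the role of the
  Poisson integral of \<open>\<bar>Im u\<bar>\<close>, which diverges logarithmically over the whole half plane.\<close>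

lemma abs_Im_le_majorant:
  assumes "Re u \<ge> 0" "u \<noteq> 0" "norm u \<le> R"
  shows "\<bar>Im u\<bar> \<le> Re (u - 2 / of_real pi * u * (Ln u - of_real (ln R)))"
proof -
  define \<theta> where "\<theta> = Arg u"
  define r where "r = norm u"
  have r: "0 < r" "r \<le> R" using assms by (auto simp: r_def)
  have u: "u = of_real r * cis \<theta>" 
    unfolding \<theta>_def r_def using assms(2) Arg_eq[of u] by (simp add: cis_conv_exp)
  have th: "\<bar>\<theta>\<bar> \<le> pi / 2" 
    using assms Arg_Re_nonneg[of u] by (simp add: \<theta>_def)
  \<comment> \<open>What remains after dividing by \<open>r\<close> and dropping the nonnegative
    term with \<open>ln R - ln r\<close>. In terms of the complementary angle \<open>\<phi>\<close>
    it follows from \<phi> \<le> tan \<phi>, since 2 / \<pi> \<le> 1.\<close>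
  have key: "\<bar>sin \<theta>\<bar> * (1 - 2 / pi * \<bar>\<theta>\<bar>) \<le> cos \<theta>"
  proof -
    define \<phi> where "\<phi> = pi / 2 - \<bar>\<theta>\<bar>"
    have phi: "0 \<le> \<phi>" "\<phi> \<le> pi / 2" using th by (auto simp: \<phi>_def)
    have c: "cos \<theta> = sin \<phi>" by (simp add: \<phi>_def sin_diff abs_if)
    have s: "\<bar>sin \<theta>\<bar> = cos \<phi>" 
    proof -
      have "sin \<bar>\<theta>\<bar> \<ge> 0" using th pi_gt_zero by (intro sin_ge_zero) linarith+
      then have "\<bar>sin \<theta>\<bar> = sin \<bar>\<theta>\<bar>" by (simp add: abs_if split: if_splits)
      then show ?thesis by (simp add: \<phi>_def cos_diff)
    qed
    have "\<phi> * cos \<phi> \<le> sin \<phi>"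
    proof -
      have "sin 0 - 0 * cos 0 \<le> sin \<phi> - \<phi> * cos \<phi>"
      proof (rule DERIV_nonneg_imp_nondecreasing[OF phi(1)])
        fix x assume x: "0 \<le> x" "x \<le> \<phi>"
        have "((\<lambda>a. sin a - a * cos a) has_real_derivative x * sin x) (at x)"
          by (auto intro!: derivative_eq_intros)
        moreover have "x * sin x \<ge> 0" using x phi by (intro mult_nonneg_nonneg sin_ge_zero) auto
        ultimately show "\<exists>y. ((\<lambda>a. sin a - a * cos a) has_real_derivative y) (at x) \<and> y \<ge> 0" by blast
      qed
      then show ?thesis by simp
    qed
    moreover have "cos \<phi> \<ge> 0" using phi by (intro cos_ge_zero) auto
    moreover have "2 / pi \<le> 1" using pi_ge_two by simp
    ultimately have "cos \<phi> * (2 / pi * \<phi>) \<le> sin \<phi>"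
      using mult_right_mono[of "2 / pi" 1 "\<phi> * cos \<phi>"] phi by (simp add: mult_ac)
    moreover have "1 - 2 / pi * \<bar>\<theta>\<bar> = 2 / pi * \<phi>" by (simp add: \<phi>_def field_simps)
    ultimately show ?thesis by (simp add: c s)
  qed
  have ln0: "ln r \<le> ln R" using r by simp
  have Lnu: "Ln u = Complex (ln r) \<theta>" 
    using assms(2) by (simp add: complex_eq_iff \<theta>_def r_def Arg_eq_Im_Ln)
  have c0: "cos \<theta> \<ge> 0" using th by (intro cos_ge_zero) auto
  have abs: "\<bar>sin \<theta>\<bar> * \<bar>\<theta>\<bar> = sin \<theta> * \<theta>"
  proof -
    have "sin \<theta> * \<theta> \<ge> 0"
    proof (cases "\<theta> \<ge> 0")
      case True then show ?thesis using th pi_gt_zero by (intro mult_nonneg_nonneg sin_ge_zero) auto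
    next
      case False 
      then have "sin (- \<theta>) \<ge> 0" using th pi_gt_zero by (intro sin_ge_zero) auto
      then show ?thesis using False by (simp add: mult_nonpos_nonpos)
    qed
    then show ?thesis by (metis abs_mult abs_of_nonneg)
  qed
  have two: "(2::complex) / of_real pi = of_real (2 / pi)" by simp
  have "Re (u - 2 / of_real pi * u * (Ln u - of_real (ln R)))
      = r * (cos \<theta> + 2 / pi * (\<bar>sin \<theta>\<bar> * \<bar>\<theta>\<bar>)) + 2 / pi * (r * cos \<theta>) * (ln R - ln r)"
    unfolding two Lnu abs by (simp add: u algebra_simps diff_divide_distrib del: of_real_divide of_real_mult)
  also have "\<dots> \<ge> r * (cos \<theta> + 2 / pi * (\<bar>sin \<theta>\<bar> * \<bar>\<theta>\<bar>))"
    using ln0 c0 r by simp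
  also have "r * (cos \<theta> + 2 / pi * (\<bar>sin \<theta>\<bar> * \<bar>\<theta>\<bar>)) \<ge> r * \<bar>sin \<theta>\<bar>"
    using key r by (intro mult_left_mono) (auto simp: algebra_simps)
  finally show ?thesis using r by (simp add: u abs_mult)
qed

text \<open>With p = x / \<nu> the half-plane factor (1 - p) / (1 + p) is at most exp (- 2 p), the
  first term of the artanh series. With q = \<nu> x / R^2 \<le> 1 / 2 the reflected factor (1 + q) /
  (1 - q) is at most 1 + 4 q. The loss exp (4 x / R) is harmless because at most \<open>R\<close>
  such factors will be multiplied.\<close>

lemma half_disc_factor_bound:
  fixes x \<nu> R :: real
  assumes "0 < x" "x < \<nu>" "\<nu> < R" "2 * x \<le> R"
  shows "\<bar>x - \<nu>\<bar> * (R\<^sup>2 + \<nu> * x) / ((x + \<nu>) * (R\<^sup>2 - \<nu> * x)) \<le> exp (4 * x / R - 2 * x / \<nu>)"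
    and "0 \<le> \<bar>x - \<nu>\<bar> * (R\<^sup>2 + \<nu> * x) / ((x + \<nu>) * (R\<^sup>2 - \<nu> * x))"
proof -
  have R: "R > 0" using assms by simp
  have \<nu>: "\<nu> > 0" using assms by simp
  have nx: "\<nu> * x < R\<^sup>2" "\<nu> * x \<le> R * x"
    using assms by (auto simp: power2_eq_square intro!: mult_strict_mono)
  define q where "q = \<nu> * x / R\<^sup>2"
  have q: "0 < q" "q \<le> x / R" "q \<le> 1 / 2"
  proof -
    show "0 < q" using assms R by (simp add: q_def)
    show "q \<le> x / R" using nx R by (simp add: q_def power2_eq_square field_simps)
    moreover have "x / R \<le> 1 / 2" using assms R by (simp add: field_simps)
    ultimately show "q \<le> 1 / 2" by linarith
  qed
  have "(R\<^sup>2 + \<nu> * x) / (R\<^sup>2 - \<nu> * x) = (1 + q) / (1 - q)"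
  proof -
    have "R\<^sup>2 + \<nu> * x = R\<^sup>2 * (1 + q)" "R\<^sup>2 - \<nu> * x = R\<^sup>2 * (1 - q)"
      using R by (auto simp: q_def field_simps)
    then show ?thesis using R by simp
  qed
  also have "\<dots> \<le> 1 + 4 * q"
  proof -
    have "q * (2 * q) \<le> q * 1" using q by (intro mult_left_mono) auto
    then show ?thesis using q by (simp add: pos_divide_le_eq) (simp add: algebra_simps)
  qed
  also have "\<dots> \<le> exp (4 * q)" by (rule exp_ge_add_one_self)
  also have "\<dots> \<le> exp (4 * x / R)" using q by simp
  finally have 1: "(R\<^sup>2 + \<nu> * x) / (R\<^sup>2 - \<nu> * x) \<le> exp (4 * x / R)" .
  define p where "p = x / \<nu>"
  have p: "0 < p" "p < 1" using assms \<nu> by (auto simp: p_def)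
  have "ln (1 + 0) - ln (1 - 0) - 2 * 0 \<le> ln (1 + p) - ln (1 - p) - 2 * p"
  proof (rule DERIV_nonneg_imp_nondecreasing[of 0 p "\<lambda>a. ln (1 + a) - ln (1 - a) - 2 * a"])
    fix t assume t: "0 \<le> t" "t \<le> p"
    have "((\<lambda>a. ln (1 + a) - ln (1 - a) - 2 * a) has_real_derivative 1 / (1 + t) + 1 / (1 - t) - 2) (at t)"
      using t p by (auto intro!: derivative_eq_intros simp: divide_inverse)
    moreover have "1 / (1 + t) + 1 / (1 - t) - 2 = 2 * t\<^sup>2 / ((1 + t) * (1 - t))"
    proof -
      have "1 + t \<noteq> 0" "1 - t \<noteq> 0" using t p by auto
      then have "1 / (1 + t) + 1 / (1 - t) - 2 = (2 - 2 * ((1 + t) * (1 - t))) / ((1 + t) * (1 - t))"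
        by (simp add: add_frac_eq diff_divide_distrib del: mult_cancel_left1)
      moreover have "2 - 2 * ((1 + t) * (1 - t)) = 2 * t\<^sup>2" by (simp add: algebra_simps power2_eq_square)
      ultimately show ?thesis by simp
    qed
    moreover have "\<dots> \<ge> 0" using t p by simp
    ultimately show "\<exists>y. ((\<lambda>a. ln (1 + a) - ln (1 - a) - 2 * a) has_real_derivative y) (at t) \<and> 0 \<le> y"
      by metis
  qed (use p in auto)
  then have "ln ((1 - p) / (1 + p)) \<le> - 2 * p"
    using p by (simp add: ln_div)
  then have "(1 - p) / (1 + p) \<le> exp (- 2 * p)"
    using p by (metis add_pos_pos diff_gt_0_iff_gt divide_pos_pos exp_le_cancel_iff exp_ln zero_less_one)
  moreover have "(1 - p) / (1 + p) = \<bar>x - \<nu>\<bar> / (x + \<nu>)"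
  proof -
    have "1 - p = (\<nu> - x) / \<nu>" "1 + p = (x + \<nu>) / \<nu>"
      using \<nu> by (auto simp: p_def field_simps)
    then show ?thesis using \<nu> assms by simp
  qed
  ultimately have 2: "\<bar>x - \<nu>\<bar> / (x + \<nu>) \<le> exp (- 2 * x / \<nu>)"
    by (simp add: p_def)
  have "\<bar>x - \<nu>\<bar> / (x + \<nu>) * ((R\<^sup>2 + \<nu> * x) / (R\<^sup>2 - \<nu> * x)) \<le> exp (- 2 * x / \<nu>) * exp (4 * x / R)"
    using assms \<nu> nx by (intro mult_mono 1 2) auto
  then show "\<bar>x - \<nu>\<bar> * (R\<^sup>2 + \<nu> * x) / ((x + \<nu>) * (R\<^sup>2 - \<nu> * x)) \<le> exp (4 * x / R - 2 * x / \<nu>)"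
    by (simp add: exp_add[symmetric])
  show "0 \<le> \<bar>x - \<nu>\<bar> * (R\<^sup>2 + \<nu> * x) / ((x + \<nu>) * (R\<^sup>2 - \<nu> * x))"
    using assms \<nu> nx by simp
qed

lemma ln_le_sum_inverse:
  assumes "1 \<le> N" "N \<le> M"
  shows "ln (real M + 1) - ln (real N) \<le> (\<Sum>n=N..M. 1 / real n)"
  using assms(2)
proof (induction M rule: dec_induct)
  case base
  have "ln (real N + 1) - ln (real N) = ln (1 + 1 / real N)"
  proof -
    have "1 + 1 / real N = (real N + 1) / real N" using assms by (simp add: field_simps)
    then show ?thesis using assms by (simp add: ln_div)
  qed
  also have "\<dots> \<le> 1 / real N" using assms by (intro ln_add_one_self_le_self) auto
  finally show ?case by simp
next
  case (step M)
  have "ln (real (Suc M) + 1) - ln (real (Suc M)) = ln (1 + 1 / real (Suc M))"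
  proof -
    have "1 + 1 / real (Suc M) = (real (Suc M) + 1) / real (Suc M)" by (simp add: field_simps)
    then show ?thesis by (simp only: ln_div) (simp add: ln_div)
  qed
  also have "\<dots> \<le> 1 / real (Suc M)" by (intro ln_add_one_self_le_self) auto
  finally have "ln (real (Suc M) + 1) - ln (real (Suc M)) \<le> 1 / real (Suc M)" .
  then have "ln (real M + 1 + 1) - ln (real M + 1) \<le> 1 / (real M + 1)" by (simp add: add.commute)
  moreover have "(\<Sum>n=N..Suc M. 1 / real n) = (\<Sum>n=N..M. 1 / real n) + 1 / (real M + 1)"
    using step.hyps by simp
  moreover have "real (Suc M) = real M + 1" by simp
  ultimately show ?case using step.IH by (simp only:)
qed

text \<open>On the half disc of radius \<open>M\<close> the majorant costs a factor of order \<open>M powr (2 * x)\<close>, while the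
  Blaschke factors gain \<open>M powr (- 2 * \<xi> / \<beta>)\<close>, which wins as \<open>\<beta> < 1\<close>. The half disc is moved to
  \<open>Re u \<ge> \<delta>\<close> because \<open>g\<close> and \<open>Ln\<close> need not be continuous at \<open>0\<close>; then \<open>\<xi> = x - \<delta>\<close> replaces \<open>x\<close>
  in the gain, so \<open>\<delta>\<close> has to be small.\<close>

lemma carlson_half_plane:
  fixes g :: "complex \<Rightarrow> complex" and \<mu> :: "nat \<Rightarrow> real"
  assumes holg: "g holomorphic_on {u. Re u > 0}"
    and bound: "\<And>u. Re u > 0 \<Longrightarrow> norm (g u) \<le> C * exp (pi * \<bar>Im u\<bar>)"
    and zero: "\<And>n. n \<ge> 1 \<Longrightarrow> g (of_real (\<mu> n)) = 0"
    and mono: "strict_mono_on {1..} \<mu>" and pos: "\<mu> 1 > 0"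
    and \<beta>: "0 < \<beta>" "\<beta> < 1" and N: "N \<ge> 1" "\<And>n. n \<ge> N \<Longrightarrow> \<mu> n \<le> \<beta> * real n"
    and x: "\<mu> 1 / 2 < x" "x < \<mu> 1"
  shows "g (of_real x) = 0"
proof -
  \<comment> \<open>Since \<open>\<mu> 1 / 2 < x\<close>, this choice gives
    \<open>\<delta> < (1 - \<beta>) * x\<close>, which is \<open>\<beta> * x < \<xi>\<close>: the
    exponent of the gain then exceeds that of the cost.\<close>
  define \<delta> where "\<delta> = (1 - \<beta>) * \<mu> 1 / 2"
  define \<xi> where "\<xi> = x - \<delta>"
  have \<delta>: "0 < \<delta>" "\<delta> < (1 - \<beta>) * x" using \<beta> pos x by (auto simp: \<delta>_def)
  have "(1 - \<beta>) * x \<le> 1 * x" using \<beta> x pos by (intro mult_right_mono) auto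
  then have "\<delta> < x" using \<delta> by linarith
  then have \<xi>: "0 < \<xi>" "\<beta> * x < \<xi>" using \<delta> by (auto simp: \<xi>_def algebra_simps)
  have C: "C \<ge> 0" using bound[of 1] by (simp add: order_trans[OF norm_ge_zero])
  have ge1: "\<mu> 1 \<le> \<mu> n" if "n \<ge> 1" for n
    using that mono by (cases "n = 1") (auto simp: strict_mono_on_def less_imp_le)
  \<comment> \<open>Collects everything that does not depend on the radius \<open>M\<close>.\<close>
  define K where "K = C * exp (pi * x + 2 * x * (ln (1 + \<delta>) - ln x) + 4 * \<xi> + 2 * \<xi> / \<beta> * ln (real N))"
  have main: "norm (g (of_real x)) \<le> K * exp (- (2 * \<xi> / \<beta> - 2 * x) * ln (real M + 1))"
    if M: "M \<ge> N" "real M \<ge> 2 * \<xi>" for M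
  proof -
    define R where "R = real M"
    define R' where "R' = R + \<delta>"
    have R: "R > 0" "2 * \<xi> \<le> R" "\<xi> < R" using M \<xi> by (auto simp: R_def)
    define \<Phi> where "\<Phi> = (\<lambda>u. u - 2 / of_real pi * u * (Ln u - of_real (ln R')))"
    \<comment> \<open>The exponential factor turns the bound on \<open>g\<close> into the constant
      \<open>C\<close> on the half disc. The majorant is taken for \<open>R'\<close> because the
      shift by \<open>\<delta>\<close> moves the half disc out of the disc of radius
      \<open>R\<close>.\<close>
    define f where "f = (\<lambda>v. g (v + of_real \<delta>) * exp (- of_real pi * \<Phi> (v + of_real \<delta>)))"
    define \<nu> where "\<nu> = (\<lambda>n. \<mu> n - \<delta>)"
    have \<nu>: "\<xi> < \<nu> n" "\<nu> n < R" "\<nu> n \<le> \<beta> * real n" if "n \<in> {N..M}" for n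
    proof -
      have "\<mu> n \<le> \<beta> * real n" using that N by auto
      then show "\<nu> n \<le> \<beta> * real n" using \<delta> by (simp add: \<nu>_def)
      have "\<beta> * real n \<le> 1 * real M" using that \<beta> by (intro mult_mono) auto
      with \<open>\<mu> n \<le> \<beta> * real n\<close> show "\<nu> n < R" using \<delta> by (simp add: \<nu>_def R_def)
      \<comment> \<open>All zeros lie to the right of the evaluation point because
        \<open>x < \<mu> 1\<close>; this is what \<open>half_disc_factor_bound\<close>
        requires.\<close>
      show "\<xi> < \<nu> n" using ge1[of n] that N x by (auto simp: \<nu>_def \<xi>_def)
    qed
    have injn: "inj_on \<nu> {N..M}"
    proof (rule inj_onI)
      fix i j assume ij: "i \<in> {N..M}" "j \<in> {N..M}" "\<nu> i = \<nu> j"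
      have "inj_on \<mu> {1..}" by (rule strict_mono_on_imp_inj_on[OF mono])
      then show "i = j" using ij N by (auto simp: \<nu>_def inj_on_def)
    qed
    have "norm (f (of_real \<xi>)) \<le> C * (\<Prod>\<nu>\<in>\<nu> ` {N..M}. \<bar>\<xi> - \<nu>\<bar> * (R\<^sup>2 + \<nu> * \<xi>) / ((\<xi> + \<nu>) * (R\<^sup>2 - \<nu> * \<xi>)))"
    proof (rule half_disc_blaschke_bound)
      show "open {v. Re v > - \<delta>}" by (intro open_Collect_less continuous_intros)
      show "{v. 0 \<le> Re v \<and> norm v \<le> R} \<subseteq> {v. Re v > - \<delta>}" using \<delta> by auto
      have "(\<lambda>v. g (v + of_real \<delta>)) holomorphic_on {v. Re v > - \<delta>}"
        by (intro holomorphic_on_compose_gen[OF _ holg, unfolded o_def] holomorphic_intros) auto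
      then show "f holomorphic_on {v. - \<delta> < Re v}"
        unfolding f_def \<Phi>_def
        by (intro holomorphic_intros) (auto simp: complex_nonpos_Reals_iff)
      show "finite (\<nu> ` {N..M})" by simp
      show "\<nu> ` {N..M} \<subseteq> {0<..<R}" using \<nu> \<xi> by fastforce
      show "f (of_real n) = 0" if "n \<in> \<nu> ` {N..M}" for n
        using that zero N by (auto simp: f_def \<nu>_def)
      show "norm (f v) \<le> C" if v: "0 \<le> Re v" "norm v \<le> R" for v
      proof -
        define u where "u = v + of_real \<delta>"
        have u: "Re u > 0" "u \<noteq> 0" using v \<delta> by (auto simp: u_def complex_eq_iff)
        have "norm u \<le> R'" using v \<delta> unfolding u_def R'_def
          by (metis abs_of_pos add_mono_thms_linordered_semiring(1) dual_order.refl norm_of_real norm_triangle_le)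
        then have "\<bar>Im u\<bar> \<le> Re (\<Phi> u)"
          unfolding \<Phi>_def using u by (intro abs_Im_le_majorant) auto
        then have "pi * \<bar>Im u\<bar> \<le> pi * Re (\<Phi> u)" by simp
        have "norm (f v) = norm (g u) * exp (- pi * Re (\<Phi> u))"
          by (simp add: f_def u_def norm_mult)
        also have "\<dots> \<le> C * exp (pi * \<bar>Im u\<bar>) * exp (- pi * Re (\<Phi> u))"
          using bound u by (intro mult_right_mono) auto
        also have "\<dots> = C * exp (pi * \<bar>Im u\<bar> - pi * Re (\<Phi> u))"
          by (simp add: exp_diff exp_minus divide_inverse)
        also have "\<dots> \<le> C * 1"
          using C \<open>pi * \<bar>Im u\<bar> \<le> pi * Re (\<Phi> u)\<close> by (intro mult_left_mono) auto
        finally show ?thesis by simp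
      qed
      show "0 < \<xi>" "\<xi> < R" using \<xi> R by auto
    qed
    also have "(\<Prod>\<nu>\<in>\<nu> ` {N..M}. \<bar>\<xi> - \<nu>\<bar> * (R\<^sup>2 + \<nu> * \<xi>) / ((\<xi> + \<nu>) * (R\<^sup>2 - \<nu> * \<xi>)))
        = (\<Prod>n\<in>{N..M}. \<bar>\<xi> - \<nu> n\<bar> * (R\<^sup>2 + \<nu> n * \<xi>) / ((\<xi> + \<nu> n) * (R\<^sup>2 - \<nu> n * \<xi>)))"
      using injn by (simp add: prod.reindex)
    also have "\<dots> \<le> (\<Prod>n\<in>{N..M}. exp (4 * \<xi> / R - 2 * \<xi> / \<beta> * (1 / real n)))"
    proof (rule prod_mono)
      fix n assume n: "n \<in> {N..M}"
      have n0: "\<nu> n > 0" "real n > 0" using \<nu>[OF n] \<xi> n N by auto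
      have "2 * \<xi> / \<beta> * (1 / real n) \<le> 2 * \<xi> / \<nu> n"
        using \<nu>(3)[OF n] n0 \<beta> \<xi> by (simp add: frac_le)
      then have "exp (4 * \<xi> / R - 2 * \<xi> / \<nu> n) \<le> exp (4 * \<xi> / R - 2 * \<xi> / \<beta> * (1 / real n))"
        by simp
      then show "0 \<le> \<bar>\<xi> - \<nu> n\<bar> * (R\<^sup>2 + \<nu> n * \<xi>) / ((\<xi> + \<nu> n) * (R\<^sup>2 - \<nu> n * \<xi>)) \<and>
         \<bar>\<xi> - \<nu> n\<bar> * (R\<^sup>2 + \<nu> n * \<xi>) / ((\<xi> + \<nu> n) * (R\<^sup>2 - \<nu> n * \<xi>)) \<le> exp (4 * \<xi> / R - 2 * \<xi> / \<beta> * (1 / real n))"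
        using half_disc_factor_bound[OF \<xi>(1) \<nu>(1,2)[OF n] R(2)] by linarith
    qed
    also have "\<dots> = exp (\<Sum>n=N..M. 4 * \<xi> / R - 2 * \<xi> / \<beta> * (1 / real n))"
      by (simp add: exp_sum)
    also have "(\<Sum>n=N..M. 4 * \<xi> / R - 2 * \<xi> / \<beta> * (1 / real n))
        = real (card {N..M}) * (4 * \<xi> / R) - 2 * \<xi> / \<beta> * (\<Sum>n=N..M. 1 / real n)"
      by (simp only: sum_subtractf sum_distrib_left sum_constant)
    finally have "norm (f (of_real \<xi>)) \<le> C * exp (real (card {N..M}) * (4 * \<xi> / R) - 2 * \<xi> / \<beta> * (\<Sum>n=N..M. 1 / real n))"
      using C by (simp add: mult_left_mono)
    also have "\<dots> \<le> C * exp (4 * \<xi> - 2 * \<xi> / \<beta> * (ln (real M + 1) - ln (real N)))"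
    proof -
      have "real (card {N..M}) \<le> R" using N by (simp add: R_def of_nat_diff)
      then have "real (card {N..M}) * (4 * \<xi> / R) \<le> R * (4 * \<xi> / R)"
        using \<xi> R by (intro mult_right_mono) auto
      moreover have "2 * \<xi> / \<beta> * (ln (real M + 1) - ln (real N)) \<le> 2 * \<xi> / \<beta> * (\<Sum>n=N..M. 1 / real n)"
        using ln_le_sum_inverse[OF N(1) M(1)] \<xi> \<beta> by (intro mult_left_mono) auto
      ultimately show ?thesis using R C by (intro mult_left_mono) auto
    qed
    finally have fb: "norm (f (of_real \<xi>)) \<le> C * exp (4 * \<xi> - 2 * \<xi> / \<beta> * (ln (real M + 1) - ln (real N)))" .
    have two: "(2::complex) / of_real pi = of_real (2 / pi)" by simp
    have x0: "x > 0" using x pos by simp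
    have "Re (\<Phi> (of_real x)) = x - 2 / pi * x * (ln x - ln R')"
      unfolding \<Phi>_def two using x0 by (simp add: Ln_of_real del: of_real_divide of_real_mult)
    then have eq: "pi * Re (\<Phi> (of_real x)) = pi * x + 2 * x * (ln R' - ln x)"
      by (simp only:) (simp add: field_simps)
    have xx: "of_real \<xi> + of_real \<delta> = complex_of_real x" by (simp add: \<xi>_def)
    have "norm (g (of_real x)) = norm (f (of_real \<xi>)) * exp (pi * x + 2 * x * (ln R' - ln x))"
      unfolding f_def xx eq[symmetric] by (simp add: norm_mult exp_add[symmetric] mult.assoc)
    also have "\<dots> \<le> (C * exp (4 * \<xi> - 2 * \<xi> / \<beta> * (ln (real M + 1) - ln (real N)))) *
        exp (pi * x + 2 * x * (ln (1 + \<delta>) + ln (real M + 1) - ln x))"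
    proof (intro mult_mono fb)
      have "R' \<le> (1 + \<delta>) * (real M + 1)" using \<delta> by (simp add: R'_def R_def algebra_simps)
      then have "ln R' \<le> ln ((1 + \<delta>) * (real M + 1))" using R \<delta> by (simp add: R'_def)
      also have "\<dots> = ln (1 + \<delta>) + ln (real M + 1)" using \<delta> by (simp add: ln_mult)
      finally show "exp (pi * x + 2 * x * (ln R' - ln x)) \<le> exp (pi * x + 2 * x * (ln (1 + \<delta>) + ln (real M + 1) - ln x))"
        using x0 by simp
    qed (use C in auto)
    also have "\<dots> = K * exp (- (2 * \<xi> / \<beta> - 2 * x) * ln (real M + 1))"
      by (simp add: K_def mult.assoc exp_add[symmetric] algebra_simps)
    finally show ?thesis .
  qed
  define c where "c = 2 * \<xi> / \<beta> - 2 * x"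
  have c: "c > 0" using \<xi> \<beta> by (simp add: c_def field_simps)
  have "(\<lambda>M. K * exp (- c * ln (real M + 1))) \<longlonglongrightarrow> 0"
    using c by real_asymp
  moreover have "eventually (\<lambda>M. norm (g (of_real x)) \<le> K * exp (- c * ln (real M + 1))) sequentially"
    using eventually_ge_at_top[of "max N (nat \<lceil>2 * \<xi>\<rceil>)"]
    by eventually_elim (use main in \<open>auto simp: c_def ceiling_le_iff nat_le_iff\<close>)
  ultimately have "norm (g (of_real x)) \<le> 0"
    by (intro tendsto_lowerbound[of _ 0 sequentially]) auto
  then show ?thesis by simp
qed

text \<open>For w = s^2 one has 2 (Im s)^2 = \<bar>w\<bar> - Re w \<le> \<bar>Im w\<bar> when Re w >
  0, so the Gaussian bound becomes an exponential one. The number \<open>b\<close> strictly between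
  \<open>a\<close> and 1 turns the limit into an eventual linear bound on the squares. The
  half-plane result yields zeros only on an interval, and the identity theorem extends them to the
  plane.\<close>

theorem zero_on_positive_sequence_imp_zero:
  fixes D :: "complex \<Rightarrow> complex" and lam :: "nat \<Rightarrow> real"
  assumes holD: "D holomorphic_on UNIV"
    and bound: "\<And>s. norm (D s) \<le> C * exp (2 * pi * (Im s)\<^sup>2)"
    and zero: "\<And>n. n \<ge> 1 \<Longrightarrow> D (of_real (lam n)) = 0"
    and pos: "\<And>n. n \<ge> 1 \<Longrightarrow> lam n > 0" and mono: "strict_mono_on {1..} lam"
    and lim: "(\<lambda>n. lam n / sqrt (real n)) \<longlonglongrightarrow> a" and a: "a < 1"
  shows "D s = 0"
proof -
  have a0: "a \<ge> 0"
    by (rule tendsto_lowerbound[OF lim]) (auto intro!: eventually_sequentiallyI[of 1] divide_nonneg_nonneg less_imp_le[OF pos])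
  define b where "b = (a + 1) / 2"
  have b: "0 < b" "b < 1" "a < b" using a a0 by (auto simp: b_def)
  obtain N0 where N0: "\<And>n. n \<ge> N0 \<Longrightarrow> lam n / sqrt (real n) < b"
    using order_tendstoD(2)[OF lim b(3)] by (auto simp: eventually_sequentially)
  define N where "N = max 1 N0"
  define g where "g = (\<lambda>w. D (csqrt w))"
  define \<mu> where "\<mu> = (\<lambda>n. (lam n)\<^sup>2)"
  have gx: "g (of_real x) = 0" if x: "\<mu> 1 / 2 < x" "x < \<mu> 1" for x
  proof (rule carlson_half_plane[where C = C and \<mu> = \<mu> and \<beta> = "b\<^sup>2" and N = N])
    show "g holomorphic_on {u. 0 < Re u}"
      unfolding g_def
      by (intro holomorphic_on_compose_gen[OF _ holD, unfolded o_def] holomorphic_intros)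
        (auto simp: complex_nonpos_Reals_iff)
    show "norm (g u) \<le> C * exp (pi * \<bar>Im u\<bar>)" if "Re u > 0" for u
    proof -
      have C0: "C \<ge> 0" using bound[of 0] by (simp add: order_trans[OF norm_ge_zero])
      have "(Im (csqrt u))\<^sup>2 = (norm u - Re u) / 2"
        using complex_Re_le_cmod[of u] by (simp add: power_mult_distrib sgn_if)
      moreover have "norm u \<le> Re u + \<bar>Im u\<bar>" using cmod_le[of u] that by simp
      ultimately have "2 * pi * (Im (csqrt u))\<^sup>2 \<le> pi * \<bar>Im u\<bar>" by simp
      then have "C * exp (2 * pi * (Im (csqrt u))\<^sup>2) \<le> C * exp (pi * \<bar>Im u\<bar>)"
        using C0 by (intro mult_left_mono) auto
      with bound[of "csqrt u"] show ?thesis unfolding g_def by linarith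
    qed
    show "g (of_real (\<mu> n)) = 0" if "n \<ge> 1" for n
    proof -
      have "csqrt (of_real (\<mu> n)) = of_real (lam n)"
        using pos[OF that] by (simp add: \<mu>_def csqrt_square)
      then show ?thesis using zero[OF that] by (simp add: g_def)
    qed
    show "strict_mono_on {1..} \<mu>"
      using mono pos unfolding strict_mono_on_def \<mu>_def by (auto intro!: power_strict_mono less_imp_le)
    show "\<mu> 1 > 0" using pos[of 1] by (simp add: \<mu>_def)
    show "0 < b\<^sup>2" "b\<^sup>2 < 1" using b by (auto simp: power_less_one_iff abs_square_less_1)
    show "N \<ge> 1" by (simp add: N_def)
    show "\<mu> n \<le> b\<^sup>2 * real n" if "n \<ge> N" for n
    proof -
      have n: "n \<ge> 1" "n \<ge> N0" using that by (auto simp: N_def)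
      then have "lam n \<le> b * sqrt (real n)" using N0[OF n(2)] by (simp add: field_simps)
      then have "(lam n)\<^sup>2 \<le> (b * sqrt (real n))\<^sup>2" using pos[OF n(1)] by (intro power_mono) auto
      then show ?thesis by (simp add: \<mu>_def power_mult_distrib)
    qed
  qed (use x in auto)
  define m where "m = \<mu> 1"
  have m: "m > 0" using pos[of 1] by (simp add: m_def \<mu>_def)
  define I where "I = {sqrt (m / 2)<..<sqrt m}"
  define p where "p = (sqrt (m / 2) + sqrt m) / 2"
  have "sqrt (m / 2) < sqrt m" using m by simp
  then have p: "p \<in> I" by (simp add: I_def p_def)
  have I0: "D (of_real y) = 0" if "y \<in> I" for y
  proof -
    have y: "sqrt (m / 2) < y" "y < sqrt m" "y > 0" using that m by (auto simp: I_def intro: less_trans[of 0 "sqrt (m / 2)"])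
    have "(sqrt (m / 2))\<^sup>2 < y\<^sup>2" using y m by (intro power_strict_mono) auto
    moreover have "y\<^sup>2 < (sqrt m)\<^sup>2" using y m by (intro power_strict_mono) auto
    ultimately have "g (of_real (y\<^sup>2)) = 0" using m by (intro gx) (auto simp: m_def)
    then show ?thesis using y by (simp add: g_def csqrt_square)
  qed
  show ?thesis
  proof (rule analytic_continuation[of D UNIV "of_real ` I" "of_real p"])
    have "p islimpt I" using p by (intro open_imp_islimpt) (auto simp: I_def)
    then show "complex_of_real p islimpt of_real ` I"
      by (auto simp: islimpt_approachable dist_of_real)
  qed (use holD I0 in auto)
qed

section \<open>Equal moduli on three parallel lines\<close>

text \<open>Entire functions have no zero divisors: \<open>f\<close> vanishes on the nonempty open
  set where \<open>g\<close> does not. This permits cancelling in cross-multiplied identities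
  instead of handling the poles of quotients.\<close>

lemma holomorphic_mult_eq_0:
  fixes f g :: "complex \<Rightarrow> complex"
  assumes "f holomorphic_on UNIV" "g holomorphic_on UNIV" "\<And>z. f z * g z = 0"
    and "g w \<noteq> 0"
  shows "f z = 0"
proof -
  have "continuous_on UNIV g" using assms(2) by (rule holomorphic_on_imp_continuous_on)
  then have "open (g -` (- {0}))" by (rule open_vimage[rotated]) auto
  moreover have "w \<in> g -` (- {0})" using assms(4) by simp
  ultimately have "w islimpt g -` (- {0})" by (rule open_imp_islimpt)
  from analytic_continuation[OF assms(1) open_UNIV connected_UNIV _ _ this] show ?thesis
    using assms(3) by auto
qed

text \<open>The periods of \<open>P / Q\<close> form a group. Dirichlet approximation of the
  irrational \<open>p / q\<close> produces arbitrarily small nonzero integer combinations of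
  \<open>p\<close> and \<open>q\<close>, so the periods accumulate at 0. The periodicity defect is
  entire in the shift, hence vanishes for every complex shift.\<close>

lemma entire_ratio_const_of_incommensurable_periods:
  fixes P Q :: "complex \<Rightarrow> complex" and p q :: real
  assumes hol: "P holomorphic_on UNIV" "Q holomorphic_on UNIV"
    and nz: "P w \<noteq> 0" "Q w' \<noteq> 0"
    and p: "\<And>s. P s * Q (s - \<i> * of_real p) = Q s * P (s - \<i> * of_real p)"
    and q: "\<And>s. P s * Q (s - \<i> * of_real q) = Q s * P (s - \<i> * of_real q)"
    and irrat: "p / q \<notin> \<rat>"
  shows "P s * Q s' = Q s * P s'"
proof -
  define T where "T = {\<tau>::real. \<forall>s. P s * Q (s - \<i> * of_real \<tau>) = Q s * P (s - \<i> * of_real \<tau>)}"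
  have q0: "q \<noteq> 0" using irrat by auto
  have neg: "- \<tau> \<in> T" if "\<tau> \<in> T" for \<tau>
  proof -
    have "P s * Q (s + \<i> * of_real \<tau>) = Q s * P (s + \<i> * of_real \<tau>)" for s
      using that[unfolded T_def, simplified, rule_format, of "s + \<i> * of_real \<tau>"] by (simp add: mult.commute)
    then show ?thesis by (simp add: T_def)
  qed
  have add: "\<tau> + \<tau>' \<in> T" if t: "\<tau> \<in> T" "\<tau>' \<in> T" for \<tau> \<tau>'
  proof -
    define P1 where "P1 = (\<lambda>s. P (s - \<i> * of_real \<tau>))"
    define Q1 where "Q1 = (\<lambda>s. Q (s - \<i> * of_real \<tau>))"
    define P2 where "P2 = (\<lambda>s. P (s - \<i> * of_real (\<tau> + \<tau>')))"
    define Q2 where "Q2 = (\<lambda>s. Q (s - \<i> * of_real (\<tau> + \<tau>')))"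
    have hol': "P1 holomorphic_on UNIV" "Q1 holomorphic_on UNIV" "P2 holomorphic_on UNIV" "Q2 holomorphic_on UNIV"
      unfolding P1_def Q1_def P2_def Q2_def
      by (intro holomorphic_on_compose_gen[OF _ hol(1), unfolded o_def]
          holomorphic_on_compose_gen[OF _ hol(2), unfolded o_def] holomorphic_intros; simp)+
    have 1: "P s * Q1 s = Q s * P1 s" for s using t(1) by (simp add: T_def P1_def Q1_def)
    have 2: "P1 s * Q2 s = Q1 s * P2 s" for s
    proof -
      have "s - \<i> * of_real \<tau> - \<i> * of_real \<tau>' = s - \<i> * of_real (\<tau> + \<tau>')" by (simp add: algebra_simps)
      then show ?thesis
        using t(2)[unfolded T_def, simplified, rule_format, of "s - \<i> * of_real \<tau>"]
        by (simp only: P1_def Q1_def P2_def Q2_def)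
    qed
    have nz': "P1 (w + \<i> * of_real \<tau>) \<noteq> 0" "Q1 (w' + \<i> * of_real \<tau>) \<noteq> 0"
      using nz by (auto simp: P1_def Q1_def)
    \<comment> \<open>The intermediate functions \<open>P1\<close> and \<open>Q1\<close> are
      eliminated by multiplying with both and cancelling one after the other.\<close>
    have "P s * Q2 s - Q s * P2 s = 0" for s
    proof (rule holomorphic_mult_eq_0[of "\<lambda>s. P s * Q2 s - Q s * P2 s" P1])
      show "(\<lambda>s. P s * Q2 s - Q s * P2 s) holomorphic_on UNIV" by (intro holomorphic_intros hol hol')
      fix s
      show "(P s * Q2 s - Q s * P2 s) * P1 s = 0"
      proof (rule holomorphic_mult_eq_0[of "\<lambda>s. (P s * Q2 s - Q s * P2 s) * P1 s" Q1])
        show "(\<lambda>s. (P s * Q2 s - Q s * P2 s) * P1 s) holomorphic_on UNIV" by (intro holomorphic_intros hol hol')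
        fix s
        have "(P s * Q2 s - Q s * P2 s) * P1 s * Q1 s = (P s * Q1 s) * (P1 s * Q2 s) - (Q s * P1 s) * (Q1 s * P2 s)"
          by (simp add: algebra_simps)
        also have "\<dots> = 0" by (simp add: 1 2)
        finally show "(P s * Q2 s - Q s * P2 s) * P1 s * Q1 s = 0" .
      qed (use hol' nz' in auto)
    qed (use hol' nz' in auto)
    then show ?thesis by (simp add: T_def P2_def Q2_def)
  qed
  have nat: "of_nat k * \<tau> \<in> T" if "\<tau> \<in> T" for k \<tau>
  proof (induction k)
    case 0
    show ?case by (simp add: T_def mult.commute)
  next
    case (Suc k)
    then show ?case using add[OF that Suc] by (simp add: algebra_simps)
  qed
  have int: "of_int k * \<tau> \<in> T" if "\<tau> \<in> T" for k \<tau>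
  proof (cases "k \<ge> 0")
    case True then show ?thesis using nat[OF that, of "nat k"] by simp
  next
    case False then show ?thesis using neg[OF nat[OF that, of "nat (- k)"]] by simp
  qed
  have T: "p \<in> T" "q \<in> T" using p q by (auto simp: T_def)
  have small: "\<exists>\<tau>\<in>T. \<tau> \<noteq> 0 \<and> \<bar>\<tau>\<bar> < e" if "e > 0" for e
  proof -
    obtain N :: nat where N: "N > 0" "\<bar>q\<bar> / e < real N"
      using reals_Archimedean2[of "max 1 (\<bar>q\<bar> / e)"] by (metis max_less_iff_conj of_nat_0_less_iff less_trans zero_less_one)
    obtain h k where hk: "0 < k" "\<bar>of_int k * (p / q) - of_int h\<bar> < 1 / real N"
      using Dirichlet_approx[OF N(1), of "p / q"] by blast
    define \<tau> where "\<tau> = of_int k * p + of_int (- h) * q"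
    have eq: "\<tau> = q * (of_int k * (p / q) - of_int h)" using q0 by (simp add: \<tau>_def field_simps)
    have "of_int k * (p / q) - of_int h \<noteq> 0"
    proof
      assume "of_int k * (p / q) - of_int h = 0"
      then have "p / q = of_int h / of_int k" using hk(1) by (simp add: field_simps)
      then show False using irrat by simp
    qed
    then have "\<tau> \<noteq> 0" using q0 eq by simp
    moreover have "\<tau> \<in> T" unfolding \<tau>_def by (intro add int T)
    moreover have "\<bar>\<tau>\<bar> < e"
    proof -
      have "\<bar>\<tau>\<bar> < \<bar>q\<bar> * (1 / real N)"
        unfolding eq abs_mult using hk q0 by (intro mult_strict_left_mono) auto
      also have "\<dots> \<le> e" using N that by (simp add: field_simps)
      finally show ?thesis .
    qed
    ultimately show ?thesis by blast
  qed
  \<comment> \<open>The shift is the variable and \<open>s\<close> is fixed; \<open>\<phi>\<close>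
    vanishes on the imaginary multiples of \<open>T\<close>.\<close>
  define \<phi> where "\<phi> = (\<lambda>z. P s * Q (s - z) - Q s * P (s - z))"
  have "\<phi> holomorphic_on UNIV"
    unfolding \<phi>_def
    by (intro holomorphic_on_compose_gen[OF _ hol(1), unfolded o_def]
          holomorphic_on_compose_gen[OF _ hol(2), unfolded o_def] holomorphic_intros; simp)
  then have "\<phi> (s - s') = 0"
  proof (rule analytic_continuation[of \<phi> UNIV "(\<lambda>\<tau>. \<i> * of_real \<tau>) ` T" 0])
    show "(0::complex) islimpt (\<lambda>\<tau>. \<i> * of_real \<tau>) ` T"
      unfolding islimpt_approachable
    proof (intro allI impI)
      fix e :: real assume "e > 0"
      then obtain \<tau> where "\<tau> \<in> T" "\<tau> \<noteq> 0" "\<bar>\<tau>\<bar> < e" using small by blast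
      then show "\<exists>x'\<in>(\<lambda>\<tau>. \<i> * of_real \<tau>) ` T. x' \<noteq> (0::complex) \<and> dist x' 0 < e"
        by (intro bexI[of _ "\<i> * of_real \<tau>"]) (auto simp: norm_mult)
    qed
  qed (auto simp: \<phi>_def T_def)
  then show ?thesis by (simp add: \<phi>_def)
qed

lemma holomorphic_on_reflect:
  assumes "f holomorphic_on UNIV"
  shows "(\<lambda>z. cnj (f (cnj z))) holomorphic_on UNIV"
  using holomorphic_on_compose_cnj_cnj[of f UNIV] assms holomorphic_on_subset[OF assms subset_UNIV] by (simp add: o_def)

text \<open>The reflections in two parallel lines compose to a translation, so the quotient of \<open>A1\<close>
  and \<open>A2\<close> is periodic with two incommensurable periods.\<close>

lemma entire_eq_unimodular_multiple:
  fixes A1 A2 :: "complex \<Rightarrow> complex" and \<sigma>1 \<sigma>2 :: complex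
  assumes hol: "A1 holomorphic_on UNIV" "A2 holomorphic_on UNIV"
    and eq0: "\<And>s. A1 s * cnj (A1 (cnj s)) = A2 s * cnj (A2 (cnj s))"
    and eq1: "\<And>s. A1 (s + \<sigma>1) * cnj (A1 (cnj s + \<sigma>1)) = A2 (s + \<sigma>1) * cnj (A2 (cnj s + \<sigma>1))"
    and eq2: "\<And>s. A1 (s + \<sigma>2) * cnj (A1 (cnj s + \<sigma>2)) = A2 (s + \<sigma>2) * cnj (A2 (cnj s + \<sigma>2))"
    and irrat: "Im \<sigma>1 / Im \<sigma>2 \<notin> \<rat>"
  shows "\<exists>c. norm c = 1 \<and> (\<forall>s. A1 s = c * A2 s)"
proof (cases "(\<forall>s. A1 s = 0) \<or> (\<forall>s. A2 s = 0)")
  case True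
  \<comment> \<open>If one function vanishes identically, the other one times its reflection is
    zero, so it vanishes too.\<close>
  have 1: "(\<forall>s. B1 s = 0)" if "\<And>s. B1 s * cnj (B1 (cnj s)) = B2 s * cnj (B2 (cnj s))"
    "B1 holomorphic_on UNIV" "\<forall>s. B2 s = 0" for B1 B2 :: "complex \<Rightarrow> complex"
  proof (rule ccontr)
    assume "\<not> (\<forall>s. B1 s = 0)"
    then obtain w where w: "B1 w \<noteq> 0" by blast
    have "B1 z = 0" for z
      by (rule holomorphic_mult_eq_0[of B1 "\<lambda>z. cnj (B1 (cnj z))" "cnj w"])
        (use that w holomorphic_on_reflect in auto)
    then show False using w by simp
  qed
  have "(\<forall>s. A1 s = 0)" "(\<forall>s. A2 s = 0)"
    using True 1[of A1 A2] 1[of A2 A1] eq0 hol by metis+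
  then show ?thesis by (intro exI[of _ 1]) auto
next
  case False
  then obtain w1 w2 where w: "A1 w1 \<noteq> 0" "A2 w2 \<noteq> 0" by blast
  \<comment> \<open>The reflections in the real axis: \<open>eq0\<close> becomes
    \<open>A1 * P = A2 * Q\<close>.\<close>
  define P where "P = (\<lambda>z. cnj (A1 (cnj z)))"
  define Q where "Q = (\<lambda>z. cnj (A2 (cnj z)))"
  have holPQ: "P holomorphic_on UNIV" "Q holomorphic_on UNIV"
    unfolding P_def Q_def by (intro holomorphic_on_reflect hol)+
  have PQ0: "A1 s * P s = A2 s * Q s" for s using eq0 by (simp add: P_def Q_def)
  \<comment> \<open>Reflection in the horizontal line through \<open>\<sigma>\<close> sends s to cnj
    s + 2 \<i> Im \<sigma>. Hence \<open>eq\<close> pairs \<open>A1\<close> with a translate of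
    \<open>P\<close> and \<open>A2\<close> with the same translate of \<open>Q\<close>; comparison
    with \<open>PQ0\<close> and cancelling \<open>A1\<close> and \<open>A2\<close> gives the
    period.\<close>
  have period: "P s * Q (s - \<i> * of_real (2 * Im \<sigma>)) = Q s * P (s - \<i> * of_real (2 * Im \<sigma>))"
    if eq: "\<And>s. A1 (s + \<sigma>) * cnj (A1 (cnj s + \<sigma>)) = A2 (s + \<sigma>) * cnj (A2 (cnj s + \<sigma>))" for \<sigma> s
  proof -
    define P1 where "P1 = (\<lambda>s. P (s - \<i> * of_real (2 * Im \<sigma>)))"
    define Q1 where "Q1 = (\<lambda>s. Q (s - \<i> * of_real (2 * Im \<sigma>)))"
    have PQ1: "A1 s * P1 s = A2 s * Q1 s" for s
    proof -
      have "cnj (s - \<i> * of_real (2 * Im \<sigma>)) = cnj (s - \<sigma>) + \<sigma>" by (simp add: complex_eq_iff)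
      then show ?thesis using eq[of "s - \<sigma>"] by (simp only: P1_def Q1_def P_def Q_def diff_add_cancel)
    qed
    have hol1: "P1 holomorphic_on UNIV" "Q1 holomorphic_on UNIV"
      unfolding P1_def Q1_def
      by (intro holomorphic_on_compose_gen[OF _ holPQ(1), unfolded o_def]
          holomorphic_on_compose_gen[OF _ holPQ(2), unfolded o_def] holomorphic_intros; simp)+
    have "P s * Q1 s - Q s * P1 s = 0" for s
    proof (rule holomorphic_mult_eq_0[of "\<lambda>s. P s * Q1 s - Q s * P1 s" A1])
      show "(\<lambda>s. P s * Q1 s - Q s * P1 s) holomorphic_on UNIV" by (intro holomorphic_intros holPQ hol1)
      fix s
      show "(P s * Q1 s - Q s * P1 s) * A1 s = 0"
      proof (rule holomorphic_mult_eq_0[of "\<lambda>s. (P s * Q1 s - Q s * P1 s) * A1 s" A2])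
        show "(\<lambda>s. (P s * Q1 s - Q s * P1 s) * A1 s) holomorphic_on UNIV" by (intro holomorphic_intros holPQ hol1 hol)
        fix s
        have "(P s * Q1 s - Q s * P1 s) * A1 s * A2 s = (A1 s * P s) * (A2 s * Q1 s) - (A2 s * Q s) * (A1 s * P1 s)"
          by (simp add: algebra_simps)
        also have "\<dots> = 0" by (simp add: PQ0 PQ1)
        finally show "(P s * Q1 s - Q s * P1 s) * A1 s * A2 s = 0" .
      qed (use hol w in auto)
    qed (use hol w in auto)
    then show ?thesis by (simp add: P1_def Q1_def)
  qed
  have nzPQ: "P (cnj w1) \<noteq> 0" "Q (cnj w2) \<noteq> 0" using w by (auto simp: P_def Q_def)
  have const: "P s * Q s' = Q s * P s'" for s s'
    by (rule entire_ratio_const_of_incommensurable_periods[OF holPQ nzPQ period[OF eq1] period[OF eq2]])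
      (use irrat in simp)
  define d where "d = P (cnj w2) / Q (cnj w2)"
  have P: "P s = d * Q s" for s
    using const[of s "cnj w2"] nzPQ(2) by (simp add: d_def field_simps)
  have A1: "A1 s = cnj d * A2 s" for s
    using P[of "cnj s"] by (simp add: P_def Q_def) (metis complex_cnj_cnj complex_cnj_mult)
  \<comment> \<open>Inserting both proportionalities into \<open>PQ0\<close> forces the constant to
    be unimodular.\<close>
  have "A2 s * Q s * (d * cnj d - 1) = 0" for s
    using PQ0[of s] by (simp add: A1 P algebra_simps)
  moreover have "\<exists>s. A2 s * Q s \<noteq> 0"
    using holomorphic_mult_eq_0[of A2 Q "cnj w2" w2] hol holPQ nzPQ w by blast
  ultimately have "d * cnj d = 1" by auto
  then have "(norm d)\<^sup>2 = 1" using complex_norm_square[of d] by (metis of_real_eq_1_iff)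
  then have "norm d = 1" using norm_ge_zero[of d] by (auto simp: power2_eq_1_iff simp del: norm_ge_zero)
  then show ?thesis using A1 by (intro exI[of _ "cnj d"]) auto
qed

section \<open>The Bargmann transform\<close>

lemma gaussian_integral:
  fixes c t :: real
  assumes "c > 0"
  shows "integrable lborel (\<lambda>x. exp (- c * (x - t)\<^sup>2))"
    and "(\<integral>x. exp (- c * (x - t)\<^sup>2) \<partial>lborel) = sqrt (pi / c)"
proof -
  define \<sigma> where "\<sigma> = sqrt (1 / (2 * c))"
  have \<sigma>: "\<sigma> > 0" "\<sigma>\<^sup>2 = 1 / (2 * c)" using assms by (auto simp: \<sigma>_def)
  have eq: "exp (- c * (x - t)\<^sup>2) = sqrt (pi / c) * normal_density t \<sigma> x" for x
    using assms by (simp add: normal_density_def \<sigma> real_sqrt_divide)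
  show "integrable lborel (\<lambda>x. exp (- c * (x - t)\<^sup>2))"
    unfolding eq using \<sigma> by (intro integrable_mult_right) simp
  show "(\<integral>x. exp (- c * (x - t)\<^sup>2) \<partial>lborel) = sqrt (pi / c)"
    unfolding eq using \<sigma> by simp
qed

text \<open>From 2 a b \<le> a^2 + b^2. The bound does not depend on \<open>t\<close>, since all
  translates of the squared Gaussian have the same integral; the growth of the transform is then
  governed by the factor exp (\<pi> (Re z)^2) alone.\<close>

lemma square_integrable_times_gaussian:
  assumes "square_integrable f"
  shows "integrable lebesgue (\<lambda>x. cmod (f x) * exp (- pi * (x - t)\<^sup>2))"
    and "(\<integral>x. cmod (f x) * exp (- pi * (x - t)\<^sup>2) \<partial>lebesgue) \<le> (\<integral>x. (cmod (f x))\<^sup>2 \<partial>lebesgue) + 1"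
proof -
  have f: "f \<in> borel_measurable lebesgue" "integrable lebesgue (\<lambda>x. (cmod (f x))\<^sup>2)"
    using assms by (auto simp: square_integrable_def)
  have g: "integrable lebesgue (\<lambda>x. exp (- (2 * pi) * (x - t)\<^sup>2))"
    "(\<integral>x. exp (- (2 * pi) * (x - t)\<^sup>2) \<partial>lebesgue) = sqrt (pi / (2 * pi))"
    using gaussian_integral[of "2 * pi" t]
    by (simp_all add: integrable_completion integral_completion)
  have sum: "integrable lebesgue (\<lambda>x. (cmod (f x))\<^sup>2 + exp (- (2 * pi) * (x - t)\<^sup>2))"
    using f g by simp
  have le: "cmod (f x) * exp (- pi * (x - t)\<^sup>2) \<le> (cmod (f x))\<^sup>2 + exp (- (2 * pi) * (x - t)\<^sup>2)" for x
  proof -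
    have "2 * (cmod (f x) * exp (- pi * (x - t)\<^sup>2)) \<le> (cmod (f x))\<^sup>2 + (exp (- pi * (x - t)\<^sup>2))\<^sup>2"
      using sum_squares_bound[of "cmod (f x)" "exp (- pi * (x - t)\<^sup>2)"] by simp
    also have "(exp (- pi * (x - t)\<^sup>2))\<^sup>2 = exp (- (2 * pi) * (x - t)\<^sup>2)"
      by (simp add: power2_eq_square exp_add[symmetric])
    finally have "2 * (cmod (f x) * exp (- pi * (x - t)\<^sup>2)) \<le> (cmod (f x))\<^sup>2 + exp (- (2 * pi) * (x - t)\<^sup>2)" .
    moreover have "0 \<le> cmod (f x) * exp (- pi * (x - t)\<^sup>2)" by simp
    ultimately show ?thesis by linarith
  qed
  have [measurable]: "f \<in> borel_measurable lebesgue" by (fact f)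
  have m: "(\<lambda>x. exp (- pi * (x - t)\<^sup>2)) \<in> borel_measurable lebesgue"
    by (intro measurable_completion) measurable
  show i: "integrable lebesgue (\<lambda>x. cmod (f x) * exp (- pi * (x - t)\<^sup>2))"
    by (rule Bochner_Integration.integrable_bound[OF sum])
      (use m le in \<open>auto intro!: AE_I2 simp: abs_of_nonneg add_nonneg_nonneg\<close>)
  have "(\<integral>x. cmod (f x) * exp (- pi * (x - t)\<^sup>2) \<partial>lebesgue)
      \<le> (\<integral>x. (cmod (f x))\<^sup>2 + exp (- (2 * pi) * (x - t)\<^sup>2) \<partial>lebesgue)"
    by (rule integral_mono[OF i sum le])
  also have "\<dots> = (\<integral>x. (cmod (f x))\<^sup>2 \<partial>lebesgue) + sqrt (pi / (2 * pi))"
    using f g by simp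
  also have "sqrt (pi / (2 * pi)) \<le> 1" by (simp add: real_sqrt_le_1_iff)
  finally show "(\<integral>x. cmod (f x) * exp (- pi * (x - t)\<^sup>2) \<partial>lebesgue) \<le> (\<integral>x. (cmod (f x))\<^sup>2 \<partial>lebesgue) + 1"
    by simp
qed

text \<open>The Bargmann transform without its usual factor \<open>2 powr (1 / 4) * exp (- \<pi> z\<^sup>2 / 2)\<close>.\<close>

definition bargmann :: "(real \<Rightarrow> complex) \<Rightarrow> complex \<Rightarrow> complex" where
  "bargmann f z = (LINT x|lebesgue. f x * exp (of_real (- pi * x\<^sup>2) + of_real (2 * pi * x) * z))"

lemma norm_bargmann_kernel:
  "cmod (exp (of_real (- pi * x\<^sup>2) + of_real (2 * pi * x) * z)) = exp (pi * (Re z)\<^sup>2) * exp (- pi * (x - Re z)\<^sup>2)"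
  by (simp add: exp_add[symmetric] power2_eq_square algebra_simps)

lemma borel_measurable_bargmann_kernel:
  "(\<lambda>x. exp (complex_of_real (- pi * x\<^sup>2) + of_real (2 * pi * x) * z)) \<in> borel_measurable lebesgue"
  by (intro measurable_completion) measurable

lemma bargmann_integrable:
  assumes "square_integrable f"
  shows "integrable lebesgue (\<lambda>x. f x * exp (of_real (- pi * x\<^sup>2) + of_real (2 * pi * x) * z))"
proof (rule Bochner_Integration.integrable_bound)
  show "integrable lebesgue (\<lambda>x. exp (pi * (Re z)\<^sup>2) * (cmod (f x) * exp (- pi * (x - Re z)\<^sup>2)))"
    using square_integrable_times_gaussian[OF assms] by simp
  show "(\<lambda>x. f x * exp (complex_of_real (- pi * x\<^sup>2) + complex_of_real (2 * pi * x) * z)) \<in> borel_measurable lebesgue"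
    using assms borel_measurable_bargmann_kernel unfolding square_integrable_def
    by (intro borel_measurable_times) auto
qed (simp only: norm_mult norm_bargmann_kernel, simp)

lemma norm_bargmann_le:
  assumes "square_integrable f"
  shows "cmod (bargmann f z) \<le> ((\<integral>x. (cmod (f x))\<^sup>2 \<partial>lebesgue) + 1) * exp (pi * (Re z)\<^sup>2)"
proof -
  have "cmod (bargmann f z) \<le> (\<integral>x. cmod (f x * exp (of_real (- pi * x\<^sup>2) + of_real (2 * pi * x) * z)) \<partial>lebesgue)"
    unfolding bargmann_def by (rule integral_norm_bound)
  also have "\<dots> = (\<integral>x. exp (pi * (Re z)\<^sup>2) * (cmod (f x) * exp (- pi * (x - Re z)\<^sup>2)) \<partial>lebesgue)"
    by (simp only: norm_mult norm_bargmann_kernel mult.left_commute)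
  also have "\<dots> = exp (pi * (Re z)\<^sup>2) * (\<integral>x. cmod (f x) * exp (- pi * (x - Re z)\<^sup>2) \<partial>lebesgue)"
    by simp
  also have "\<dots> \<le> exp (pi * (Re z)\<^sup>2) * ((\<integral>x. (cmod (f x))\<^sup>2 \<partial>lebesgue) + 1)"
    by (intro mult_left_mono square_integrable_times_gaussian[OF assms]) auto
  finally show ?thesis by (simp add: mult.commute)
qed

lemma gabor_transform_eq_bargmann:
  "gabor_transform f (t, \<omega>) = exp (of_real (- pi * t\<^sup>2)) * bargmann f (of_real t - \<i> * of_real \<omega>)"
proof -
  have "of_real (gauss (x - t)) * exp (- 2 * of_real pi * \<i> * of_real x * of_real \<omega>)
      = exp (of_real (- pi * t\<^sup>2)) * exp (of_real (- pi * x\<^sup>2) + of_real (2 * pi * x) * (of_real t - \<i> * of_real \<omega>))" for x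
    unfolding gauss_def exp_of_real[symmetric] exp_add[symmetric]
    by (simp add: power2_eq_square algebra_simps)
  then have "gabor_transform f (t, \<omega>) =
    (LINT x|lebesgue. exp (of_real (- pi * t\<^sup>2)) * (f x * exp (of_real (- pi * x\<^sup>2) + of_real (2 * pi * x) * (of_real t - \<i> * of_real \<omega>))))"
    unfolding gabor_transform_def by (simp only: prod.case mult.assoc mult.left_commute)
  then show ?thesis
    unfolding bargmann_def by (simp only: integral_mult_right_zero)
qed

lemma norm_gabor_transform:
  "cmod (gabor_transform f (t, \<omega>)) = exp (- pi * t\<^sup>2) * cmod (bargmann f (of_real t - \<i> * of_real \<omega>))"
  by (simp add: gabor_transform_eq_bargmann norm_mult)

text \<open>Expanding exp (2 \<pi> x z) and integrating termwise gives an everywhere convergent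
  power series with coefficients \<open>c\<close>. The series of absolute values sums to a factor
  exp (\<bar>2 \<pi> x\<bar> r), which is at most the sum of the kernels' exponentials at
  \<open>r\<close> and \<open>- r\<close>, and these are integrable against \<open>f\<close> times
  the Gaussian.\<close>

lemma holomorphic_bargmann:
  assumes sq: "square_integrable f"
  shows "bargmann f holomorphic_on UNIV"
proof -
  define c where "c = (\<lambda>k. LINT x|lebesgue. f x * exp (of_real (- pi * x\<^sup>2)) * of_real ((2 * pi * x) ^ k / fact k))"
  have f [measurable]: "f \<in> borel_measurable lebesgue" using sq by (simp add: square_integrable_def)
  have "(\<lambda>k. c k * (z - 0) ^ k) sums bargmann f z" for z
  proof -
    define r where "r = norm z"
    define h where "h = (\<lambda>k x. f x * exp (of_real (- pi * x\<^sup>2)) * (of_real (2 * pi * x) * z) ^ k /\<^sub>R fact k)"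
    have int: "integrable lebesgue (\<lambda>x. cmod (f x) * exp (- pi * x\<^sup>2) * exp (\<bar>2 * pi * x\<bar> * r))"
    proof (rule Bochner_Integration.integrable_bound)
      show "integrable lebesgue (\<lambda>x. cmod (f x * exp (of_real (- pi * x\<^sup>2) + of_real (2 * pi * x) * of_real r))
          + cmod (f x * exp (of_real (- pi * x\<^sup>2) + of_real (2 * pi * x) * of_real (- r))))"
        by (intro Bochner_Integration.integrable_add integrable_norm bargmann_integrable sq)
      have "(\<lambda>x. exp (- pi * x\<^sup>2) * exp (\<bar>2 * pi * x\<bar> * r)) \<in> borel_measurable lebesgue"
        by (intro measurable_completion) measurable
      moreover have "(\<lambda>x. cmod (f x)) \<in> borel_measurable lebesgue" by measurable
      ultimately have "(\<lambda>x. cmod (f x) * (exp (- pi * x\<^sup>2) * exp (\<bar>2 * pi * x\<bar> * r))) \<in> borel_measurable lebesgue"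
        by (rule borel_measurable_times[rotated])
      then       show "(\<lambda>x. cmod (f x) * exp (- pi * x\<^sup>2) * exp (\<bar>2 * pi * x\<bar> * r)) \<in> borel_measurable lebesgue"
        by (simp only: mult.assoc)
      show "AE x in lebesgue. norm (cmod (f x) * exp (- pi * x\<^sup>2) * exp (\<bar>2 * pi * x\<bar> * r))
          \<le> norm (cmod (f x * exp (of_real (- pi * x\<^sup>2) + of_real (2 * pi * x) * of_real r))
          + cmod (f x * exp (of_real (- pi * x\<^sup>2) + of_real (2 * pi * x) * of_real (- r))))"
      proof (rule AE_I2)
        fix x :: real
        have n: "cmod (f x * exp (of_real (- pi * x\<^sup>2) + of_real (2 * pi * x) * of_real s))
            = cmod (f x) * exp (- pi * x\<^sup>2) * exp (2 * pi * x * s)" for s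
          by (simp add: norm_mult mult.assoc exp_add[symmetric])
        have "exp (\<bar>2 * pi * x\<bar> * r) \<le> exp (2 * pi * x * r) + exp (- (2 * pi * x * r))"
          by (cases "x \<ge> 0") (auto simp: abs_if)
        then have "cmod (f x) * exp (- pi * x\<^sup>2) * exp (\<bar>2 * pi * x\<bar> * r)
          \<le> cmod (f x) * exp (- pi * x\<^sup>2) * (exp (2 * pi * x * r) + exp (- (2 * pi * x * r)))"
          by (intro mult_left_mono) auto
        then show "norm (cmod (f x) * exp (- pi * x\<^sup>2) * exp (\<bar>2 * pi * x\<bar> * r))
          \<le> norm (cmod (f x * exp (of_real (- pi * x\<^sup>2) + of_real (2 * pi * x) * of_real r))
          + cmod (f x * exp (of_real (- pi * x\<^sup>2) + of_real (2 * pi * x) * of_real (- r))))"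
          unfolding n by (simp add: distrib_left)
      qed
    qed
    have nh: "norm (h k x) = cmod (f x) * exp (- pi * x\<^sup>2) * ((\<bar>2 * pi * x\<bar> * r) ^ k /\<^sub>R fact k)" for k x
      by (simp add: h_def norm_mult norm_power r_def norm_divide abs_mult)
    have snh: "(\<lambda>k. norm (h k x)) sums (cmod (f x) * exp (- pi * x\<^sup>2) * exp (\<bar>2 * pi * x\<bar> * r))" for x
      unfolding nh by (intro sums_mult exp_converges)
    have inth: "integrable lebesgue (h k)" for k
    proof (rule Bochner_Integration.integrable_bound[OF int])
      have "(\<lambda>x. exp (of_real (- pi * x\<^sup>2)) * (of_real (2 * pi * x) * z) ^ k /\<^sub>R fact k) \<in> borel_measurable lebesgue"
        by (intro measurable_completion) measurable
      then have "(\<lambda>x. f x * (exp (of_real (- pi * x\<^sup>2)) * (of_real (2 * pi * x) * z) ^ k /\<^sub>R fact k)) \<in> borel_measurable lebesgue"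
        by (intro borel_measurable_times f)
      moreover have "h k = (\<lambda>x. f x * (exp (of_real (- pi * x\<^sup>2)) * (of_real (2 * pi * x) * z) ^ k /\<^sub>R fact k))"
        by (simp add: h_def fun_eq_iff)
      ultimately show "h k \<in> borel_measurable lebesgue" by simp
      show "AE x in lebesgue. norm (h k x) \<le> norm (cmod (f x) * exp (- pi * x\<^sup>2) * exp (\<bar>2 * pi * x\<bar> * r))"
      proof (rule AE_I2)
        fix x :: real
        have "norm (h k x) = (\<Sum>i\<in>{k}. norm (h i x))" by simp
        also have "\<dots> \<le> (\<Sum>i. norm (h i x))" by (intro sum_le_suminf sums_summable[OF snh]) auto
        finally show "norm (h k x) \<le> norm (cmod (f x) * exp (- pi * x\<^sup>2) * exp (\<bar>2 * pi * x\<bar> * r))"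
          using sums_unique[OF snh[of x]] by simp
      qed
    qed
    have "(\<lambda>k. integral\<^sup>L lebesgue (h k)) sums (\<integral>x. (\<Sum>k. h k x) \<partial>lebesgue)"
    proof (rule sums_integral[OF inth])
      show "AE x in lebesgue. summable (\<lambda>k. norm (h k x))"
        using sums_summable[OF snh] by simp
      show "summable (\<lambda>k. \<integral>x. norm (h k x) \<partial>lebesgue)"
      proof (rule summableI_nonneg_bounded)
        fix n
        have "(\<Sum>k<n. \<integral>x. norm (h k x) \<partial>lebesgue) = (\<integral>x. (\<Sum>k<n. norm (h k x)) \<partial>lebesgue)"
          using inth by (simp add: integral_sum)
        also have "\<dots> \<le> (\<integral>x. cmod (f x) * exp (- pi * x\<^sup>2) * exp (\<bar>2 * pi * x\<bar> * r) \<partial>lebesgue)"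
        proof (rule integral_mono[OF _ int])
          show "integrable lebesgue (\<lambda>x. \<Sum>k<n. norm (h k x))" using inth by auto
          fix x
          show "(\<Sum>k<n. norm (h k x)) \<le> cmod (f x) * exp (- pi * x\<^sup>2) * exp (\<bar>2 * pi * x\<bar> * r)"
            using sum_le_suminf[OF sums_summable[OF snh[of x]], of "{..<n}"] sums_unique[OF snh[of x]] by simp
        qed
        finally show "(\<Sum>k<n. \<integral>x. norm (h k x) \<partial>lebesgue) \<le> (\<integral>x. cmod (f x) * exp (- pi * x\<^sup>2) * exp (\<bar>2 * pi * x\<bar> * r) \<partial>lebesgue)" .
      qed auto
    qed
    also have "(\<lambda>x. \<Sum>k. h k x) = (\<lambda>x. f x * exp (of_real (- pi * x\<^sup>2) + of_real (2 * pi * x) * z))"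
    proof
      fix x
      have "(\<lambda>k. f x * exp (of_real (- pi * x\<^sup>2)) * ((of_real (2 * pi * x) * z) ^ k /\<^sub>R fact k)) sums
          (f x * exp (of_real (- pi * x\<^sup>2)) * exp (of_real (2 * pi * x) * z))"
        by (intro sums_mult exp_converges)
      then have "(\<lambda>k. h k x) sums (f x * exp (of_real (- pi * x\<^sup>2) + of_real (2 * pi * x) * z))"
        unfolding exp_add h_def by (simp add: mult.assoc)
      then show "(\<Sum>k. h k x) = f x * exp (of_real (- pi * x\<^sup>2) + of_real (2 * pi * x) * z)"
        by (rule sums_unique[symmetric])
    qed
    finally have S: "(\<lambda>k. integral\<^sup>L lebesgue (h k)) sums bargmann f z" by (simp only: bargmann_def)
    have "integral\<^sup>L lebesgue (h k) = c k * (z - 0) ^ k" for k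
    proof -
      have "h k = (\<lambda>x. (f x * exp (of_real (- pi * x\<^sup>2)) * of_real ((2 * pi * x) ^ k / fact k)) * z ^ k)"
        by (simp add: h_def fun_eq_iff power_mult_distrib scaleR_conv_of_real field_simps)
      then show ?thesis by (simp add: c_def)
    qed
    with S show ?thesis by simp
  qed
  then have "bargmann f holomorphic_on ball 0 r" for r
    by (intro power_series_holomorphic[where a = c]) auto
  then show ?thesis
    unfolding holomorphic_on_def
    by (metis UNIV_I at_within_open dist_0_norm field_differentiable_at_within gt_ex mem_ball open_ball)
qed

text \<open>The value at frequency 0 shows that positive and negative part have the same mass
  \<open>m\<close>. Divided by \<open>m\<close> they are densities of two probability measures with
  equal characteristic functions, so Levy's uniqueness theorem applies; for \<open>m = 0\<close>
  both parts vanish outright.\<close>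

lemma fourier_transform_zero_imp_zero:
  fixes u :: "real \<Rightarrow> real"
  assumes int: "integrable lebesgue u"
    and zero: "\<And>\<xi>::real. (LINT x|lebesgue. of_real (u x) * exp (\<i> * of_real (\<xi> * x))) = (0::complex)"
  shows "AE x in lebesgue. u x = 0"
proof -
  \<comment> \<open>A Borel representative is needed to form densities with respect to
    \<open>lborel\<close>; \<open>u\<close> is only Lebesgue measurable.\<close>
  obtain v where v[measurable]: "v \<in> borel_measurable lborel" and ae: "AE x in lborel. u x = v x"
    using completion_ex_borel_measurable_real[where g = u and M = lborel] int by auto
  have ae': "AE x in lebesgue. u x = v x" using ae by (rule AE_completion)
  have [measurable]: "u \<in> borel_measurable lebesgue" using int by auto
  have vleb[measurable]: "v \<in> borel_measurable lebesgue" using v by (rule measurable_completion)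
  have "integrable lebesgue v"
    using int ae' by (subst integrable_cong_AE[of v lebesgue u]) auto
  then have intv: "integrable lborel v" using v by (simp add: integrable_completion)
  have expm: "(\<lambda>x. exp (\<i> * of_real (\<xi> * x)) :: complex) \<in> borel_measurable lebesgue" for \<xi>
    by (intro measurable_completion) measurable
  have zerov: "(LINT x|lborel. of_real (v x) * exp (\<i> * of_real (\<xi> * x))) = (0::complex)" for \<xi>
  proof -
    have "(LINT x|lborel. of_real (v x) * exp (\<i> * of_real (\<xi> * x))) = (LINT x|lebesgue. of_real (v x) * exp (\<i> * of_real (\<xi> * x)) :: complex)"
      by (rule integral_completion[symmetric]) measurable
    also have "\<dots> = (LINT x|lebesgue. of_real (u x) * exp (\<i> * of_real (\<xi> * x)))"
    proof (rule integral_cong_AE)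
      show "(\<lambda>x. complex_of_real (v x) * exp (\<i> * complex_of_real (\<xi> * x))) \<in> borel_measurable lebesgue"
        by (intro borel_measurable_times expm) measurable
      show "(\<lambda>x. complex_of_real (u x) * exp (\<i> * complex_of_real (\<xi> * x))) \<in> borel_measurable lebesgue"
        by (intro borel_measurable_times expm) measurable
    qed (use ae' in auto)
    finally show ?thesis using zero by simp
  qed
  define p where "p = (\<lambda>x. max 0 (v x))"
  define n where "n = (\<lambda>x. max 0 (- v x))"
  have [measurable]: "p \<in> borel_measurable borel" "n \<in> borel_measurable borel"
    using v unfolding p_def n_def by measurable
  have intp: "integrable lborel p" "integrable lborel n"
    using intv unfolding p_def n_def by auto
  have nn: "p x \<ge> 0" "n x \<ge> 0" and vpn: "v x = p x - n x" for x by (auto simp: p_def n_def)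
  define m where "m = (\<integral>x. p x \<partial>lborel)"
  have intpe: "integrable lborel (\<lambda>x. of_real (q x) * exp (\<i> * of_real (\<xi> * x)) :: complex)"
    if "integrable lborel q" "q \<in> borel_measurable borel" for q \<xi>
    by (rule Bochner_Integration.integrable_bound[OF that(1)]) (use that in \<open>auto simp: norm_mult\<close>)
  have eq: "(LINT x|lborel. of_real (p x) * exp (\<i> * of_real (\<xi> * x)) :: complex)
     = (LINT x|lborel. of_real (n x) * exp (\<i> * of_real (\<xi> * x)))" for \<xi>
    using zerov[of \<xi>] intpe[of p \<xi>] intpe[of n \<xi>] intp
    by (simp add: vpn left_diff_distrib)
  have mn: "m = (\<integral>x. n x \<partial>lborel)"
    using eq[of 0] unfolding m_def by simp
  have "AE x in lborel. v x = 0"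
  proof (cases "m = 0")
    case True
    have "AE x in lborel. p x = 0"
      using integral_nonneg_eq_0_iff_AE[OF intp(1)] nn True by (simp add: m_def)
    moreover have "AE x in lborel. n x = 0"
      using integral_nonneg_eq_0_iff_AE[OF intp(2)] nn True by (simp add: mn)
    ultimately show ?thesis by eventually_elim (simp add: vpn)
  next
    case False
    then have m: "m > 0" using Bochner_Integration.integral_nonneg[of lborel p] nn by (simp add: m_def order_less_le)
    have D: "real_distribution (density lborel (\<lambda>x. ennreal (q x / m)))"
      if q: "integrable lborel q" "\<And>x. q x \<ge> 0" "(\<integral>x. q x \<partial>lborel) = m" "q \<in> borel_measurable borel" for q
    proof -
      have "emeasure (density lborel (\<lambda>x. ennreal (q x / m))) UNIV = (\<integral>\<^sup>+x. ennreal (q x / m) \<partial>lborel)"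
        using q(4) by (subst emeasure_density) auto
      also have "\<dots> = ennreal (\<integral>x. q x / m \<partial>lborel)"
        using q m by (intro nn_integral_eq_integral) auto
      also have "\<dots> = 1" using q m by simp
      finally have "prob_space (density lborel (\<lambda>x. ennreal (q x / m)))" by (intro prob_spaceI) auto
      then show ?thesis by (simp add: real_distribution_def real_distribution_axioms_def)
    qed
    have ch: "char (density lborel (\<lambda>x. ennreal (q x / m))) \<xi> = (LINT x|lborel. of_real (q x) * exp (\<i> * of_real (\<xi> * x))) / of_real m"
      if q: "\<And>x. q x \<ge> 0" "q \<in> borel_measurable borel" for q \<xi>
    proof -
      have "char (density lborel (\<lambda>x. ennreal (q x / m))) \<xi> = (LINT x|lborel. (q x / m) *\<^sub>R exp (\<i> * of_real (\<xi> * x)))"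
        unfolding char_def using q m by (subst integral_density) auto
      also have "\<dots> = (LINT x|lborel. (of_real (q x) * exp (\<i> * of_real (\<xi> * x))) / of_real m)"
        by (intro Bochner_Integration.integral_cong) (auto simp: scaleR_conv_of_real)
      finally show ?thesis by simp
    qed
    have "density lborel (\<lambda>x. ennreal (p x / m)) = density lborel (\<lambda>x. ennreal (n x / m))"
    proof (rule Levy_uniqueness)
      show "char (density lborel (\<lambda>x. ennreal (p x / m))) = char (density lborel (\<lambda>x. ennreal (n x / m)))"
        by (rule ext) (simp add: ch nn eq del: of_real_mult)
    qed (auto intro!: D intp nn simp: m_def[symmetric] mn[symmetric])
    moreover have "(\<integral>\<^sup>+x. ennreal (p x / m) \<partial>lborel) \<noteq> \<infinity>"
      using intp(1) m nn by (subst nn_integral_eq_integral) auto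
    ultimately have "AE x in lborel. ennreal (p x / m) = ennreal (n x / m)"
      by (subst (asm) finite_density_unique) auto
    then show ?thesis
    proof eventually_elim
      case (elim x)
      then have "p x = n x" using nn m by (simp add: divide_nonneg_pos)
      then show ?case by (simp add: vpn)
    qed
  qed
  with ae have "AE x in lborel. u x = 0" by eventually_elim simp
  then show ?thesis by (rule AE_completion)
qed

text \<open>On the imaginary axis the transform of \<open>f\<close> is the Fourier transform of
  \<open>f\<close> times a Gaussian. The Fourier lemma is about real functions, so real and
  imaginary part are separated; the transform of the conjugate at \<xi> is the conjugate of the
  transform at - \<xi> and vanishes as well.\<close>

lemma bargmann_zero_imp_zero:
  assumes sq: "square_integrable f" and zero: "\<And>z. bargmann f z = 0"
  shows "AE x in lebesgue. f x = 0"
proof -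
  define h where "h = (\<lambda>x. f x * exp (of_real (- pi * x\<^sup>2)))"
  have inth: "integrable lebesgue h"
    using bargmann_integrable[OF sq, of 0] by (simp add: h_def)
  have fz: "(LINT x|lebesgue. h x * exp (\<i> * of_real (\<xi> * x))) = 0"
    and fint: "integrable lebesgue (\<lambda>x. h x * exp (\<i> * of_real (\<xi> * x)))" for \<xi> :: real
  proof -
    have "h x * exp (\<i> * of_real (\<xi> * x)) = f x * exp (of_real (- pi * x\<^sup>2) + of_real (2 * pi * x) * (\<i> * of_real (\<xi> / (2 * pi))))" for x
      by (simp add: h_def mult.assoc exp_add[symmetric] mult_ac)
    then show "(LINT x|lebesgue. h x * exp (\<i> * of_real (\<xi> * x))) = 0"
      "integrable lebesgue (\<lambda>x. h x * exp (\<i> * of_real (\<xi> * x)))"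
      using zero[of "\<i> * of_real (\<xi> / (2 * pi))"] bargmann_integrable[OF sq, of "\<i> * of_real (\<xi> / (2 * pi))"]
      by (simp_all only: bargmann_def)
  qed
  have cnjz: "(LINT x|lebesgue. cnj (h x) * exp (\<i> * of_real (\<xi> * x))) = 0"
    and cnji: "integrable lebesgue (\<lambda>x. cnj (h x) * exp (\<i> * of_real (\<xi> * x)))" for \<xi> :: real
  proof -
    have eq: "cnj (h x) * exp (\<i> * of_real (\<xi> * x)) = cnj (h x * exp (\<i> * of_real (- \<xi> * x)))" for x
      by (simp add: exp_cnj)
    show "(LINT x|lebesgue. cnj (h x) * exp (\<i> * of_real (\<xi> * x))) = 0"
      unfolding eq using Bochner_Integration.integral_cnj[of lebesgue "\<lambda>x. h x * exp (\<i> * of_real (- \<xi> * x))"] fz[of "- \<xi>"]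
      by (simp only: complex_cnj_zero)
    show "integrable lebesgue (\<lambda>x. cnj (h x) * exp (\<i> * of_real (\<xi> * x)))"
      unfolding eq using fint[of "- \<xi>"] by (simp only: complex_integrable_cnj)
  qed
  have "AE x in lebesgue. Re (h x) = 0"
  proof (rule fourier_transform_zero_imp_zero)
    show "integrable lebesgue (\<lambda>x. Re (h x))" using inth by simp
    fix \<xi> :: real
    have eq: "of_real (Re (h x)) * exp (\<i> * of_real (\<xi> * x))
        = (h x * exp (\<i> * of_real (\<xi> * x)) + cnj (h x) * exp (\<i> * of_real (\<xi> * x))) / 2" for x
      by (simp add: complex_add_cnj distrib_right[symmetric])
    have "(LINT x|lebesgue. of_real (Re (h x)) * exp (\<i> * of_real (\<xi> * x)))
      = (LINT x|lebesgue. (h x * exp (\<i> * of_real (\<xi> * x)) + cnj (h x) * exp (\<i> * of_real (\<xi> * x))) / 2)"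
      by (intro Bochner_Integration.integral_cong refl eq)
    also have "\<dots> = 0"
      using fint[of \<xi>] cnji[of \<xi>] by (simp add: fz cnjz del: of_real_mult)
    finally show "(LINT x|lebesgue. of_real (Re (h x)) * exp (\<i> * of_real (\<xi> * x))) = (0::complex)" .
  qed
  moreover have "AE x in lebesgue. Im (h x) = 0"
  proof (rule fourier_transform_zero_imp_zero)
    show "integrable lebesgue (\<lambda>x. Im (h x))" using inth by simp
    fix \<xi> :: real
    have eq: "of_real (Im (h x)) * exp (\<i> * of_real (\<xi> * x))
        = (h x * exp (\<i> * of_real (\<xi> * x)) - cnj (h x) * exp (\<i> * of_real (\<xi> * x))) / (2 * \<i>)" for x
    proof -
      have "h x - cnj (h x) = 2 * \<i> * of_real (Im (h x))" by (simp add: complex_eq_iff)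
      then have "of_real (Im (h x)) = (h x - cnj (h x)) / (2 * \<i>)" by simp
      then show ?thesis by (simp only: left_diff_distrib times_divide_eq_left)
    qed
    have "(LINT x|lebesgue. of_real (Im (h x)) * exp (\<i> * of_real (\<xi> * x)))
      = (LINT x|lebesgue. (h x * exp (\<i> * of_real (\<xi> * x)) - cnj (h x) * exp (\<i> * of_real (\<xi> * x))) / (2 * \<i>))"
      by (intro Bochner_Integration.integral_cong refl eq)
    also have "\<dots> = 0"
      using fint[of \<xi>] cnji[of \<xi>] by (simp add: fz cnjz del: of_real_mult)
    finally show "(LINT x|lebesgue. of_real (Im (h x)) * exp (\<i> * of_real (\<xi> * x))) = (0::complex)" .
  qed
  ultimately show ?thesis
  proof eventually_elim
    case (elim x)
    then have "h x = 0" by (simp add: complex_eq_iff)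
    then show ?case by (simp add: h_def)
  qed
qed

lemma square_integrable_diff_scaled:
  assumes "square_integrable f" "square_integrable g"
  shows "square_integrable (\<lambda>x. f x - c * g x)"
proof -
  have m: "f \<in> borel_measurable lebesgue" "g \<in> borel_measurable lebesgue"
    and i: "integrable lebesgue (\<lambda>x. (cmod (f x))\<^sup>2)" "integrable lebesgue (\<lambda>x. (cmod (g x))\<^sup>2)"
    using assms by (auto simp: square_integrable_def)
  have m': "(\<lambda>x. f x - c * g x) \<in> borel_measurable lebesgue"
    using m by (intro borel_measurable_diff borel_measurable_times) auto
  have "integrable lebesgue (\<lambda>x. (cmod (f x - c * g x))\<^sup>2)"
  proof (rule Bochner_Integration.integrable_bound)
    show "integrable lebesgue (\<lambda>x. 2 * (cmod (f x))\<^sup>2 + 2 * (cmod c)\<^sup>2 * (cmod (g x))\<^sup>2)"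
      using i by simp
    show "(\<lambda>x. (cmod (f x - c * g x))\<^sup>2) \<in> borel_measurable lebesgue" using m' by measurable
    show "AE x in lebesgue. norm ((cmod (f x - c * g x))\<^sup>2) \<le> norm (2 * (cmod (f x))\<^sup>2 + 2 * (cmod c)\<^sup>2 * (cmod (g x))\<^sup>2)"
    proof (rule AE_I2)
      fix x
      have "(cmod (f x - c * g x))\<^sup>2 \<le> (cmod (f x) + cmod (c * g x))\<^sup>2"
        by (intro power_mono norm_triangle_ineq4) auto
      also have "\<dots> \<le> 2 * (cmod (f x))\<^sup>2 + 2 * (cmod (c * g x))\<^sup>2"
        using sum_squares_bound[of "cmod (f x)" "cmod (c * g x)"] by (simp add: power2_sum)
      finally show "norm ((cmod (f x - c * g x))\<^sup>2) \<le> norm (2 * (cmod (f x))\<^sup>2 + 2 * (cmod c)\<^sup>2 * (cmod (g x))\<^sup>2)"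
        by (simp add: norm_mult power_mult_distrib)
    qed
  qed
  with m' show ?thesis by (simp add: square_integrable_def)
qed

lemma bargmann_diff_scaled:
  assumes "square_integrable f" "square_integrable g"
  shows "bargmann (\<lambda>x. f x - c * g x) z = bargmann f z - c * bargmann g z"
  using bargmann_integrable[OF assms(1), of z] bargmann_integrable[OF assms(2), of z]
  unfolding bargmann_def by (simp add: left_diff_distrib mult.assoc del: of_real_mult of_real_minus)

lemma square_integrable_gaussian:
  "square_integrable (\<lambda>x. exp (of_real (- pi * x\<^sup>2) + of_real (2 * pi * x) * b))"
proof -
  have "(cmod (exp (of_real (- pi * x\<^sup>2) + of_real (2 * pi * x) * b)))\<^sup>2
      = exp (2 * pi * (Re b)\<^sup>2) * exp (- (2 * pi) * (x - Re b)\<^sup>2)" for x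
    unfolding norm_bargmann_kernel by (simp add: power_mult_distrib exp_double[symmetric] mult.assoc)
  moreover have "integrable lebesgue (\<lambda>x. exp (2 * pi * (Re b)\<^sup>2) * exp (- (2 * pi) * (x - Re b)\<^sup>2))"
    using gaussian_integral(1)[of "2 * pi" "Re b"] by (simp add: integrable_completion)
  ultimately show ?thesis
    unfolding square_integrable_def using borel_measurable_bargmann_kernel by simp
qed

text \<open>The product of the Gaussian with the kernel depends on \<open>b\<close> and
  \<open>z\<close> only through \<open>b + z\<close>, so \<open>b = 0\<close> suffices; there both
  sides are entire and agree on the real axis. Apart from a constant and the factor exp (\<pi> z^2 /
  2), the transform is exp (\<pi> b z): these Gaussians are preimages of exponentials and, for
  conjugated \<open>b\<close>, of reproducing kernels.\<close>

lemma bargmann_gaussian: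
  "bargmann (\<lambda>x. exp (of_real (- pi * x\<^sup>2) + of_real (2 * pi * x) * b)) z
    = exp (of_real (pi / 2) * (b + z)\<^sup>2) / of_real (sqrt 2)"
proof -
  define G where "G = bargmann (\<lambda>x. exp (of_real (- pi * x\<^sup>2) + of_real (2 * pi * x) * 0))"
  have real: "G (of_real s) - exp (of_real (pi / 2) * (of_real s)\<^sup>2) / of_real (sqrt 2) = 0" for s :: real
  proof -
    have "exp (of_real (- pi * x\<^sup>2) + of_real (2 * pi * x) * 0) * exp (of_real (- pi * x\<^sup>2) + of_real (2 * pi * x) * of_real s)
      = complex_of_real (exp (pi / 2 * s\<^sup>2) * exp (- (2 * pi) * (x - s / 2)\<^sup>2))" for x :: real
      by (simp add: exp_add[symmetric] exp_of_real[symmetric] power2_eq_square algebra_simps)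
    then have "G (of_real s) = (LINT x|lebesgue. complex_of_real (exp (pi / 2 * s\<^sup>2) * exp (- (2 * pi) * (x - s / 2)\<^sup>2)))"
      by (simp only: G_def bargmann_def)
    also have "\<dots> = complex_of_real (LINT x|lebesgue. exp (pi / 2 * s\<^sup>2) * exp (- (2 * pi) * (x - s / 2)\<^sup>2))"
      by (rule integral_complex_of_real)
    also have "(LINT x|lebesgue. exp (pi / 2 * s\<^sup>2) * exp (- (2 * pi) * (x - s / 2)\<^sup>2)) = exp (pi / 2 * s\<^sup>2) * sqrt (pi / (2 * pi))"
      using gaussian_integral(2)[of "2 * pi" "s / 2"] by (simp add: integral_completion)
    finally show ?thesis by (simp add: real_sqrt_divide exp_of_real[symmetric])
  qed
  have G: "G w = exp (of_real (pi / 2) * w\<^sup>2) / of_real (sqrt 2)" for w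
  proof -
    have "(\<lambda>w. G w - exp (of_real (pi / 2) * w\<^sup>2) / of_real (sqrt 2)) holomorphic_on UNIV"
      unfolding G_def by (intro holomorphic_intros holomorphic_bargmann square_integrable_gaussian) auto
    then have "G w - exp (of_real (pi / 2) * w\<^sup>2) / of_real (sqrt 2) = 0"
    proof (rule analytic_continuation[of _ UNIV "range of_real" 0])
      have "(0::real) islimpt UNIV" by (rule open_imp_islimpt) auto
      then show "(0::complex) islimpt range of_real"
        by (auto simp: islimpt_approachable dist_of_real)
    qed (use real in auto)
    then show ?thesis by simp
  qed
  have "bargmann (\<lambda>x. exp (of_real (- pi * x\<^sup>2) + of_real (2 * pi * x) * b)) z = G (b + z)"
    unfolding G_def bargmann_def
    by (intro Bochner_Integration.integral_cong) (auto simp: exp_add[symmetric] algebra_simps)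
  then show ?thesis using G by simp
qed

section \<open>Range of the Bargmann transform\<close>

lemma integrable_product_mult:
  fixes f :: "'a::euclidean_space \<Rightarrow> real" and g :: "'b::euclidean_space \<Rightarrow> real"
  assumes "integrable lborel f" "integrable lborel g"
  shows "integrable (lborel \<Otimes>\<^sub>M lborel) (\<lambda>(x, y). f x * g y)"
proof (rule lborel_pair.Fubini_integrable)
  have [measurable]: "f \<in> borel_measurable borel" "g \<in> borel_measurable borel" using assms by auto
  show "(\<lambda>(x, y). f x * g y) \<in> borel_measurable (lborel \<Otimes>\<^sub>M lborel)" by measurable
  have "(\<lambda>x. \<integral>y. norm (case (x, y) of (x, y) \<Rightarrow> f x * g y) \<partial>lborel) = (\<lambda>x. norm (f x) * (\<integral>y. norm (g y) \<partial>lborel))"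
    using assms by (simp add: abs_mult)
  then show "integrable lborel (\<lambda>x. \<integral>y. norm (case (x, y) of (x, y) \<Rightarrow> f x * g y) \<partial>lborel)"
    using assms by simp
qed (use assms in auto)

text \<open>Integrals are taken over pairs, where Lebesgue measure is a product measure, while
  entire functions take complex arguments.\<close>

definition plane_to_complex :: "real \<times> real \<Rightarrow> complex" where
  "plane_to_complex p = Complex (fst p) (snd p)"

lemma plane_to_complex_measurable [measurable]: "plane_to_complex \<in> borel_measurable borel"
proof -
  have eq: "plane_to_complex = (\<lambda>p. of_real (fst p) + \<i> * of_real (snd p))"
    by (simp add: plane_to_complex_def fun_eq_iff complex_eq_iff)
  show ?thesis unfolding eq by (intro borel_measurable_continuous_onI continuous_intros)
qed

lemma borel_measurable_fst_snd [measurable]: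
  "fst \<in> borel_measurable (borel :: (real \<times> real) measure)"
  "snd \<in> borel_measurable (borel :: (real \<times> real) measure)"
  by (intro borel_measurable_continuous_onI continuous_intros)+

lemma norm_plane_to_complex: "(norm (plane_to_complex p))\<^sup>2 = (fst p)\<^sup>2 + (snd p)\<^sup>2"
  by (simp add: plane_to_complex_def cmod_power2)

lemma planar_gaussian:
  fixes d :: real
  assumes "d > 0"
  shows "integrable lborel (\<lambda>p. exp (- d * (norm (plane_to_complex p))\<^sup>2))"
    and "(\<integral>p. exp (- d * (norm (plane_to_complex p))\<^sup>2) \<partial>lborel) = pi / d"
proof -
  have eq: "(\<lambda>p. exp (- d * (norm (plane_to_complex p))\<^sup>2)) = (\<lambda>(x, y). exp (- d * (x - 0)\<^sup>2) * exp (- d * (y - 0)\<^sup>2))"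
    by (auto simp: norm_plane_to_complex exp_add[symmetric] algebra_simps fun_eq_iff)
  have i: "integrable (lborel \<Otimes>\<^sub>M lborel) (\<lambda>(x, y). exp (- d * (x - 0)\<^sup>2) * exp (- d * (y - 0)\<^sup>2))"
    by (intro integrable_product_mult gaussian_integral assms)
  then show "integrable lborel (\<lambda>p. exp (- d * (norm (plane_to_complex p))\<^sup>2))"
    unfolding eq lborel_prod .
  have "(\<integral>p. exp (- d * (norm (plane_to_complex p))\<^sup>2) \<partial>lborel)
      = (\<integral>x. \<integral>y. exp (- d * (x - 0)\<^sup>2) * exp (- d * (y - 0)\<^sup>2) \<partial>lborel \<partial>lborel)"
    unfolding eq lborel_prod[symmetric] using lborel_pair.integral_fst'[OF i] by simp
  also have "\<dots> = sqrt (pi / d) * sqrt (pi / d)"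
    using gaussian_integral[OF assms, of 0] by simp
  finally show "(\<integral>p. exp (- d * (norm (plane_to_complex p))\<^sup>2) \<partial>lborel) = pi / d"
    using assms by simp
qed

lemma nn_integral_shear_fst:
  assumes [measurable]: "g \<in> borel_measurable borel"
  shows "(\<integral>\<^sup>+p. g (fst p + a * snd p, snd p) \<partial>lborel) = (\<integral>\<^sup>+p. g p \<partial>(lborel :: (real \<times> real) measure))"
proof -
  have "(\<integral>\<^sup>+p. g (fst p + a * snd p, snd p) \<partial>(lborel \<Otimes>\<^sub>M lborel)) = (\<integral>\<^sup>+y. \<integral>\<^sup>+x. g (x + a * y, y) \<partial>lborel \<partial>lborel)"
    by (subst lborel_pair.nn_integral_snd[symmetric]) (auto simp: lborel_prod)
  also have "\<dots> = (\<integral>\<^sup>+y. \<integral>\<^sup>+x. g (x, y) \<partial>lborel \<partial>lborel)"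
  proof (rule nn_integral_cong)
    fix y
    show "(\<integral>\<^sup>+x. g (x + a * y, y) \<partial>lborel) = (\<integral>\<^sup>+x. g (x, y) \<partial>lborel)"
      using nn_integral_real_affine[of "\<lambda>x. g (x, y)" 1 "a * y"] by (simp add: add.commute)
  qed
  also have "\<dots> = (\<integral>\<^sup>+p. g p \<partial>(lborel \<Otimes>\<^sub>M lborel))"
    by (subst lborel_pair.nn_integral_snd) (auto simp: lborel_prod)
  finally show ?thesis by (simp add: lborel_prod)
qed

lemma nn_integral_shear_snd:
  assumes [measurable]: "g \<in> borel_measurable borel"
  shows "(\<integral>\<^sup>+p. g (fst p, snd p + a * fst p) \<partial>lborel) = (\<integral>\<^sup>+p. g p \<partial>(lborel :: (real \<times> real) measure))"
proof -
  have "(\<integral>\<^sup>+p. g (fst p, snd p + a * fst p) \<partial>(lborel \<Otimes>\<^sub>M lborel)) = (\<integral>\<^sup>+x. \<integral>\<^sup>+y. g (x, y + a * x) \<partial>lborel \<partial>lborel)"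
    by (subst lborel.nn_integral_fst[symmetric]) (auto simp: lborel_prod)
  also have "\<dots> = (\<integral>\<^sup>+x. \<integral>\<^sup>+y. g (x, y) \<partial>lborel \<partial>lborel)"
  proof (rule nn_integral_cong)
    fix x
    show "(\<integral>\<^sup>+y. g (x, y + a * x) \<partial>lborel) = (\<integral>\<^sup>+y. g (x, y) \<partial>lborel)"
      using nn_integral_real_affine[of "\<lambda>y. g (x, y)" 1 "a * x"] by (simp add: add.commute)
  qed
  also have "\<dots> = (\<integral>\<^sup>+p. g p \<partial>(lborel \<Otimes>\<^sub>M lborel))"
    by (subst lborel.nn_integral_fst) (auto simp: lborel_prod)
  finally show ?thesis by (simp add: lborel_prod)
qed

definition plane_rotation :: "real \<Rightarrow> real \<Rightarrow> real \<times> real \<Rightarrow> real \<times> real" where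
  "plane_rotation c s p = (c * fst p - s * snd p, s * fst p + c * snd p)"

lemma plane_rotation_measurable [measurable]: "plane_rotation c s \<in> borel_measurable borel"
  unfolding plane_rotation_def by (intro borel_measurable_continuous_onI continuous_intros)

lemma nn_integral_plane_rotation:
  fixes g :: "real \<times> real \<Rightarrow> ennreal"
  assumes [measurable]: "g \<in> borel_measurable borel" and cs: "c\<^sup>2 + s\<^sup>2 = 1"
  shows "(\<integral>\<^sup>+p. g (plane_rotation c s p) \<partial>lborel) = (\<integral>\<^sup>+p. g p \<partial>lborel)"
proof -
  \<comment> \<open>A rotation other than the half turn is a product of three shears.\<close>
  have main: "(\<integral>\<^sup>+p. g (plane_rotation c s p) \<partial>lborel) = (\<integral>\<^sup>+p. g p \<partial>lborel)"
    if g[measurable]: "g \<in> borel_measurable borel" and cs: "c\<^sup>2 + s\<^sup>2 = 1" and c: "c \<noteq> -1"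
    for g :: "real \<times> real \<Rightarrow> ennreal" and c s
  proof -
    \<comment> \<open>Minus the tangent of half the angle; the shears with parameters
      \<open>a\<close>, \<open>s\<close>, \<open>a\<close> compose to the rotation.\<close>
    define a where "a = - s / (1 + c)"
    have c1: "1 + c \<noteq> 0" using c by linarith
    have as: "1 + a * s = c"
    proof -
      have "s * s = (1 - c) * (1 + c)" using cs by (simp add: power2_eq_square algebra_simps)
      then have "a * s = - (1 - c)" using c1 by (simp add: a_def)
      then show ?thesis by simp
    qed
    have ac: "a * (1 + c) = - s" using c1 by (simp add: a_def)
    define h1 where "h1 = (\<lambda>p::real \<times> real. g (fst p + a * snd p, snd p))"
    define h2 where "h2 = (\<lambda>p::real \<times> real. h1 (fst p, snd p + s * fst p))"
    have m1[measurable]: "h1 \<in> borel_measurable borel" unfolding h1_def by measurable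
    have m2[measurable]: "h2 \<in> borel_measurable borel" unfolding h2_def by measurable
    have "h2 (fst p + a * snd p, snd p) = g (plane_rotation c s p)" for p
    proof -
      have 2: "snd p + s * (fst p + a * snd p) = s * fst p + c * snd p"
        using as by (simp add: algebra_simps flip: distrib_left) (metis add.commute distrib_left mult.commute mult.left_commute mult_1)
      have "fst p + a * snd p + a * (s * fst p + c * snd p) = (1 + a * s) * fst p + a * (1 + c) * snd p"
        by (simp add: algebra_simps)
      then have 1: "fst p + a * snd p + a * (s * fst p + c * snd p) = c * fst p - s * snd p"
        using as ac by simp
      show ?thesis by (simp add: h1_def h2_def plane_rotation_def 1 2)
    qed
    then have "(\<integral>\<^sup>+p. g (plane_rotation c s p) \<partial>lborel) = (\<integral>\<^sup>+p. h2 (fst p + a * snd p, snd p) \<partial>lborel)" by simp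
    also have "\<dots> = (\<integral>\<^sup>+p. h2 p \<partial>lborel)" by (rule nn_integral_shear_fst) measurable
    also have "\<dots> = (\<integral>\<^sup>+p. h1 p \<partial>lborel)" unfolding h2_def by (rule nn_integral_shear_snd) measurable
    also have "\<dots> = (\<integral>\<^sup>+p. g p \<partial>lborel)" unfolding h1_def by (rule nn_integral_shear_fst) measurable
    finally show ?thesis .
  qed
  show ?thesis
  proof (cases "c = -1")
    case False
    then show ?thesis using main[OF assms] by simp
  next
    case True
    then have s: "s = 0" using cs by simp
    \<comment> \<open>The half turn is the square of a quarter turn.\<close>
    define h where "h = (\<lambda>p. g (plane_rotation 0 1 p))"
    have [measurable]: "h \<in> borel_measurable borel" unfolding h_def by measurable
    have "g (plane_rotation c s p) = h (plane_rotation 0 1 p)" for p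
      by (simp add: h_def plane_rotation_def True s)
    then have "(\<integral>\<^sup>+p. g (plane_rotation c s p) \<partial>lborel) = (\<integral>\<^sup>+p. h (plane_rotation 0 1 p) \<partial>lborel)" by simp
    also have "\<dots> = (\<integral>\<^sup>+p. g p \<partial>lborel)" using main[of h 0 1] main[of g 0 1] by (simp add: h_def)
    finally show ?thesis .
  qed
qed

lemma distr_plane_rotation:
  assumes "c\<^sup>2 + s\<^sup>2 = 1"
  shows "distr lborel borel (plane_rotation c s) = (lborel :: (real \<times> real) measure)"
proof (rule measure_eqI)
  fix A :: "(real \<times> real) set" assume "A \<in> sets (distr lborel borel (plane_rotation c s))"
  then have [measurable]: "A \<in> sets borel" by simp
  have "emeasure (distr lborel borel (plane_rotation c s)) A = (\<integral>\<^sup>+p. indicator A p \<partial>distr lborel borel (plane_rotation c s))"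
    by simp
  also have "\<dots> = (\<integral>\<^sup>+p. indicator A (plane_rotation c s p) \<partial>lborel)"
    by (rule nn_integral_distr) measurable
  also have "\<dots> = (\<integral>\<^sup>+p. indicator A p \<partial>lborel)"
    by (rule nn_integral_plane_rotation[OF _ assms]) measurable
  finally show "emeasure (distr lborel borel (plane_rotation c s)) A = emeasure lborel A" by simp
qed simp

lemma integral_rotate:
  fixes h :: "complex \<Rightarrow> complex"
  assumes [measurable]: "h \<in> borel_measurable borel" and u: "norm u = 1"
  shows "(\<integral>p. h (u * plane_to_complex p) \<partial>lborel) = (\<integral>p. h (plane_to_complex p) \<partial>lborel)"
proof -
  have "(Re u)\<^sup>2 + (Im u)\<^sup>2 = 1" using u by (metis cmod_power2 one_power2)
  note D = distr_plane_rotation[OF this]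
  have "u * plane_to_complex p = plane_to_complex (plane_rotation (Re u) (Im u) p)" for p
    by (simp add: plane_to_complex_def plane_rotation_def complex_eq_iff)
  then have "(\<integral>p. h (u * plane_to_complex p) \<partial>lborel) = (\<integral>p. h (plane_to_complex (plane_rotation (Re u) (Im u) p)) \<partial>lborel)"
    by simp
  also have "\<dots> = (\<integral>p. h (plane_to_complex p) \<partial>distr lborel borel (plane_rotation (Re u) (Im u)))"
    by (subst integral_distr) auto
  finally show ?thesis by (simp add: D)
qed

section \<open>Mean values and the reproducing formula\<close>

lemma circle_mean_value:
  fixes G :: "complex \<Rightarrow> complex"
  assumes "G holomorphic_on UNIV"
  shows "(LINT t|lborel. indicator {0..1} t *\<^sub>R G (exp (2 * of_real pi * \<i> * of_real t) * w)) = G 0"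
proof -
  define H where "H = (\<lambda>v. G (v * w))"
  have hol: "H holomorphic_on UNIV"
    unfolding H_def by (intro holomorphic_on_compose_gen[OF _ assms, unfolded o_def] holomorphic_intros) auto
  have "((\<lambda>u. H u / (u - 0)) has_contour_integral (2 * of_real pi * \<i> * H 0)) (circlepath 0 1)"
    by (rule Cauchy_integral_circlepath) (use hol in \<open>auto intro: holomorphic_on_subset holomorphic_on_imp_continuous_on\<close>)
  then have "((\<lambda>t. H (circlepath 0 1 t) / (circlepath 0 1 t - 0) * vector_derivative (circlepath 0 1) (at t within {0..1}))
      has_integral (2 * of_real pi * \<i> * H 0)) {0..1}"
    by (simp add: has_contour_integral_def)
  then have "((\<lambda>t. (2 * of_real pi * \<i>) * H (exp (2 * of_real pi * \<i> * of_real t))) has_integral (2 * of_real pi * \<i> * H 0)) {0..1}"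
  proof (rule has_integral_eq[rotated])
    fix t :: real assume t: "t \<in> {0..1}"
    have c: "circlepath 0 1 t = exp (2 * of_real pi * \<i> * of_real t)" by (simp add: circlepath)
    have "vector_derivative (circlepath 0 1) (at t within {0..1}) = 2 * of_real pi * \<i> * exp (2 * of_real pi * \<i> * of_real t)"
      using t vector_derivative_circlepath01[of t 0 1] by simp
    then show "H (circlepath 0 1 t) / (circlepath 0 1 t - 0) * vector_derivative (circlepath 0 1) (at t within {0..1})
        = (2 * of_real pi * \<i>) * H (exp (2 * of_real pi * \<i> * of_real t))"
      unfolding c by simp
  qed
  from has_integral_mult_right[OF this, of "inverse (2 * of_real pi * \<i>)"]
  have hi: "((\<lambda>t. H (exp (2 * of_real pi * \<i> * of_real t))) has_integral H 0) {0..1}"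
  proof -
    have "inverse (2 * of_real pi * \<i>) * (2 * of_real pi * \<i> * x) = x" for x :: complex
    proof -
      have "2 * of_real pi * \<i> \<noteq> (0::complex)" by simp
      then show ?thesis by (metis left_inverse mult.assoc mult_1)
    qed
    then show "((\<lambda>t. inverse (2 * of_real pi * \<i>) * (2 * of_real pi * \<i> * H (exp (2 * of_real pi * \<i> * of_real t))))
        has_integral inverse (2 * of_real pi * \<i>) * (2 * of_real pi * \<i> * H 0)) {0..1} \<Longrightarrow> ?thesis"
      by (simp only:)
  qed
  have "continuous_on {0..1} (\<lambda>t. H (exp (2 * of_real pi * \<i> * of_real t)))"
    by (intro continuous_on_compose2[OF holomorphic_on_imp_continuous_on[OF hol]] continuous_intros) auto
  then have "set_integrable lborel {0..1::real} (\<lambda>t. H (exp (2 * of_real pi * \<i> * of_real t)))"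
    by (intro borel_integrable_compact[unfolded set_integrable_def[symmetric]] continuous_intros) auto
  then have "(LINT t:{0..1}|lborel. H (exp (2 * of_real pi * \<i> * of_real t))) = integral {0..1} (\<lambda>t. H (exp (2 * of_real pi * \<i> * of_real t)))"
    by (rule set_borel_integral_eq_integral(2))
  also have "\<dots> = H 0" using hi by (rule integral_unique)
  finally show ?thesis by (simp add: H_def set_lebesgue_integral_def)
qed

lemma borel_measurable_entire:
  assumes "G holomorphic_on UNIV"
  shows "G \<in> borel_measurable borel"
  using holomorphic_on_imp_continuous_on[OF assms] by (rule borel_measurable_continuous_onI)

text \<open>By rotation invariance of the planar Gaussian, \<open>G\<close> may be replaced by its mean over circles.\<close>

lemma gaussian_mean_value:
  fixes G :: "complex \<Rightarrow> complex"
  assumes hol: "G holomorphic_on UNIV" and bound: "\<And>w. norm (G w) \<le> C * exp (c * (norm w)\<^sup>2)" and c: "c < pi"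
  shows "(LINT p|lborel. G (plane_to_complex p) * of_real (exp (- pi * (norm (plane_to_complex p))\<^sup>2))) = G 0"
proof -
  have [measurable]: "G \<in> borel_measurable borel" using hol by (rule borel_measurable_entire)
  have C: "C \<ge> 0" using order_trans[OF norm_ge_zero bound[of 0]] by simp
  define \<gamma> where "\<gamma> = (\<lambda>w::complex. exp (- pi * (norm w)\<^sup>2))"
  have [measurable]: "\<gamma> \<in> borel_measurable borel"
    unfolding \<gamma>_def by (intro borel_measurable_continuous_onI continuous_intros)
  define e where "e = (\<lambda>t::real. exp (2 * of_real pi * \<i> * of_real t))"
  have [measurable]: "e \<in> borel_measurable borel"
    unfolding e_def by (intro borel_measurable_continuous_onI continuous_intros)
  have ne: "norm (e t) = 1" for t by (simp add: e_def)
  let ?P = plane_to_complex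
  define I where "I = (LINT p|lborel. G (?P p) * of_real (\<gamma> (?P p)))"
  have rot: "(LINT p|lborel. G (e t * ?P p) * of_real (\<gamma> (?P p))) = I" for t
  proof -
    have "(\<integral>p. (\<lambda>w. G w * of_real (\<gamma> w)) (e t * ?P p) \<partial>lborel) = (\<integral>p. (\<lambda>w. G w * of_real (\<gamma> w)) (?P p) \<partial>lborel)"
      by (rule integral_rotate[of "\<lambda>w. G w * of_real (\<gamma> w)"]) (simp_all add: ne)
    then show ?thesis by (simp add: I_def \<gamma>_def norm_mult ne)
  qed
  define F where "F = (\<lambda>(t, p). indicator {0..1::real} t *\<^sub>R (G (e t * ?P p) * of_real (\<gamma> (?P p))))"
  have Fint: "integrable (lborel \<Otimes>\<^sub>M lborel) F"
  proof (rule Bochner_Integration.integrable_bound)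
    show "integrable (lborel \<Otimes>\<^sub>M lborel) (\<lambda>(t, p). (indicator {0..1::real} t :: real) * (C * exp (- (pi - c) * (norm (?P p))\<^sup>2)))"
    proof (rule integrable_product_mult)
      show "integrable lborel (\<lambda>t. indicator {0..1::real} t :: real)" by simp
      show "integrable lborel (\<lambda>p. C * exp (- (pi - c) * (norm (?P p))\<^sup>2))"
        using planar_gaussian(1)[of "pi - c"] c by simp
    qed
    show "F \<in> borel_measurable (lborel \<Otimes>\<^sub>M lborel)" unfolding F_def by measurable
    show "AE x in lborel \<Otimes>\<^sub>M lborel. norm (F x) \<le> norm ((\<lambda>(t, p). (indicator {0..1::real} t :: real) * (C * exp (- (pi - c) * (norm (?P p))\<^sup>2))) x)"
    proof (rule AE_I2)
      fix q :: "real \<times> real \<times> real"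
      obtain t p where q: "q = (t, p)" by (cases q)
      let ?w = "?P p"
      have "norm (G (e t * ?w)) * \<gamma> ?w \<le> (C * exp (c * (norm ?w)\<^sup>2)) * \<gamma> ?w"
        using bound[of "e t * ?w"] by (intro mult_right_mono) (auto simp: norm_mult ne \<gamma>_def)
      also have "\<dots> = C * exp (- (pi - c) * (norm ?w)\<^sup>2)"
        by (simp add: \<gamma>_def mult.assoc exp_add[symmetric] algebra_simps)
      finally show "norm (F q) \<le> norm ((\<lambda>(t, p). (indicator {0..1::real} t :: real) * (C * exp (- (pi - c) * (norm (?P p))\<^sup>2))) q)"
        using C by (auto simp: F_def norm_mult \<gamma>_def indicator_def q)
    qed
  qed
  \<comment> \<open>Every rotated integral equals \<open>I\<close>, so averaging over the angle
    changes nothing; after Fubini the inner integral is a circle mean.\<close>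
  have "I = (LINT t|lborel. indicator {0..1::real} t *\<^sub>R I)" by simp
  also have "\<dots> = (LINT t|lborel. LINT p|lborel. F (t, p))"
    by (intro Bochner_Integration.integral_cong) (simp_all add: F_def rot)
  also have "\<dots> = (LINT p|lborel. LINT t|lborel. F (t, p))"
    using lborel_pair.Fubini_integral[of "\<lambda>t p. F (t, p)"] Fint by (simp add: case_prod_eta)
  also have "\<dots> = (LINT p|lborel. G 0 * of_real (\<gamma> (?P p)))"
  proof (intro Bochner_Integration.integral_cong refl)
    fix p
    have "(LINT t|lborel. F (t, p)) = (LINT t|lborel. (indicator {0..1} t *\<^sub>R G (e t * ?P p)) * of_real (\<gamma> (?P p)))"
      by (simp add: F_def)
    also have "\<dots> = (LINT t|lborel. indicator {0..1} t *\<^sub>R G (e t * ?P p)) * of_real (\<gamma> (?P p))"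
      by (rule integral_mult_left_zero)
    also have "(LINT t|lborel. indicator {0..1} t *\<^sub>R G (e t * ?P p)) = G 0"
      unfolding e_def by (rule circle_mean_value[OF hol])
    finally show "(LINT t|lborel. F (t, p)) = G 0 * of_real (\<gamma> (?P p))" .
  qed
  also have "\<dots> = G 0 * of_real (LINT p|lborel. \<gamma> (?P p))" by simp
  also have "(LINT p|lborel. \<gamma> (?P p)) = 1"
    using planar_gaussian(2)[of pi] by (simp add: \<gamma>_def)
  finally show ?thesis by (simp add: I_def \<gamma>_def)
qed

text \<open>Replacing w by z + w turns \<pi> z cnj w - \<pi> \<bar>w\<bar>^2 into - \<pi> w cnj z -
  \<pi> \<bar>w\<bar>^2. So the integral is the centred Gaussian mean of \<open>G\<close>, and
  \<open>G 0 = K z\<close>.\<close>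

lemma gaussian_reproducing:
  fixes K :: "complex \<Rightarrow> complex"
  assumes hol: "K holomorphic_on UNIV" and bound: "\<And>z. norm (K z) \<le> C * exp (c * (norm z)\<^sup>2)" and c: "0 \<le> c" "c < pi"
  shows "(LINT p|lborel. K (plane_to_complex p) * exp (of_real pi * z * cnj (plane_to_complex p)
      - of_real (pi * (norm (plane_to_complex p))\<^sup>2))) = K z"
proof -
  let ?P = plane_to_complex
  define G where "G = (\<lambda>w. K (z + w) * exp (- of_real pi * w * cnj z))"
  have [measurable]: "K \<in> borel_measurable borel" using hol by (rule borel_measurable_entire)
  have C: "C \<ge> 0" using order_trans[OF norm_ge_zero bound[of 0]] by simp
  have holG: "G holomorphic_on UNIV"
    unfolding G_def
    by (intro holomorphic_intros holomorphic_on_compose_gen[OF _ hol, unfolded o_def]) auto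
  \<comment> \<open>Half of the room below \<pi>. It absorbs the terms linear in \<bar>w\<bar>,
    whose coefficient \<open>B\<close> comes from 2 c \<bar>z\<bar> and from the exponential in
    \<open>G\<close>.\<close>
  define \<epsilon> where "\<epsilon> = (pi - c) / 2"
  have \<epsilon>: "\<epsilon> > 0" using c by (simp add: \<epsilon>_def)
  define B where "B = (2 * c + pi) * norm z"
  define C' where "C' = C * exp (c * (norm z)\<^sup>2 + B\<^sup>2 / (4 * \<epsilon>))"
  have boundG: "norm (G w) \<le> C' * exp ((c + \<epsilon>) * (norm w)\<^sup>2)" for w
  proof -
    have "norm (z + w) \<le> norm z + norm w" by (rule norm_triangle_ineq)
    then have "(norm (z + w))\<^sup>2 \<le> (norm z + norm w)\<^sup>2" by (intro power_mono) auto
    then have 1: "c * (norm (z + w))\<^sup>2 \<le> c * (norm z + norm w)\<^sup>2" using c by (intro mult_left_mono)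
    have "- Re (w * cnj z) \<le> norm (w * cnj z)"
      by (metis abs_Re_le_cmod abs_le_D2 minus_le_iff order_trans order_refl)
    then have 2: "pi * (- Re (w * cnj z)) \<le> pi * (norm w * norm z)" by (simp add: norm_mult)
    have 3: "B * norm w \<le> B\<^sup>2 / (4 * \<epsilon>) + \<epsilon> * (norm w)\<^sup>2"
    proof -
      have "0 \<le> (B / (2 * \<epsilon>) - norm w)\<^sup>2 * \<epsilon>" using \<epsilon> by simp
      also have "\<dots> = B\<^sup>2 / (4 * \<epsilon>) + \<epsilon> * (norm w)\<^sup>2 - B * norm w"
        using \<epsilon> by (simp add: power2_eq_square field_simps)
      finally show ?thesis by simp
    qed
    have "norm (G w) = norm (K (z + w)) * exp (pi * (- Re (w * cnj z)))"
      by (simp add: G_def norm_mult algebra_simps)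
    also have "\<dots> \<le> (C * exp (c * (norm (z + w))\<^sup>2)) * exp (pi * (norm w * norm z))"
      using 2 by (intro mult_mono bound) (auto simp: C)
    also have "\<dots> = C * exp (c * (norm (z + w))\<^sup>2 + pi * (norm w * norm z))" by (simp add: exp_add)
    also have "\<dots> \<le> C * exp (c * (norm z)\<^sup>2 + B\<^sup>2 / (4 * \<epsilon>) + (c + \<epsilon>) * (norm w)\<^sup>2)"
    proof -
      have "c * (norm (z + w))\<^sup>2 + pi * (norm w * norm z) \<le> c * (norm z + norm w)\<^sup>2 + pi * (norm w * norm z)"
        using 1 by simp
      also have "\<dots> = c * (norm z)\<^sup>2 + B * norm w + c * (norm w)\<^sup>2"
        by (simp add: B_def power2_eq_square algebra_simps)
      also have "\<dots> \<le> c * (norm z)\<^sup>2 + B\<^sup>2 / (4 * \<epsilon>) + (c + \<epsilon>) * (norm w)\<^sup>2"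
        using 3 by (simp add: algebra_simps)
      finally show ?thesis using C by (intro mult_left_mono) auto
    qed
    finally show ?thesis by (simp add: C'_def exp_add mult.assoc)
  qed
  have "c + \<epsilon> < pi" using c by (simp add: \<epsilon>_def field_simps)
  note mv = gaussian_mean_value[OF holG boundG this]
  define h where "h = (\<lambda>w. K w * exp (of_real pi * z * cnj w - of_real (pi * (norm w)\<^sup>2)))"
  have [measurable]: "h \<in> borel_measurable borel"
  proof -
    have "(\<lambda>w. exp (of_real pi * z * cnj w - of_real (pi * (norm w)\<^sup>2))) \<in> borel_measurable borel"
      by (intro borel_measurable_continuous_onI continuous_intros)
    then show ?thesis unfolding h_def by measurable
  qed
  have "(LINT p|lborel. h (?P p)) = (LINT p|distr lborel borel ((+) (Re z, Im z)). h (?P p))"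
    by (simp add: lborel_distr_plus)
  also have "\<dots> = (LINT p|lborel. h (?P ((Re z, Im z) + p)))"
    by (rule integral_distr) measurable
  also have "\<dots> = (LINT p|lborel. G (?P p) * of_real (exp (- pi * (norm (?P p))\<^sup>2)))"
  proof (intro Bochner_Integration.integral_cong refl)
    fix p
    define w where "w = ?P p"
    have P: "?P ((Re z, Im z) + p) = z + w" by (simp add: w_def plane_to_complex_def complex_eq_iff)
    have "of_real pi * z * cnj (z + w) - of_real (pi * (norm (z + w))\<^sup>2)
        = - of_real pi * w * cnj z + of_real (- pi * (norm w)\<^sup>2)"
      unfolding of_real_mult of_real_minus complex_norm_square by (simp add: algebra_simps)
    then have "h (z + w) = K (z + w) * (exp (- of_real pi * w * cnj z) * exp (of_real (- pi * (norm w)\<^sup>2)))"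
      unfolding h_def by (simp only: exp_add)
    then show "h (?P ((Re z, Im z) + p)) = G (?P p) * of_real (exp (- pi * (norm (?P p))\<^sup>2))"
      unfolding P w_def[symmetric] G_def exp_of_real[symmetric] by (simp only: mult.assoc)
  qed
  also have "\<dots> = K z" unfolding mv by (simp add: G_def)
  finally show ?thesis by (simp add: h_def)
qed

text \<open>The preimage is the superposition of the preimages of the reproducing kernels, weighted by \<open>K\<close>.\<close>

theorem bargmann_surjective:
  fixes K :: "complex \<Rightarrow> complex"
  assumes hol: "K holomorphic_on UNIV" and bound: "\<And>z. norm (K z) \<le> C * exp (c * (norm z)\<^sup>2)"
    and c: "0 \<le> c" "c < pi / 2"
  shows "\<exists>f. square_integrable f \<and> (\<forall>z. bargmann f z = exp (of_real (pi / 2) * z\<^sup>2) * K z)"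
proof -
  let ?P = plane_to_complex
  have [measurable]: "K \<in> borel_measurable borel" using hol by (rule borel_measurable_entire)
  have C: "C \<ge> 0" using order_trans[OF norm_ge_zero bound[of 0]] by simp
  define \<eta> where "\<eta> = pi / 2 - c"
  have \<eta>: "\<eta> > 0" using c by (simp add: \<eta>_def)
  \<comment> \<open>By \<open>bargmann_gaussian\<close> the Gaussian with parameter
    \<open>cnj w\<close> has a transform containing exp (\<pi> (cnj w)^2 / 2), which the last term
    of the exponent removes; exp (\<pi> z^2 / 2) exp (\<pi> z cnj w) is left, and
    \<open>sqrt 2\<close> in \<open>f\<close> cancels the remaining constant.\<close>
  define k where "k = (\<lambda>w x. K w * exp (- of_real (pi * (norm w)\<^sup>2) + (of_real (- pi * x\<^sup>2) + of_real (2 * pi * x) * cnj w) - of_real (pi / 2) * (cnj w)\<^sup>2))"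
  define f where "f = (\<lambda>x. of_real (sqrt 2) * (LINT p|lborel. k (?P p) x))"
  have km: "(\<lambda>(x, p). k (?P p) x) \<in> borel_measurable (lborel \<Otimes>\<^sub>M (lborel :: (real \<times> real) measure))"
  proof -
    have [measurable]: "cnj \<in> borel_measurable borel" by (intro borel_measurable_continuous_onI continuous_intros)
    show ?thesis unfolding k_def by measurable
  qed
  \<comment> \<open>Completing the square in \<open>x\<close> leaves exp (- \<pi> \<bar>w\<bar>^2 /
    2) from the Gaussian weight; the rest of that decay is consumed by (cnj w)^2. This is why
    \<open>c\<close> must stay below \<pi> / 2.\<close>
  have kbound: "norm (k w x) \<le> C * exp (- \<eta> * (norm w)\<^sup>2) * exp (- pi * (x - Re w)\<^sup>2)" for w x
  proof -
    have "norm (k w x) = norm (K w) * exp (- pi * (norm w)\<^sup>2 - pi * x\<^sup>2 + 2 * pi * x * Re w - pi / 2 * ((Re w)\<^sup>2 - (Im w)\<^sup>2))"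
      by (simp add: k_def norm_mult power2_eq_square)
    also have "\<dots> \<le> (C * exp (c * (norm w)\<^sup>2)) * exp (- pi * (norm w)\<^sup>2 - pi * x\<^sup>2 + 2 * pi * x * Re w - pi / 2 * ((Re w)\<^sup>2 - (Im w)\<^sup>2))"
      by (intro mult_right_mono bound) auto
    also have "\<dots> = C * exp (- \<eta> * (norm w)\<^sup>2) * exp (- pi * (x - Re w)\<^sup>2)"
      unfolding mult.assoc exp_add[symmetric] cmod_power2 \<eta>_def
      by (simp add: power2_eq_square algebra_simps)
    finally show ?thesis .
  qed
  \<comment> \<open>Since \<open>x\<^sup>2\<close> is at most 2 (Re w)^2 + 2 (x - Re w)^2, decay in
    x alone can be paid for with half of the decay in \<open>w\<close> and with the decay in x - Re
    w; this requires 2 \<delta> \<le> \<eta> / 2 and 2 \<delta> \<le> \<pi>.\<close>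
  define \<delta> where "\<delta> = min (\<eta> / 4) (pi / 2)"
  have \<delta>: "\<delta> > 0" "\<delta> \<le> \<eta> / 4" "\<delta> \<le> pi / 2" using \<eta> by (auto simp: \<delta>_def)
  have kbound': "norm (k w x) \<le> exp (- \<delta> * x\<^sup>2) * (C * exp (- (\<eta> / 2) * (norm w)\<^sup>2))" for w x
  proof -
    have "x\<^sup>2 \<le> 2 * (Re w)\<^sup>2 + 2 * (x - Re w)\<^sup>2"
    proof -
      have "0 \<le> (2 * Re w - x)\<^sup>2" by simp
      then show ?thesis by (simp add: power2_eq_square algebra_simps)
    qed
    then have "\<delta> * x\<^sup>2 \<le> \<delta> * (2 * (Re w)\<^sup>2 + 2 * (x - Re w)\<^sup>2)" using \<delta> by (intro mult_left_mono) auto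
    also have "\<dots> = (2 * \<delta>) * (Re w)\<^sup>2 + (2 * \<delta>) * (x - Re w)\<^sup>2" by (simp add: algebra_simps)
    also have "\<dots> \<le> (\<eta> / 2) * (norm w)\<^sup>2 + pi * (x - Re w)\<^sup>2"
      using \<delta> \<eta> by (intro add_mono mult_mono) (auto simp: cmod_power2)
    finally have "- \<eta> * (norm w)\<^sup>2 + (- pi * (x - Re w)\<^sup>2) \<le> - \<delta> * x\<^sup>2 + (- (\<eta> / 2) * (norm w)\<^sup>2)"
      by (simp add: field_simps)
    then have "C * exp (- \<eta> * (norm w)\<^sup>2 + (- pi * (x - Re w)\<^sup>2)) \<le> C * exp (- \<delta> * x\<^sup>2 + (- (\<eta> / 2) * (norm w)\<^sup>2))"
      using C by (intro mult_left_mono) auto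
    then show ?thesis using kbound[of w x] by (simp only: exp_add mult_ac)
  qed
  have gint: "integrable lborel (\<lambda>p. C * exp (- (\<eta> / 2) * (norm (?P p))\<^sup>2))"
    using planar_gaussian(1)[of "\<eta> / 2"] \<eta> by (intro integrable_mult_right) auto
  have fm[measurable]: "f \<in> borel_measurable borel"
  proof -
    have "(\<lambda>x. LINT p|lborel. k (?P p) x) \<in> borel_measurable lborel"
      by (rule lborel.borel_measurable_lebesgue_integral[OF km])
    then show ?thesis unfolding f_def by simp
  qed
  define A where "A = sqrt 2 * (LINT p|lborel. C * exp (- (\<eta> / 2) * (norm (?P p))\<^sup>2))"
  have fbound: "norm (f x) \<le> A * exp (- \<delta> * x\<^sup>2)" for x
  proof -
    have kx: "(\<lambda>p. k (?P p) x) \<in> borel_measurable lborel"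
      using measurable_compose[OF measurable_Pair1'[of x lborel lborel] km] by simp
    have "norm (LINT p|lborel. k (?P p) x) \<le> (LINT p|lborel. norm (k (?P p) x))" by (rule integral_norm_bound)
    also have "\<dots> \<le> (LINT p|lborel. exp (- \<delta> * x\<^sup>2) * (C * exp (- (\<eta> / 2) * (norm (?P p))\<^sup>2)))"
    proof (rule integral_mono[OF _ _ kbound'])
      show i: "integrable lborel (\<lambda>p. exp (- \<delta> * x\<^sup>2) * (C * exp (- (\<eta> / 2) * (norm (?P p))\<^sup>2)))"
        by (intro integrable_mult_right gint)
      show "integrable lborel (\<lambda>p. norm (k (?P p) x))"
        by (rule Bochner_Integration.integrable_bound[OF i])
          (use kx kbound' in \<open>auto intro!: AE_I2 intro: order_trans[OF _ abs_ge_self]\<close>)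
    qed
    also have "\<dots> = exp (- \<delta> * x\<^sup>2) * (LINT p|lborel. C * exp (- (\<eta> / 2) * (norm (?P p))\<^sup>2))"
      by (rule integral_mult_right_zero)
    finally show ?thesis by (simp add: f_def A_def norm_mult mult_ac)
  qed
  have sq: "square_integrable f"
    unfolding square_integrable_def
  proof
    show "f \<in> borel_measurable lebesgue" by (intro measurable_completion) measurable
    have "integrable lborel (\<lambda>x. (cmod (f x))\<^sup>2)"
    proof (rule Bochner_Integration.integrable_bound)
      show "integrable lborel (\<lambda>x. A\<^sup>2 * exp (- (2 * \<delta>) * (x - 0)\<^sup>2))"
        using gaussian_integral(1)[of "2 * \<delta>" 0] \<delta> by (intro integrable_mult_right) auto
      show "AE x in lborel. norm ((cmod (f x))\<^sup>2) \<le> norm (A\<^sup>2 * exp (- (2 * \<delta>) * (x - 0)\<^sup>2))"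
      proof (rule AE_I2)
        fix x
        have "(cmod (f x))\<^sup>2 \<le> (A * exp (- \<delta> * x\<^sup>2))\<^sup>2" by (intro power_mono fbound) auto
        also have "\<dots> = A\<^sup>2 * exp (- (2 * \<delta>) * (x - 0)\<^sup>2)"
          by (simp add: power_mult_distrib exp_double[symmetric] mult.assoc)
        finally show "norm ((cmod (f x))\<^sup>2) \<le> norm (A\<^sup>2 * exp (- (2 * \<delta>) * (x - 0)\<^sup>2))" by simp
      qed
    qed measurable
    then show "integrable lebesgue (\<lambda>x. (cmod (f x))\<^sup>2)" by (simp add: integrable_completion)
  qed
  have "bargmann f z = exp (of_real (pi / 2) * z\<^sup>2) * K z" for z
  proof -
    define E where "E = (\<lambda>x::real. exp (of_real (- pi * x\<^sup>2) + of_real (2 * pi * x) * z))"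
    have Ex: "exp (of_real (- pi * x\<^sup>2) + of_real (2 * pi * x) * z) = E x" for x by (simp add: E_def)
    have [measurable]: "E \<in> borel_measurable borel"
      unfolding E_def by (intro borel_measurable_continuous_onI continuous_intros)
    have Fint: "integrable (lborel \<Otimes>\<^sub>M lborel) (\<lambda>(x, p). k (?P p) x * E x)"
    proof (rule Bochner_Integration.integrable_bound)
      show "integrable (lborel \<Otimes>\<^sub>M lborel) (\<lambda>(x, p). (exp (pi * (Re z)\<^sup>2) * exp (- pi * (x - Re z)\<^sup>2)) * (C * exp (- (\<eta> / 2) * (norm (?P p))\<^sup>2)))"
        by (intro integrable_product_mult gint integrable_mult_right gaussian_integral) simp
      show "(\<lambda>(x, p). k (?P p) x * E x) \<in> borel_measurable (lborel \<Otimes>\<^sub>M lborel)"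
        using km by (simp add: case_prod_beta) measurable
      show "AE q in lborel \<Otimes>\<^sub>M lborel. norm ((\<lambda>(x, p). k (?P p) x * E x) q)
        \<le> norm ((\<lambda>(x, p). (exp (pi * (Re z)\<^sup>2) * exp (- pi * (x - Re z)\<^sup>2)) * (C * exp (- (\<eta> / 2) * (norm (?P p))\<^sup>2))) q)"
      proof (rule AE_I2)
        fix q :: "real \<times> real \<times> real"
        obtain x p where q: "q = (x, p)" by (cases q)
        have "exp (- \<delta> * x\<^sup>2) \<le> 1" using \<delta> by simp
        then have "exp (- \<delta> * x\<^sup>2) * (C * exp (- (\<eta> / 2) * (norm (?P p))\<^sup>2)) \<le> 1 * (C * exp (- (\<eta> / 2) * (norm (?P p))\<^sup>2))"
          using C by (intro mult_right_mono) auto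
        with kbound'[of "?P p" x] have "norm (k (?P p) x) \<le> C * exp (- (\<eta> / 2) * (norm (?P p))\<^sup>2)" by linarith
        then have "norm (k (?P p) x * E x) \<le> (C * exp (- (\<eta> / 2) * (norm (?P p))\<^sup>2)) * (exp (pi * (Re z)\<^sup>2) * exp (- pi * (x - Re z)\<^sup>2))"
          unfolding norm_mult E_def norm_bargmann_kernel by (rule mult_right_mono) auto
        also have "\<dots> = (exp (pi * (Re z)\<^sup>2) * exp (- pi * (x - Re z)\<^sup>2)) * (C * exp (- (\<eta> / 2) * (norm (?P p))\<^sup>2))"
          by (rule mult.commute)
        finally show "norm ((\<lambda>(x, p). k (?P p) x * E x) q)
          \<le> norm ((\<lambda>(x, p). (exp (pi * (Re z)\<^sup>2) * exp (- pi * (x - Re z)\<^sup>2)) * (C * exp (- (\<eta> / 2) * (norm (?P p))\<^sup>2))) q)"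
          unfolding q prod.case real_norm_def by (rule order_trans[OF _ abs_ge_self])
      qed
    qed
    have "bargmann f z = (LINT x|lborel. f x * E x)"
      unfolding bargmann_def Ex by (rule integral_completion) measurable
    also have "\<dots> = of_real (sqrt 2) * (LINT x|lborel. (LINT p|lborel. k (?P p) x * E x))"
      by (simp add: f_def mult.assoc)
    also have "(LINT x|lborel. (LINT p|lborel. k (?P p) x * E x)) = (LINT p|lborel. (LINT x|lborel. k (?P p) x * E x))"
      using lborel_pair.Fubini_integral[of "\<lambda>x p. k (?P p) x * E x"] Fint by simp
    also have "of_real (sqrt 2) * (LINT p|lborel. (LINT x|lborel. k (?P p) x * E x)) = (LINT p|lborel. of_real (sqrt 2) * (LINT x|lborel. k (?P p) x * E x))"
      by simp
    also have "\<dots> = (LINT p|lborel. exp (of_real (pi / 2) * z\<^sup>2) * (K (?P p) * exp (of_real pi * z * cnj (?P p) - of_real (pi * (norm (?P p))\<^sup>2))))"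
    proof (intro Bochner_Integration.integral_cong refl)
      fix p
      define w where "w = ?P p"
      define g where "g = (\<lambda>x::real. exp (of_real (- pi * x\<^sup>2) + of_real (2 * pi * x) * cnj w))"
      define a where "a = K w * exp (- of_real (pi * (norm w)\<^sup>2) - of_real (pi / 2) * (cnj w)\<^sup>2)"
      have [measurable]: "g \<in> borel_measurable borel"
        unfolding g_def by (intro borel_measurable_continuous_onI continuous_intros)
      have "k w x = a * g x" for x
        unfolding k_def a_def g_def mult.assoc exp_add[symmetric] by (simp add: algebra_simps)
      then have "(LINT x|lborel. k w x * E x) = a * (LINT x|lborel. g x * E x)"
        by (simp add: mult.assoc)
      also have "(LINT x|lborel. g x * E x) = bargmann g z"
        unfolding bargmann_def Ex by (rule integral_completion[symmetric]) measurable
      also have "\<dots> = exp (of_real (pi / 2) * (cnj w + z)\<^sup>2) / of_real (sqrt 2)"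
        unfolding g_def by (rule bargmann_gaussian)
      finally have "of_real (sqrt 2) * (LINT x|lborel. k w x * E x) = a * exp (of_real (pi / 2) * (cnj w + z)\<^sup>2)"
        by simp
      also have "\<dots> = exp (of_real (pi / 2) * z\<^sup>2) * (K w * exp (of_real pi * z * cnj w - of_real (pi * (norm w)\<^sup>2)))"
      proof -
        have "- of_real (pi * (norm w)\<^sup>2) - of_real (pi / 2) * (cnj w)\<^sup>2 + of_real (pi / 2) * (cnj w + z)\<^sup>2
          = of_real (pi / 2) * z\<^sup>2 + (of_real pi * z * cnj w - of_real (pi * (norm w)\<^sup>2))"
          by (simp add: power2_eq_square field_simps)
        then show ?thesis
          unfolding a_def by (simp only: mult.assoc exp_add[symmetric] mult.left_commute[of _ "K w"])
      qed
      finally show "of_real (sqrt 2) * (LINT x|lborel. k (?P p) x * E x)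
        = exp (of_real (pi / 2) * z\<^sup>2) * (K (?P p) * exp (of_real pi * z * cnj (?P p) - of_real (pi * (norm (?P p))\<^sup>2)))"
        unfolding w_def .
    qed
    also have "\<dots> = exp (of_real (pi / 2) * z\<^sup>2) * (LINT p|lborel. K (?P p) * exp (of_real pi * z * cnj (?P p) - of_real (pi * (norm (?P p))\<^sup>2)))"
      by (rule integral_mult_right_zero)
    also have "(LINT p|lborel. K (?P p) * exp (of_real pi * z * cnj (?P p) - of_real (pi * (norm (?P p))\<^sup>2))) = K z"
      by (rule gaussian_reproducing[OF hol bound c(1)]) (use c pi_gt_zero in linarith)
    finally show ?thesis .
  qed
  with sq show ?thesis by blast
qed

section \<open>Canonical products\<close>

text \<open>Euler's sine product at \<i> r: the partial products times \<pi> r increase to sinh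
  (\<pi> r), and sinh y \<le> y exp y. The case \<open>r = 0\<close> is separate because
  \<open>r\<close> is divided out.\<close>

lemma prod_one_plus_squares_le:
  fixes r :: real
  assumes r: "r \<ge> 0"
  shows "(\<Prod>k=1..n. 1 + r\<^sup>2 / (real k)\<^sup>2) \<le> exp (pi * r)"
proof (cases "r = 0")
  case True then show ?thesis by simp
next
  case False
  with r have r: "r > 0" by simp
  define p where "p = (\<lambda>n. \<Prod>k=1..n. 1 + r\<^sup>2 / (real k)\<^sup>2)"
  have "(\<lambda>n. of_real pi * (\<i> * of_real r) * (\<Prod>k=1..n. 1 - (\<i> * of_real r)\<^sup>2 / (of_nat k)\<^sup>2)) \<longlonglongrightarrow> sin (of_real pi * (\<i> * of_real r))"
    by (rule sin_product_formula_complex)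
  moreover have "of_real pi * (\<i> * of_real r) * (\<Prod>k=1..n. 1 - (\<i> * of_real r)\<^sup>2 / (of_nat k)\<^sup>2) = \<i> * of_real (pi * r * p n)" for n
    by (simp add: p_def power_mult_distrib)
  ultimately have "(\<lambda>n. \<i> * of_real (pi * r * p n)) \<longlonglongrightarrow> sin (of_real pi * (\<i> * of_real r))"
    by (simp only:)
  then have "(\<lambda>n. Im (\<i> * of_real (pi * r * p n))) \<longlonglongrightarrow> Im (sin (of_real pi * (\<i> * of_real r)))"
    by (rule tendsto_Im)
  then have lim: "(\<lambda>n. pi * r * p n) \<longlonglongrightarrow> Im (sin (of_real pi * (\<i> * of_real r)))"
    by simp
  have "incseq (\<lambda>n. pi * r * p n)"
  proof (rule incseq_SucI)
    fix n
    have "p n \<ge> 0" unfolding p_def by (intro prod_nonneg) auto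
    then have "p n * 1 \<le> p n * (1 + r\<^sup>2 / (real (Suc n))\<^sup>2)" by (intro mult_left_mono) auto
    also have "\<dots> = p (Suc n)" by (simp add: p_def)
    finally show "pi * r * p n \<le> pi * r * p (Suc n)" using r by (intro mult_left_mono) auto
  qed
  from incseq_le[OF this lim] have "pi * r * p n \<le> Im (sin (of_real pi * (\<i> * of_real r)))" .
  also have "\<dots> = (exp (pi * r) - exp (- (pi * r))) / 2"
    by (simp add: Im_sin)
  also have "\<dots> \<le> pi * r * exp (pi * r)"
  proof -
    define x where "x = pi * r"
    have "1 + (- (2 * x)) \<le> exp (- (2 * x))" by (rule exp_ge_add_one_self)
    then have "exp x * (1 - exp (- (2 * x))) \<le> exp x * (2 * x)" by (intro mult_left_mono) auto
    moreover have "exp x * (1 - exp (- (2 * x))) = exp x - exp (- x)"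
      by (simp add: right_diff_distrib exp_add[symmetric])
    ultimately have "exp x - exp (- x) \<le> exp x * (2 * x)" by linarith
    then show ?thesis by (simp add: x_def[symmetric] mult_ac)
  qed
  finally have "pi * r * p n \<le> pi * r * exp (pi * r)" .
  then show ?thesis using r by (simp add: p_def)
qed

text \<open>Takes care of the finitely many factors with zeros below the asymptotic bound: each
  costs only a constant and an arbitrarily small exponential type.\<close>

lemma one_plus_square_le_exp:
  fixes m \<epsilon> :: real
  assumes "\<epsilon> > 0" "m > 0"
  shows "\<exists>C>0. \<forall>r\<ge>0. 1 + r\<^sup>2 / m\<^sup>2 \<le> C * exp (\<epsilon> * r)"
proof -
  define C where "C = 1 + 2 / (\<epsilon> * m)\<^sup>2"
  have C: "C \<ge> 1" by (simp add: C_def)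
  have "1 + r\<^sup>2 / m\<^sup>2 \<le> C * exp (\<epsilon> * r)" if "r \<ge> 0" for r
  proof -
    have "1 + \<epsilon> * r + (\<epsilon> * r)\<^sup>2 / 2 \<le> exp (\<epsilon> * r)"
      using exp_lower_Taylor_quadratic[of "\<epsilon> * r"] that assms by simp
    moreover have "0 \<le> \<epsilon> * r" using that assms by simp
    ultimately have e: "1 + (\<epsilon> * r)\<^sup>2 / 2 \<le> exp (\<epsilon> * r)" by linarith
    have "r\<^sup>2 / m\<^sup>2 = 2 / (\<epsilon> * m)\<^sup>2 * ((\<epsilon> * r)\<^sup>2 / 2)"
      using assms by (simp add: power_mult_distrib)
    moreover have "1 + 2 / (\<epsilon> * m)\<^sup>2 * ((\<epsilon> * r)\<^sup>2 / 2) \<le> C * (1 + (\<epsilon> * r)\<^sup>2 / 2)"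
    proof -
      have "C * (1 + (\<epsilon> * r)\<^sup>2 / 2) = 1 + 2 / (\<epsilon> * m)\<^sup>2 * ((\<epsilon> * r)\<^sup>2 / 2) + (2 / (\<epsilon> * m)\<^sup>2 + (\<epsilon> * r)\<^sup>2 / 2)"
        unfolding C_def distrib_right distrib_left by simp
      moreover have "0 \<le> 2 / (\<epsilon> * m)\<^sup>2 + (\<epsilon> * r)\<^sup>2 / 2" by simp
      ultimately show ?thesis by linarith
    qed
    moreover have "C * (1 + (\<epsilon> * r)\<^sup>2 / 2) \<le> C * exp (\<epsilon> * r)" using e C by (intro mult_left_mono) auto
    ultimately show ?thesis by linarith
  qed
  then show ?thesis using C by (intro exI[of _ C]) auto
qed

text \<open>The zeros are placed at both signs because the reciprocals of \<open>\<mu>\<close> need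
  not be summable under linear growth, whereas their squares are. Comparing the tail with the sine
  product for zeros b k gives the type \<pi> / b, and the first factors use up the room between that
  and \<open>c\<close>.\<close>

theorem canonical_product:
  fixes \<mu> :: "nat \<Rightarrow> real"
  assumes pos: "\<And>n. n \<ge> 1 \<Longrightarrow> \<mu> n > 0" and b: "b > 0" and N: "\<And>n. n \<ge> N \<Longrightarrow> b * real n \<le> \<mu> n"
    and c: "c > pi / b"
  shows "\<exists>S C. S holomorphic_on UNIV \<and> S 0 = 1 \<and> (\<forall>n\<ge>1. S (of_real (\<mu> n)) = 0)
    \<and> (\<forall>w. norm (S w) \<le> C * exp (c * norm w))"
proof -
  \<comment> \<open>The factors are numbered from 0, the zeros from 1.\<close>
  define f where "f = (\<lambda>n (w::complex). 1 - w\<^sup>2 / of_real ((\<mu> (Suc n))\<^sup>2))"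
  have conv: "uniformly_convergent_on (cball 0 R) (\<lambda>M w. \<Prod>n<M. f n w)" for R
  proof (rule uniformly_convergent_on_prod')
    show "uniformly_convergent_on (cball 0 R) (\<lambda>M w. \<Sum>n<M. norm (f n w - 1))"
    proof (rule Weierstrass_m_test'_ev)
      show "\<forall>\<^sub>F n in sequentially. \<forall>w\<in>cball 0 R. norm (norm (f n w - 1)) \<le> R\<^sup>2 / b\<^sup>2 * (1 / (real (Suc n))\<^sup>2)"
        using eventually_ge_at_top[of N]
      proof eventually_elim
        case (elim n)
        show ?case
        proof
          fix w :: complex assume w: "w \<in> cball 0 R"
          have m: "0 < b * real (Suc n)" "b * real (Suc n) \<le> \<mu> (Suc n)" using N[of "Suc n"] elim b by auto
          have "norm (norm (f n w - 1)) = (norm w)\<^sup>2 / (\<mu> (Suc n))\<^sup>2"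
            by (simp add: f_def norm_divide norm_power)
          also have "\<dots> \<le> R\<^sup>2 / (b * real (Suc n))\<^sup>2"
            using m w by (intro frac_le power_mono) auto
          finally show "norm (norm (f n w - 1)) \<le> R\<^sup>2 / b\<^sup>2 * (1 / (real (Suc n))\<^sup>2)"
            by (simp add: power_mult_distrib)
        qed
      qed
      have "summable (\<lambda>n. 1 / (real (Suc n))\<^sup>2)"
        using inverse_squares_sums by (simp add: sums_iff add.commute)
      then show "summable (\<lambda>n. R\<^sup>2 / b\<^sup>2 * (1 / (real (Suc n))\<^sup>2))" by (rule summable_mult)
    qed
    show "continuous_on (cball 0 R) (f n)" for n
    proof (cases "\<mu> (Suc n) = 0")
      case True with pos[of "Suc n"] show ?thesis by simp
    next
      case False then show ?thesis unfolding f_def by (intro continuous_intros) auto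
    qed
  qed auto
  define S where "S = (\<lambda>w. lim (\<lambda>M. \<Prod>n<M. f n w))"
  have ul: "uniform_limit (cball 0 R) (\<lambda>M w. \<Prod>n<M. f n w) S sequentially" for R
    using conv[of R] unfolding uniformly_convergent_uniform_limit_iff S_def .
  have lim: "(\<lambda>M. \<Prod>n<M. f n w) \<longlonglongrightarrow> S w" for w
    by (rule tendsto_uniform_limitI[OF ul[of "norm w"]]) simp
  have holf: "f n holomorphic_on UNIV" for n
    unfolding f_def using pos[of "Suc n"] by (intro holomorphic_intros) auto
  have hol: "S holomorphic_on UNIV"
  proof (rule holomorphic_uniform_sequence[of UNIV "\<lambda>M w. \<Prod>n<M. f n w"])
    show "(\<lambda>w. \<Prod>n<M. f n w) holomorphic_on UNIV" for M
      by (intro holomorphic_intros holf)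
    fix x :: complex
    have "cball x 1 \<subseteq> cball 0 (norm x + 1)"
      by (metis add.commute cball_subset_cball_iff dist_0_norm dist_commute order_refl)
    then have "uniform_limit (cball x 1) (\<lambda>M w. \<Prod>n<M. f n w) S sequentially"
      by (rule uniform_limit_on_subset[OF ul])
    then show "\<exists>d>0. cball x d \<subseteq> UNIV \<and> uniform_limit (cball x d) (\<lambda>M w. \<Prod>n<M. f n w) S sequentially"
      by (intro exI[of _ 1]) auto
  qed simp
  have S0: "S 0 = 1"
    using LIMSEQ_unique[OF lim[of 0]] by (simp add: f_def)
  have zero: "S (of_real (\<mu> n)) = 0" if n: "n \<ge> 1" for n
  proof -
    obtain m where m: "n = Suc m" using n by (cases n) auto
    have "f m (of_real (\<mu> n)) = 0" using pos[OF n] by (simp add: f_def m)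
    then have "eventually (\<lambda>M. (\<Prod>k<M. f k (of_real (\<mu> n))) = 0) sequentially"
      by (intro eventually_sequentiallyI[of "Suc m"] prod_zero) auto
    then have "(\<lambda>M. \<Prod>k<M. f k (of_real (\<mu> n))) \<longlonglongrightarrow> 0" by (rule tendsto_eventually)
    then show ?thesis using LIMSEQ_unique[OF lim[of "of_real (\<mu> n)"]] by simp
  qed
  \<comment> \<open>The \<open>N\<close> exceptional factors together cost less than
    \<open>c - pi / b\<close>; \<open>Suc N\<close> keeps the denominator positive.\<close>
  define \<epsilon> where "\<epsilon> = (c - pi / b) / real (Suc N)"
  have \<epsilon>: "\<epsilon> > 0" using c by (simp add: \<epsilon>_def)
  have "\<forall>n. \<exists>C>0. \<forall>r\<ge>0. 1 + r\<^sup>2 / (\<mu> (Suc n))\<^sup>2 \<le> C * exp (\<epsilon> * r)"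
    using one_plus_square_le_exp[OF \<epsilon>] pos by simp
  then obtain D where D: "\<And>n. D n > 0" "\<And>n r. r \<ge> 0 \<Longrightarrow> 1 + r\<^sup>2 / (\<mu> (Suc n))\<^sup>2 \<le> D n * exp (\<epsilon> * r)"
    by metis
  define C where "C = (\<Prod>n<N. D n)"
  have bound: "norm (S w) \<le> C * exp (c * norm w)" for w
  proof -
    define r where "r = norm w"
    have r: "r \<ge> 0" by (simp add: r_def)
    have "norm (\<Prod>n<M. f n w) \<le> C * exp (c * r)" if M: "M \<ge> N" for M
    proof -
      have "norm (\<Prod>n<M. f n w) \<le> (\<Prod>n<M. 1 + r\<^sup>2 / (\<mu> (Suc n))\<^sup>2)"
        unfolding prod_norm[symmetric]
      proof (rule prod_mono)
        fix n
        have "norm (f n w) \<le> 1 + norm (w\<^sup>2 / of_real ((\<mu> (Suc n))\<^sup>2))"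
          unfolding f_def by (metis norm_one norm_triangle_ineq4)
        then show "0 \<le> norm (f n w) \<and> norm (f n w) \<le> 1 + r\<^sup>2 / (\<mu> (Suc n))\<^sup>2"
          by (simp add: norm_divide norm_power r_def)
      qed
      also have "\<dots> = (\<Prod>n<N. 1 + r\<^sup>2 / (\<mu> (Suc n))\<^sup>2) * (\<Prod>n\<in>{N..<M}. 1 + r\<^sup>2 / (\<mu> (Suc n))\<^sup>2)"
      proof -
        have "(\<Prod>n<M. 1 + r\<^sup>2 / (\<mu> (Suc n))\<^sup>2) = (\<Prod>n\<in>{..<N} \<union> {N..<M}. 1 + r\<^sup>2 / (\<mu> (Suc n))\<^sup>2)"
          by (rule prod.cong) (use M in auto)
        also have "\<dots> = (\<Prod>n<N. 1 + r\<^sup>2 / (\<mu> (Suc n))\<^sup>2) * (\<Prod>n\<in>{N..<M}. 1 + r\<^sup>2 / (\<mu> (Suc n))\<^sup>2)"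
          by (rule prod.union_disjoint) auto
        finally show ?thesis .
      qed
      also have "\<dots> \<le> (\<Prod>n<N. D n * exp (\<epsilon> * r)) * (\<Prod>n\<in>{N..<M}. 1 + (r / b)\<^sup>2 / (real (Suc n))\<^sup>2)"
      proof (rule mult_mono)
        show "(\<Prod>n<N. 1 + r\<^sup>2 / (\<mu> (Suc n))\<^sup>2) \<le> (\<Prod>n<N. D n * exp (\<epsilon> * r))"
          using D r by (intro prod_mono) (auto intro: add_nonneg_nonneg)
        show "(\<Prod>n\<in>{N..<M}. 1 + r\<^sup>2 / (\<mu> (Suc n))\<^sup>2) \<le> (\<Prod>n\<in>{N..<M}. 1 + (r / b)\<^sup>2 / (real (Suc n))\<^sup>2)"
        proof (rule prod_mono)
          fix n assume n: "n \<in> {N..<M}"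
          have m: "0 < b * real (Suc n)" "b * real (Suc n) \<le> \<mu> (Suc n)" using N[of "Suc n"] n b by auto
          have "r\<^sup>2 / (\<mu> (Suc n))\<^sup>2 \<le> r\<^sup>2 / (b * real (Suc n))\<^sup>2"
            using m r by (intro frac_le power_mono) auto
          then show "0 \<le> 1 + r\<^sup>2 / (\<mu> (Suc n))\<^sup>2 \<and> 1 + r\<^sup>2 / (\<mu> (Suc n))\<^sup>2 \<le> 1 + (r / b)\<^sup>2 / (real (Suc n))\<^sup>2"
            by (simp add: power_mult_distrib power_divide add_nonneg_nonneg)
        qed
        show "0 \<le> (\<Prod>n<N. D n * exp (\<epsilon> * r))" using D(1) by (intro prod_nonneg) (simp add: less_imp_le)
        show "0 \<le> (\<Prod>n\<in>{N..<M}. 1 + r\<^sup>2 / (\<mu> (Suc n))\<^sup>2)" by (intro prod_nonneg) (simp add: add_nonneg_nonneg)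
      qed
      also have "\<dots> \<le> (C * exp (real N * \<epsilon> * r)) * exp (pi * (r / b))"
      proof (rule mult_mono)
        show "(\<Prod>n<N. D n * exp (\<epsilon> * r)) \<le> C * exp (real N * \<epsilon> * r)"
          by (simp add: prod.distrib C_def exp_of_nat_mult[symmetric] mult.assoc)
        have "(\<Prod>n\<in>{N..<M}. 1 + (r / b)\<^sup>2 / (real (Suc n))\<^sup>2) = (\<Prod>k\<in>{Suc N..M}. 1 + (r / b)\<^sup>2 / (real k)\<^sup>2)"
          unfolding atLeastLessThanSuc_atLeastAtMost[symmetric] by (rule prod.shift_bounds_Suc_ivl[symmetric])
        also have "\<dots> \<le> (\<Prod>k=1..M. 1 + (r / b)\<^sup>2 / (real k)\<^sup>2)"
          by (rule prod_mono2) (auto intro: add_nonneg_nonneg)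
        also have "\<dots> \<le> exp (pi * (r / b))" using r b by (intro prod_one_plus_squares_le) auto
        finally show "(\<Prod>n\<in>{N..<M}. 1 + (r / b)\<^sup>2 / (real (Suc n))\<^sup>2) \<le> exp (pi * (r / b))" .
        show "0 \<le> C * exp (real N * \<epsilon> * r)" using D(1) unfolding C_def by (intro mult_nonneg_nonneg prod_nonneg) (auto simp: less_imp_le)
        show "0 \<le> (\<Prod>n\<in>{N..<M}. 1 + (r / b)\<^sup>2 / (real (Suc n))\<^sup>2)" by (intro prod_nonneg) (simp add: add_nonneg_nonneg)
      qed
      also have "\<dots> = C * exp ((real N * \<epsilon> + pi / b) * r)"
        by (simp add: exp_add[symmetric] algebra_simps)
      also have "\<dots> \<le> C * exp (c * r)"
      proof -
        have "real N * \<epsilon> \<le> real (Suc N) * \<epsilon>" using \<epsilon> by (intro mult_right_mono) auto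
        also have "\<dots> = c - pi / b" by (simp add: \<epsilon>_def del: of_nat_Suc)
        finally have "(real N * \<epsilon> + pi / b) * r \<le> c * r" using r by (intro mult_right_mono) auto
        moreover have "C \<ge> 0" using D(1) unfolding C_def by (intro prod_nonneg) (auto simp: less_imp_le)
        ultimately show ?thesis by (intro mult_left_mono) auto
      qed
      finally show ?thesis .
    qed
    then show ?thesis
      unfolding r_def by (intro tendsto_upperbound[OF tendsto_norm[OF lim[of w]]] eventually_sequentiallyI[of N]) auto
  qed
  show ?thesis using hol S0 zero bound by blast
qed

section \<open>Phase retrieval from samples on three lines\<close>

lemma bargmann_AE_scaled:
  assumes "square_integrable f" "square_integrable g" "AE x in lebesgue. f x = c * g x"
  shows "bargmann f z = c * bargmann g z"
proof -
  have "bargmann (\<lambda>x. f x - c * g x) z = 0"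
    unfolding bargmann_def by (rule integral_eq_zero_AE) (use assms(3) in auto)
  then show ?thesis using bargmann_diff_scaled[OF assms(1,2)] by simp
qed

text \<open>\<open>time_freq\<close> identifies \<open>(t, \<omega>)\<close> with the argument of the Bargmann transform, which turns the
  direction \<open>(sin \<theta>, cos \<theta>)\<close> into the unit complex number \<open>line_dir \<theta>\<close>.\<close>

definition time_freq :: "real \<Rightarrow> real \<Rightarrow> complex" where
  "time_freq t \<omega> = Complex t (- \<omega>)"

definition line_dir :: "real \<Rightarrow> complex" where
  "line_dir \<theta> = Complex (sin \<theta>) (- cos \<theta>)"

lemma norm_line_dir [simp]: "norm (line_dir \<theta>) = 1"
  by (simp add: line_dir_def cmod_def)

lemma line_dir_nonzero [simp]: "line_dir \<theta> \<noteq> 0"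
  by (metis norm_line_dir norm_zero zero_neq_one)

lemma norm_gabor_transform_on_line:
  "cmod (gabor_transform f ((t, \<omega>) + s *\<^sub>R (sin \<theta>, cos \<theta>)))
    = exp (- pi * (t + s * sin \<theta>)\<^sup>2) * cmod (bargmann f (time_freq t \<omega> + of_real s * line_dir \<theta>))"
proof -
  have "of_real (t + s * sin \<theta>) - \<i> * of_real (\<omega> + s * cos \<theta>) = time_freq t \<omega> + of_real s * line_dir \<theta>"
    by (simp add: time_freq_def line_dir_def complex_eq_iff)
  then show ?thesis using norm_gabor_transform[of f "t + s * sin \<theta>" "\<omega> + s * cos \<theta>"] by simp
qed

text \<open>Dividing by the unit number \<open>line_dir \<theta>\<close> rotates the lines to
  horizontal position, so the imaginary part is the signed distance between the parallel lines
  through the two points.\<close>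

lemma Im_divide_line_dir:
  "Im ((time_freq t \<omega> - time_freq t' \<omega>') / line_dir \<theta>) = (t - t') * cos \<theta> - (\<omega> - \<omega>') * sin \<theta>"
proof -
  have eq: "(time_freq t \<omega> - time_freq t' \<omega>') / line_dir \<theta> = (time_freq t \<omega> - time_freq t' \<omega>') * cnj (line_dir \<theta>)"
  proof -
    have "line_dir \<theta> * cnj (line_dir \<theta>) = 1" using complex_norm_square[of "line_dir \<theta>"] by simp
    then show ?thesis
      by (metis divide_inverse inverse_unique)
  qed
  show ?thesis unfolding eq by (simp add: time_freq_def line_dir_def algebra_simps)
qed

text \<open>For real s the squared modulus is a function times its own conjugate; writing
  \<open>cnj s\<close> inside the second factor makes it entire in s. The weight in \<open>H\<close>
  compensates the growth along the line, and sin^2 + cos^2 = 1 leaves exactly exp (2 \<pi> (Im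
  s)^2), independently of the direction.\<close>

lemma bargmann_square_eq_on_line:
  fixes lam :: "nat \<Rightarrow> real"
  assumes sq: "square_integrable f1" "square_integrable f2"
    and pos: "\<And>n. n \<ge> 1 \<Longrightarrow> lam n > 0" and mono: "strict_mono_on {1..} lam"
    and lim: "(\<lambda>n. lam n / sqrt (real n)) \<longlonglongrightarrow> a" and a: "a < 1"
    and eq: "\<And>n. n \<ge> 1 \<Longrightarrow> cmod (gabor_transform f1 ((t, \<omega>) + lam n *\<^sub>R (sin \<theta>, cos \<theta>)))
      = cmod (gabor_transform f2 ((t, \<omega>) + lam n *\<^sub>R (sin \<theta>, cos \<theta>)))"
  shows "bargmann f1 (time_freq t \<omega> + s * line_dir \<theta>) * cnj (bargmann f1 (time_freq t \<omega> + cnj s * line_dir \<theta>))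
    = bargmann f2 (time_freq t \<omega> + s * line_dir \<theta>) * cnj (bargmann f2 (time_freq t \<omega> + cnj s * line_dir \<theta>))"
proof -
  define z where "z = time_freq t \<omega>"
  define u where "u = line_dir \<theta>"
  define H where "H = (\<lambda>f s. exp (- of_real (2 * pi) * (of_real t + s * of_real (sin \<theta>))\<^sup>2) *
    (bargmann f (z + s * u) * cnj (bargmann f (z + cnj s * u))))"
  have holH: "H f holomorphic_on UNIV" if "square_integrable f" for f
  proof -
    have "(\<lambda>s. bargmann f (z + s * u)) holomorphic_on UNIV"
      by (intro holomorphic_on_compose_gen[OF _ holomorphic_bargmann[OF that], unfolded o_def] holomorphic_intros) auto
    then show ?thesis unfolding H_def
      by (intro holomorphic_intros holomorphic_on_reflect[of "\<lambda>s. bargmann f (z + s * u)"]) auto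
  qed
  have boundH: "norm (H f s) \<le> ((\<integral>x. (cmod (f x))\<^sup>2 \<partial>lebesgue) + 1)\<^sup>2 * exp (2 * pi * (Im s)\<^sup>2)"
    if "square_integrable f" for f s
  proof -
    define A where "A = (\<integral>x. (cmod (f x))\<^sup>2 \<partial>lebesgue) + 1"
    have A: "A \<ge> 0" unfolding A_def by (intro add_nonneg_nonneg Bochner_Integration.integral_nonneg) auto
    have re: "Re (z + s * u) = t + Re s * sin \<theta> + Im s * cos \<theta>" "Re (z + cnj s * u) = t + Re s * sin \<theta> - Im s * cos \<theta>"
      by (simp_all add: z_def u_def time_freq_def line_dir_def)
    have "norm (exp (- of_real (2 * pi) * (of_real t + s * of_real (sin \<theta>))\<^sup>2))
        = exp (- 2 * pi * ((t + Re s * sin \<theta>)\<^sup>2 - (Im s * sin \<theta>)\<^sup>2))"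
      by (simp add: power2_eq_square algebra_simps)
    moreover have "norm (bargmann f (z + s * u) * cnj (bargmann f (z + cnj s * u)))
        \<le> (A * exp (pi * (t + Re s * sin \<theta> + Im s * cos \<theta>)\<^sup>2)) * (A * exp (pi * (t + Re s * sin \<theta> - Im s * cos \<theta>)\<^sup>2))"
      unfolding norm_mult complex_mod_cnj re[symmetric] A_def
      by (intro mult_mono norm_bargmann_le that) (use A A_def in auto)
    ultimately have "norm (H f s) \<le> exp (- 2 * pi * ((t + Re s * sin \<theta>)\<^sup>2 - (Im s * sin \<theta>)\<^sup>2)) *
        ((A * exp (pi * (t + Re s * sin \<theta> + Im s * cos \<theta>)\<^sup>2)) * (A * exp (pi * (t + Re s * sin \<theta> - Im s * cos \<theta>)\<^sup>2)))"
      unfolding H_def norm_mult[of "exp _"] by (intro mult_mono) auto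
    also have "\<dots> = A\<^sup>2 * exp (- 2 * pi * ((t + Re s * sin \<theta>)\<^sup>2 - (Im s * sin \<theta>)\<^sup>2) + pi * (t + Re s * sin \<theta> + Im s * cos \<theta>)\<^sup>2 + pi * (t + Re s * sin \<theta> - Im s * cos \<theta>)\<^sup>2)"
    proof -
      have "exp a * ((A * exp b) * (A * exp c)) = A\<^sup>2 * exp (a + b + c)" for a b c :: real
        by (simp add: exp_add power2_eq_square)
      then show ?thesis .
    qed
    also have "- 2 * pi * ((t + Re s * sin \<theta>)\<^sup>2 - (Im s * sin \<theta>)\<^sup>2) + pi * (t + Re s * sin \<theta> + Im s * cos \<theta>)\<^sup>2 + pi * (t + Re s * sin \<theta> - Im s * cos \<theta>)\<^sup>2
        = 2 * pi * (Im s)\<^sup>2 * ((sin \<theta>)\<^sup>2 + (cos \<theta>)\<^sup>2)"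
    proof -
      have "- 2 * pi * (x\<^sup>2 - (y * p)\<^sup>2) + pi * (x + y * q)\<^sup>2 + pi * (x - y * q)\<^sup>2 = 2 * pi * y\<^sup>2 * (p\<^sup>2 + q\<^sup>2)"
        for x y p q :: real
        by (simp add: power2_eq_square algebra_simps)
      then show ?thesis .
    qed
    also have "\<dots> = 2 * pi * (Im s)\<^sup>2" by simp
    finally show ?thesis by (simp add: A_def)
  qed
  have H2: "H f (of_real s) = of_real ((cmod (gabor_transform f ((t, \<omega>) + s *\<^sub>R (sin \<theta>, cos \<theta>))))\<^sup>2)" for f s
  proof -
    have "(exp (- pi * (t + s * sin \<theta>)\<^sup>2))\<^sup>2 = exp (- (2 * pi) * (t + s * sin \<theta>)\<^sup>2)"
      by (simp add: exp_double[symmetric] mult.assoc)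
    moreover have "exp (- of_real (2 * pi) * (of_real t + of_real s * of_real (sin \<theta>))\<^sup>2)
        = complex_of_real (exp (- (2 * pi) * (t + s * sin \<theta>)\<^sup>2))"
      by (simp add: exp_of_real[symmetric])
    ultimately show ?thesis
      unfolding norm_gabor_transform_on_line H_def z_def[symmetric] u_def[symmetric]
      by (simp add: power_mult_distrib complex_norm_square[symmetric])
  qed
  define D where "D = (\<lambda>s. H f1 s - H f2 s)"
  have "D s = 0"
  proof (rule zero_on_positive_sequence_imp_zero[where D = D and s = s and lam = lam and a = a and
        C = "((\<integral>x. (cmod (f1 x))\<^sup>2 \<partial>lebesgue) + 1)\<^sup>2 + ((\<integral>x. (cmod (f2 x))\<^sup>2 \<partial>lebesgue) + 1)\<^sup>2"])
    show "D holomorphic_on UNIV" unfolding D_def by (intro holomorphic_intros holH sq)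
    show "D (of_real (lam n)) = 0" if "n \<ge> 1" for n
      using eq[OF that] by (simp add: D_def H2)
    show "norm (D s) \<le> (((\<integral>x. (cmod (f1 x))\<^sup>2 \<partial>lebesgue) + 1)\<^sup>2 + ((\<integral>x. (cmod (f2 x))\<^sup>2 \<partial>lebesgue) + 1)\<^sup>2) * exp (2 * pi * (Im s)\<^sup>2)" for s
      using norm_triangle_ineq4[of "H f1 s" "H f2 s"] boundH[OF sq(1), of s] boundH[OF sq(2), of s]
      by (simp add: D_def distrib_right)
  qed (use pos mono lim a in auto)
  then show ?thesis by (simp add: D_def H_def z_def u_def)
qed

theorem phase_retrieval_three_lines:
  fixes lam :: "nat \<Rightarrow> nat \<Rightarrow> real" and a t \<omega> :: "nat \<Rightarrow> real" and \<theta> :: real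
  assumes sq: "square_integrable f1" "square_integrable f2"
    and pos: "\<And>l n. l \<in> {1, 2, 3} \<Longrightarrow> n \<ge> 1 \<Longrightarrow> lam n l > 0"
    and mono: "\<And>l. l \<in> {1, 2, 3} \<Longrightarrow> strict_mono_on {1..} (\<lambda>n. lam n l)"
    and lim: "\<And>l. l \<in> {1, 2, 3} \<Longrightarrow> (\<lambda>n. lam n l / sqrt (real n)) \<longlonglongrightarrow> a l"
    and a: "\<And>l. l \<in> {1, 2, 3} \<Longrightarrow> a l < 1"
    and eq: "\<And>l n. l \<in> {1, 2, 3} \<Longrightarrow> n \<ge> 1 \<Longrightarrow>
      cmod (gabor_transform f1 ((t l, \<omega> l) + lam n l *\<^sub>R (sin \<theta>, cos \<theta>)))
      = cmod (gabor_transform f2 ((t l, \<omega> l) + lam n l *\<^sub>R (sin \<theta>, cos \<theta>)))"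
    and irrat: "((t 1 - t 3) * cos \<theta> - (\<omega> 1 - \<omega> 3) * sin \<theta>) / ((t 2 - t 3) * cos \<theta> - (\<omega> 2 - \<omega> 3) * sin \<theta>) \<notin> \<rat>"
  shows "\<exists>\<alpha>::real. AE x in lebesgue. f1 x = exp (\<i> * of_real \<alpha>) * f2 x"
proof -
  define z where "z = (\<lambda>l. time_freq (t l) (\<omega> l))"
  define u where "u = line_dir \<theta>"
  have u: "u \<noteq> 0" by (simp add: u_def)
  \<comment> \<open>In the coordinate s with w = z 3 + s u, the third line is the real axis and the
    line with index \<open>l\<close> is its translate by \<open>\<sigma> l\<close>.\<close>
  define \<sigma> where "\<sigma> = (\<lambda>l. (z l - z 3) / u)"
  define A where "A = (\<lambda>f s. bargmann f (z 3 + s * u))"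
  have holA: "A f holomorphic_on UNIV" if "square_integrable f" for f
    unfolding A_def
    by (intro holomorphic_on_compose_gen[OF _ holomorphic_bargmann[OF that], unfolded o_def] holomorphic_intros) auto
  have E: "A f1 (s + \<sigma> l) * cnj (A f1 (cnj s + \<sigma> l)) = A f2 (s + \<sigma> l) * cnj (A f2 (cnj s + \<sigma> l))"
    if l: "l \<in> {1, 2, 3}" for l s
  proof -
    have "z 3 + (s + \<sigma> l) * u = z l + s * u" for s
      using u by (simp add: \<sigma>_def distrib_right)
    then show ?thesis
      using bargmann_square_eq_on_line[OF sq pos[OF l] mono[OF l] lim[OF l] a[OF l] eq[OF l]]
      by (simp add: A_def z_def u_def)
  qed
  have "\<sigma> 3 = 0" by (simp add: \<sigma>_def)
  then have E0: "A f1 s * cnj (A f1 (cnj s)) = A f2 s * cnj (A f2 (cnj s))" for s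
    using E[of 3 s] by simp
  have im: "Im (\<sigma> l) = (t l - t 3) * cos \<theta> - (\<omega> l - \<omega> 3) * sin \<theta>" for l
    unfolding \<sigma>_def z_def u_def by (rule Im_divide_line_dir)
  have "\<exists>c. norm c = 1 \<and> (\<forall>s. A f1 s = c * A f2 s)"
    by (rule entire_eq_unimodular_multiple[OF holA[OF sq(1)] holA[OF sq(2)] E0 E[of 1] E[of 2]])
      (use irrat im in auto)
  then obtain c where c: "norm c = 1" "\<And>s. A f1 s = c * A f2 s" by blast
  have B: "bargmann f1 w = c * bargmann f2 w" for w
    using c(2)[of "(w - z 3) / u"] u by (simp add: A_def)
  have "AE x in lebesgue. f1 x - c * f2 x = 0"
    by (rule bargmann_zero_imp_zero[OF square_integrable_diff_scaled[OF sq]])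
      (simp add: bargmann_diff_scaled[OF sq] B)
  moreover have "c = exp (\<i> * of_real (Arg c))"
    using Arg_eq[of c] c(1) by (cases "c = 0") auto
  ultimately show ?thesis by (intro exI[of _ "Arg c"]) auto
qed

text \<open>Failure is shown for the full lines, since it passes to every subset. A linear
  exponential is real on a line when its phase there is a multiple of \<pi>; commensurability lets
  one frequency serve all three lines.\<close>

theorem no_phase_retrieval_commensurable_lines:
  fixes t \<omega> :: "nat \<Rightarrow> real" and \<theta> :: real
  assumes d: "(t 2 - t 3) * cos \<theta> - (\<omega> 2 - \<omega> 3) * sin \<theta> \<noteq> 0"
    and rat: "((t 1 - t 3) * cos \<theta> - (\<omega> 1 - \<omega> 3) * sin \<theta>) / ((t 2 - t 3) * cos \<theta> - (\<omega> 2 - \<omega> 3) * sin \<theta>) \<in> \<rat>"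
  shows "\<not> does_gabor_phase_retrieval (\<Union>l\<in>{1, 2, 3}. range (\<lambda>s. (t l, \<omega> l) + s *\<^sub>R (sin \<theta>, cos \<theta>)))"
proof
  assume R: "does_gabor_phase_retrieval (\<Union>l\<in>{1, 2, 3}. range (\<lambda>s. (t l, \<omega> l) + s *\<^sub>R (sin \<theta>, cos \<theta>)))"
  define z where "z = (\<lambda>l. time_freq (t l) (\<omega> l))"
  define u where "u = line_dir \<theta>"
  have u: "u \<noteq> 0" by (simp add: u_def)
  define \<sigma> where "\<sigma> = (\<lambda>l. (z l - z 3) / u)"
  have im: "Im (\<sigma> l) = (t l - t 3) * cos \<theta> - (\<omega> l - \<omega> 3) * sin \<theta>" for l
    unfolding \<sigma>_def z_def u_def by (rule Im_divide_line_dir)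
  have "Im (\<sigma> 1) / Im (\<sigma> 2) \<in> \<rat>" using rat by (simp only: im)
  then obtain p q :: int where pq: "q > 0" "Im (\<sigma> 1) / Im (\<sigma> 2) = of_int p / of_int q"
    by (elim Rats_cases') blast
  \<comment> \<open>The phase of \<open>E\<close> on a line is \<kappa> times its offset:
    \<open>q\<close> times \<pi> on the second line and, as the offsets are in ratio
    \<open>p\<close> to \<open>q\<close>, \<open>p\<close> times \<pi> on the first.\<close>
  define \<kappa> where "\<kappa> = pi * of_int q / Im (\<sigma> 2)"
  have \<sigma>2: "Im (\<sigma> 2) \<noteq> 0" using d by (simp add: im)
  have \<kappa>: "\<kappa> \<noteq> 0" using pq(1) \<sigma>2 by (simp add: \<kappa>_def)
  have "Im (\<sigma> 1) * of_int q = of_int p * Im (\<sigma> 2)" using pq \<sigma>2 by (simp add: field_simps)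
  then have \<kappa>\<sigma>: "\<kappa> * Im (\<sigma> 1) = of_int p * pi" "\<kappa> * Im (\<sigma> 2) = of_int q * pi" "\<kappa> * Im (\<sigma> 3) = of_int 0 * pi"
    using \<sigma>2 by (auto simp: \<kappa>_def \<sigma>_def field_simps)
  define E where "E = (\<lambda>w. exp (of_real \<kappa> * ((w - z 3) / u)))"
  define b where "b = of_real \<kappa> / (of_real pi * u)"
  define g where "g = (\<lambda>b x. exp (of_real (- pi * x\<^sup>2) + of_real (2 * pi * x) * b) :: complex)"
  \<comment> \<open>Removes the constant exp (\<pi> b^2 / 2) produced by
    \<open>bargmann_gaussian\<close> and normalizes \<open>E\<close> to 1 at
    \<open>z 3\<close>.\<close>
  define \<gamma> where "\<gamma> = exp (- of_real \<kappa> * (z 3 / u) - of_real (pi / 2) * b\<^sup>2)"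
  define f where "f = (\<lambda>c x. g 0 x - c * \<gamma> * g b x)"
  have sq: "square_integrable (f c)" for c
    unfolding f_def g_def by (intro square_integrable_diff_scaled square_integrable_gaussian)
  have Bf: "bargmann (f c) w = exp (of_real (pi / 2) * w\<^sup>2) / of_real (sqrt 2) * (1 - c * E w)" for c w
  proof -
    have "bargmann (f c) w = bargmann (g 0) w - c * \<gamma> * bargmann (g b) w"
      unfolding f_def g_def by (intro bargmann_diff_scaled square_integrable_gaussian)
    also have "\<dots> = exp (of_real (pi / 2) * (0 + w)\<^sup>2) / of_real (sqrt 2) - c * \<gamma> * (exp (of_real (pi / 2) * (b + w)\<^sup>2) / of_real (sqrt 2))"
      unfolding g_def bargmann_gaussian ..
    also have "\<gamma> * exp (of_real (pi / 2) * (b + w)\<^sup>2) = exp (of_real (pi / 2) * w\<^sup>2) * E w"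
    proof -
      have "of_real pi * b * w = of_real \<kappa> * (w / u)" by (simp add: b_def)
      then have "- of_real \<kappa> * (z 3 / u) - of_real (pi / 2) * b\<^sup>2 + of_real (pi / 2) * (b + w)\<^sup>2
        = of_real (pi / 2) * w\<^sup>2 + of_real \<kappa> * ((w - z 3) / u)"
        by (simp add: power2_eq_square algebra_simps diff_divide_distrib add_divide_distrib)
      then show ?thesis unfolding \<gamma>_def E_def exp_add[symmetric] by simp
    qed
    then have "c * \<gamma> * (exp (of_real (pi / 2) * (b + w)\<^sup>2) / of_real (sqrt 2)) = c * (exp (of_real (pi / 2) * w\<^sup>2) * E w) / of_real (sqrt 2)"
      by (simp add: mult.assoc)
    finally show ?thesis by (simp add: algebra_simps diff_divide_distrib)
  qed
  have "\<forall>p\<in>(\<Union>l\<in>{1, 2, 3}. range (\<lambda>s. (t l, \<omega> l) + s *\<^sub>R (sin \<theta>, cos \<theta>))).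
      cmod (gabor_transform (f (- \<i>)) p) = cmod (gabor_transform (f \<i>) p)"
  proof
    fix p assume "p \<in> (\<Union>l\<in>{1, 2, 3}. range (\<lambda>s. (t l, \<omega> l) + s *\<^sub>R (sin \<theta>, cos \<theta>)))"
    then obtain l s where l: "l \<in> {1, 2, 3}" and p: "p = (t l, \<omega> l) + s *\<^sub>R (sin \<theta>, cos \<theta>)" by blast
    define w where "w = z l + of_real s * u"
    have "(w - z 3) / u = \<sigma> l + of_real s" using u by (simp add: w_def \<sigma>_def field_simps)
    then have "E w = exp (of_real \<kappa> * (\<sigma> l + of_real s))" by (simp only: E_def)
    then have "Im (E w) = exp (\<kappa> * (Re (\<sigma> l) + s)) * sin (\<kappa> * Im (\<sigma> l))"
      by (simp add: Im_exp)
    also have "sin (\<kappa> * Im (\<sigma> l)) = 0"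
      using l \<kappa>\<sigma> sin_times_pi_eq_0 by (metis Ints_of_int empty_iff insert_iff)
    finally have "E w = of_real (Re (E w))" by (simp add: complex_eq_iff)
    then obtain e where e: "E w = of_real e" by blast
    have "cmod (1 - (- \<i>) * E w) = cmod (1 - \<i> * E w)" by (simp add: e cmod_def)
    then have "cmod (bargmann (f (- \<i>)) w) = cmod (bargmann (f \<i>) w)" by (simp only: Bf norm_mult)
    then show "cmod (gabor_transform (f (- \<i>)) p) = cmod (gabor_transform (f \<i>) p)"
      unfolding p norm_gabor_transform_on_line by (simp add: w_def z_def u_def)
  qed
  with R sq obtain \<alpha> where ae: "AE x in lebesgue. f (- \<i>) x = exp (\<i> * of_real \<alpha>) * f \<i> x"
    unfolding does_gabor_phase_retrieval_def by blast
  define c where "c = exp (\<i> * of_real \<alpha>)"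
  have "1 + \<i> * E w = c * (1 - \<i> * E w)" for w
    using bargmann_AE_scaled[OF sq sq ae, of w] by (simp add: Bf c_def[symmetric])
  \<comment> \<open>\<open>E\<close> takes the values 1 and - 1 at these points, and a single
    constant would have to be both \<i> and - \<i>.\<close>
  from this[of "z 3"] this[of "z 3 + \<i> * of_real (pi / \<kappa>) * u"]
  have e: "1 + \<i> = c * (1 - \<i>)" "1 - \<i> = c * (1 + \<i>)"
    using u \<kappa> by (auto simp: E_def)
  have "Re (1 + \<i>) = Re (c * (1 - \<i>))" "Im (1 - \<i>) = Im (c * (1 + \<i>))"
    by (rule arg_cong[OF e(1)], rule arg_cong[OF e(2)])
  then show False by simp
qed

section \<open>Failure of retrieval for sparse samples\<close>

lemma norm_diff_power2_le:
  fixes w z :: complex and \<epsilon> :: real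
  assumes "\<epsilon> > 0"
  shows "(norm (w - z))\<^sup>2 \<le> (1 + \<epsilon>) * (norm w)\<^sup>2 + (1 + 1 / \<epsilon>) * (norm z)\<^sup>2"
proof -
  have "(norm (w - z))\<^sup>2 \<le> (norm w + norm z)\<^sup>2" by (intro power_mono norm_triangle_ineq4) auto
  also have "\<dots> \<le> (1 + \<epsilon>) * (norm w)\<^sup>2 + (1 + 1 / \<epsilon>) * (norm z)\<^sup>2"
  proof -
    have "0 \<le> (\<epsilon> * norm w - norm z)\<^sup>2 / \<epsilon>" using assms by simp
    also have "\<dots> = (1 + \<epsilon>) * (norm w)\<^sup>2 + (1 + 1 / \<epsilon>) * (norm z)\<^sup>2 - (norm w + norm z)\<^sup>2"
      using assms by (simp add: power2_eq_square field_simps)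
    finally show ?thesis by simp
  qed
  finally show ?thesis .
qed

theorem no_phase_retrieval_sparse:
  fixes lam :: "nat \<Rightarrow> nat \<Rightarrow> real" and a t \<omega> :: "nat \<Rightarrow> real" and \<theta> :: real
  assumes pos: "\<And>l n. l \<in> {1, 2, 3} \<Longrightarrow> n \<ge> 1 \<Longrightarrow> lam n l > 0"
    and lim: "\<And>l. l \<in> {1, 2, 3} \<Longrightarrow> (\<lambda>n. lam n l / sqrt (real n)) \<longlonglongrightarrow> a l"
    and a: "\<And>l. l \<in> {1, 2, 3} \<Longrightarrow> a l > 0"
    and sparse: "(\<Sum>l\<in>{1, 2, 3}. 1 / (a l)\<^sup>2) < 1 / 2"
  shows "\<not> does_gabor_phase_retrieval (\<Union>l\<in>{1, 2, 3}. \<Union>n\<in>{1..}.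
    {(t l, \<omega> l) + lam n l *\<^sub>R (sin \<theta>, cos \<theta>), (t l, \<omega> l) - lam n l *\<^sub>R (sin \<theta>, cos \<theta>)})"
    (is "\<not> does_gabor_phase_retrieval ?\<Lambda>")
proof
  assume R: "does_gabor_phase_retrieval ?\<Lambda>"
  define L where "L = {1, 2, 3::nat}"
  have finL: "finite L" by (simp add: L_def)
  define S0 where "S0 = (\<Sum>l\<in>L. 1 / (a l)\<^sup>2)"
  have S0: "0 < S0" "S0 < 1 / 2"
    using sparse a[of 1] a[of 2] a[of 3] unfolding S0_def L_def by (simp_all add: add_pos_pos)
  \<comment> \<open>The midpoint of 1 and 1 / (2 S0). One factor \<open>sqrt \<rho>\<close> is spent
    on replacing the limit by an eventual lower bound, the other on the strict inequality for the
    type in \<open>canonical_product\<close>.\<close>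
  define \<rho> where "\<rho> = (1 / (2 * S0) + 1) / 2"
  have \<rho>: "\<rho> > 1" "\<rho> * S0 < 1 / 2" using S0 by (auto simp: \<rho>_def field_simps)
  have "\<exists>S C. S holomorphic_on UNIV \<and> S 0 = 1 \<and> (\<forall>n\<ge>1. S (of_real ((lam n l)\<^sup>2)) = 0)
    \<and> (\<forall>w. norm (S w) \<le> C * exp (pi * \<rho> / (a l)\<^sup>2 * norm w))" if l: "l \<in> L" for l
  proof -
    have al: "a l > 0" using a l by (simp add: L_def)
    have "(\<lambda>n. (lam n l / sqrt (real n))\<^sup>2) \<longlonglongrightarrow> (a l)\<^sup>2"
      using lim l by (intro tendsto_power) (simp add: L_def)
    moreover have "(a l)\<^sup>2 / sqrt \<rho> < (a l)\<^sup>2" using \<rho> al by (simp add: divide_less_eq)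
    ultimately have "eventually (\<lambda>n. (lam n l / sqrt (real n))\<^sup>2 > (a l)\<^sup>2 / sqrt \<rho>) sequentially"
      by (rule order_tendstoD(1))
    then obtain N where N: "\<And>n. n \<ge> N \<Longrightarrow> (lam n l / sqrt (real n))\<^sup>2 > (a l)\<^sup>2 / sqrt \<rho>"
      by (auto simp: eventually_sequentially)
    have N': "(a l)\<^sup>2 / sqrt \<rho> * real n \<le> (lam n l)\<^sup>2" if "n \<ge> N" for n
    proof (cases "n = 0")
      case False
      then show ?thesis using N[OF that] by (simp add: power_divide pos_less_divide_eq less_imp_le)
    qed simp
    have "sqrt \<rho> < \<rho>" using \<rho> by (intro real_less_lsqrt) (auto simp: power2_eq_square)
    then have "pi / ((a l)\<^sup>2 / sqrt \<rho>) < pi * \<rho> / (a l)\<^sup>2"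
      using al by (simp add: divide_strict_right_mono)
    moreover have "(lam n l)\<^sup>2 > 0" if "n \<ge> 1" for n using pos[of l n] that l by (simp add: L_def)
    moreover have "(a l)\<^sup>2 / sqrt \<rho> > 0" using al \<rho> by simp
    ultimately show ?thesis using N' by (intro canonical_product[where b = "(a l)\<^sup>2 / sqrt \<rho>"])
  qed
  then obtain S C where S: "\<And>l. l \<in> L \<Longrightarrow> S l holomorphic_on UNIV" "\<And>l. l \<in> L \<Longrightarrow> S l 0 = 1"
    "\<And>l n. l \<in> L \<Longrightarrow> n \<ge> 1 \<Longrightarrow> S l (of_real ((lam n l)\<^sup>2)) = 0"
    "\<And>l w. l \<in> L \<Longrightarrow> norm (S l w) \<le> C l * exp (pi * \<rho> / (a l)\<^sup>2 * norm w)"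
    by metis
  define z where "z = (\<lambda>l. time_freq (t l) (\<omega> l))"
  define u where "u = line_dir \<theta>"
  have u: "u \<noteq> 0" "norm u = 1" by (auto simp: u_def)
  \<comment> \<open>Squaring sends both samples at distance \<open>lam n l\<close> from the centre
    to the same zero of \<open>S l\<close>, and turns exponential type into Gaussian growth of the
    same constant.\<close>
  define T where "T = (\<lambda>l w. S l (((w - z l) / u)\<^sup>2))"
  have holT: "T l holomorphic_on UNIV" if "l \<in> L" for l
    unfolding T_def
    by (intro holomorphic_on_compose_gen[OF _ S(1)[OF that], unfolded o_def] holomorphic_intros) (use u in auto)
  define K where "K = (\<lambda>w. \<Prod>l\<in>L. T l w)"
  have holK: "K holomorphic_on UNIV" unfolding K_def by (intro holomorphic_intros holT)
  define c0 where "c0 = pi * \<rho> * S0"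
  define c where "c = (c0 + pi / 2) / 2"
  have c0: "c0 > 0" "c0 < pi / 2"
  proof -
    show "c0 > 0" using \<rho> S0 by (simp add: c0_def)
    have "pi * (\<rho> * S0) < pi * (1 / 2)" using \<rho> by (intro mult_strict_left_mono) auto
    then show "c0 < pi / 2" by (simp add: c0_def)
  qed
  have c: "c0 < c" "0 \<le> c" "c < pi / 2" using c0 by (auto simp: c_def)
  \<comment> \<open>Moving the three centres to the origin costs a factor 1 + \<epsilon> in the
    exponent, which the gap between \<open>c0\<close> and \<open>c\<close> pays for, and a constant
    \<open>M\<close>.\<close>
  define \<epsilon> where "\<epsilon> = c / c0 - 1"
  have \<epsilon>: "\<epsilon> > 0" "c0 * (1 + \<epsilon>) = c" using c c0 by (auto simp: \<epsilon>_def)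
  define M where "M = (\<Sum>l\<in>L. pi * \<rho> / (a l)\<^sup>2 * ((1 + 1 / \<epsilon>) * (norm (z l))\<^sup>2))"
  have Cn: "C l \<ge> 0" if "l \<in> L" for l
    using order_trans[OF norm_ge_zero S(4)[OF that, of 0]] by simp
  have boundK: "norm (K w) \<le> ((\<Prod>l\<in>L. C l) * exp M) * exp (c * (norm w)\<^sup>2)" for w
  proof -
    have "norm (K w) = (\<Prod>l\<in>L. norm (T l w))" by (simp add: K_def prod_norm)
    also have "\<dots> \<le> (\<Prod>l\<in>L. C l * exp (pi * \<rho> / (a l)\<^sup>2 * (norm (w - z l))\<^sup>2))"
    proof (rule prod_mono)
      fix l assume l: "l \<in> L"
      show "0 \<le> norm (T l w) \<and> norm (T l w) \<le> C l * exp (pi * \<rho> / (a l)\<^sup>2 * (norm (w - z l))\<^sup>2)"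
        using S(4)[OF l, of "((w - z l) / u)\<^sup>2"] u by (simp add: T_def norm_power norm_divide)
    qed
    also have "\<dots> = (\<Prod>l\<in>L. C l) * exp (\<Sum>l\<in>L. pi * \<rho> / (a l)\<^sup>2 * (norm (w - z l))\<^sup>2)"
      by (simp add: prod.distrib exp_sum[OF finL])
    also have "\<dots> \<le> (\<Prod>l\<in>L. C l) * exp (c * (norm w)\<^sup>2 + M)"
    proof -
      have "(\<Sum>l\<in>L. pi * \<rho> / (a l)\<^sup>2 * (norm (w - z l))\<^sup>2)
        \<le> (\<Sum>l\<in>L. pi * \<rho> / (a l)\<^sup>2 * ((1 + \<epsilon>) * (norm w)\<^sup>2 + (1 + 1 / \<epsilon>) * (norm (z l))\<^sup>2))"
        using \<rho> by (intro sum_mono mult_left_mono norm_diff_power2_le \<epsilon>) auto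
      also have "\<dots> = (\<Sum>l\<in>L. pi * \<rho> * ((1 + \<epsilon>) * (norm w)\<^sup>2) * (1 / (a l)\<^sup>2)) + M"
        unfolding M_def sum.distrib[symmetric] by (intro sum.cong) (simp_all add: algebra_simps)
      also have "(\<Sum>l\<in>L. pi * \<rho> * ((1 + \<epsilon>) * (norm w)\<^sup>2) * (1 / (a l)\<^sup>2)) = c0 * (1 + \<epsilon>) * (norm w)\<^sup>2"
        unfolding sum_distrib_left[symmetric] S0_def[symmetric] c0_def by simp
      also have "\<dots> = c * (norm w)\<^sup>2" by (simp only: \<epsilon>)
      finally show ?thesis using Cn by (intro mult_left_mono prod_nonneg) auto
    qed
    finally show ?thesis by (simp add: exp_add mult_ac)
  qed
  from bargmann_surjective[OF holK boundK c(2,3)] obtain f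
    where f: "square_integrable f" "\<And>w. bargmann f w = exp (of_real (pi / 2) * w\<^sup>2) * K w" by blast
  have zero: "gabor_transform f ((t l, \<omega> l) + s *\<^sub>R (sin \<theta>, cos \<theta>)) = 0"
    if l: "l \<in> L" and n: "n \<ge> 1" and s: "s\<^sup>2 = (lam n l)\<^sup>2" for l n s
  proof -
    have "((z l + of_real s * u - z l) / u)\<^sup>2 = of_real ((lam n l)\<^sup>2)"
      using u by (simp add: s[symmetric])
    then have "T l (z l + of_real s * u) = 0" using S(3)[OF l n] by (simp only: T_def)
    then have "K (z l + of_real s * u) = 0" using l by (auto simp: K_def L_def)
    then have "bargmann f (z l + of_real s * u) = 0" by (simp add: f)
    then have "cmod (gabor_transform f ((t l, \<omega> l) + s *\<^sub>R (sin \<theta>, cos \<theta>))) = 0"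
      unfolding norm_gabor_transform_on_line by (simp add: z_def u_def)
    then show ?thesis by simp
  qed
  have "\<forall>p\<in>?\<Lambda>. cmod (gabor_transform f p) = cmod (gabor_transform (\<lambda>x. 0) p)"
  proof
    fix p assume "p \<in> ?\<Lambda>"
    then obtain l n where l: "l \<in> L" "n \<ge> 1"
      and p: "p = (t l, \<omega> l) + lam n l *\<^sub>R (sin \<theta>, cos \<theta>) \<or> p = (t l, \<omega> l) - lam n l *\<^sub>R (sin \<theta>, cos \<theta>)"
      unfolding L_def by blast
    have "gabor_transform f p = 0"
      using p zero[OF l, of "lam n l"] zero[OF l, of "- lam n l"] by auto
    then show "cmod (gabor_transform f p) = cmod (gabor_transform (\<lambda>x. 0) p)"
      by (cases p) (simp add: gabor_transform_def)
  qed
  moreover have sq0: "square_integrable (\<lambda>x. 0)" by (simp add: square_integrable_def)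
  ultimately obtain \<alpha> where "AE x in lebesgue. f x = exp (\<i> * of_real \<alpha>) * 0"
    using R f(1) unfolding does_gabor_phase_retrieval_def by blast
  then have "bargmann f w = exp (\<i> * of_real \<alpha>) * bargmann (\<lambda>x. 0) w" for w
    by (rule bargmann_AE_scaled[OF f(1) sq0])
  then have "bargmann f w = 0" for w by (simp add: bargmann_def)
  then have K0: "K w = 0" for w using f(2)[of w] by simp
  \<comment> \<open>The normalization \<open>S l 0 = 1\<close> shows that no factor is identically
    zero, so neither is the product \<open>K\<close>.\<close>
  have T1: "T l (z l) \<noteq> 0" if "l \<in> L" for l using S(2)[OF that] by (simp add: T_def)
  have L: "1 \<in> L" "2 \<in> L" "3 \<in> L" by (auto simp: L_def)
  have T123: "T 1 w * T 2 w * T 3 w = 0" for w using K0[of w] by (simp add: K_def L_def mult.assoc)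
  have hol12: "(\<lambda>w. T 1 w * T 2 w) holomorphic_on UNIV" by (intro holomorphic_intros holT L)
  have T12: "T 1 w * T 2 w = 0" for w
    by (rule holomorphic_mult_eq_0[OF hol12 holT[OF L(3)] T123 T1[OF L(3)]])
  have "T 1 w = 0" for w
    by (rule holomorphic_mult_eq_0[OF holT[OF L(1)] holT[OF L(2)] T12 T1[OF L(2)]])
  then show False using T1[OF L(1)] by simp
qed

lemma does_gabor_phase_retrieval_mono:
  "does_gabor_phase_retrieval A \<Longrightarrow> A \<subseteq> B \<Longrightarrow> does_gabor_phase_retrieval B"
  unfolding does_gabor_phase_retrieval_def by (meson subsetD)

theorem theorem4p6:
  fixes lam :: "nat \<Rightarrow> nat \<Rightarrow> real"
    and a t \<omega> d :: "nat \<Rightarrow> real"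
    and \<theta>\<^sub>0 :: real
    and \<Lambda> :: "(real \<times> real) set"
  assumes lam_pos: "\<And>l n. l \<in> {1, 2, 3} \<Longrightarrow> n \<ge> 1 \<Longrightarrow> lam n l > 0"
    and lam_mono: "\<And>l. l \<in> {1, 2, 3} \<Longrightarrow> strict_mono_on {1..} (\<lambda>n. lam n l)"
    and lam_lim: "\<And>l. l \<in> {1, 2, 3} \<Longrightarrow> (\<lambda>n. lam n l / sqrt (real n)) \<longlonglongrightarrow> a l"
    and theta: "\<theta>\<^sub>0 \<in> {0..2 * pi}"
    and Lambda: "\<Lambda> = (\<Union>l\<in>{1, 2, 3}. \<Union>n\<in>{1..}.
          {(t l, \<omega> l) + lam n l *\<^sub>R (sin \<theta>\<^sub>0, cos \<theta>\<^sub>0), (t l, \<omega> l) - lam n l *\<^sub>R (sin \<theta>\<^sub>0, cos \<theta>\<^sub>0)})"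
    and d: "\<And>l. l \<in> {1, 2} \<Longrightarrow> d l = \<bar>(\<omega> l - \<omega> 3) * sin \<theta>\<^sub>0 - (t l - t 3) * cos \<theta>\<^sub>0\<bar>"
    and d_pos: "\<And>l. l \<in> {1, 2} \<Longrightarrow> d l > 0"
  shows "(d 1 / d 2 \<notin> \<rat> \<and> Max {a 1, a 2, a 3} < 1 \<longrightarrow> does_gabor_phase_retrieval \<Lambda>) \<and>
         (d 1 / d 2 \<in> \<rat> \<or> inverse_square (a 1) + inverse_square (a 2) + inverse_square (a 3) < 1 / 2
            \<longrightarrow> \<not> does_gabor_phase_retrieval \<Lambda>)"
proof -
  define h where "h = (\<lambda>l. (t l - t 3) * cos \<theta>\<^sub>0 - (\<omega> l - \<omega> 3) * sin \<theta>\<^sub>0)"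
  have dh: "d 1 = \<bar>h 1\<bar>" "d 2 = \<bar>h 2\<bar>"
    using d[of 1] d[of 2] by (simp_all add: h_def abs_minus_commute)
  have rat: "d 1 / d 2 \<in> \<rat> \<longleftrightarrow> h 1 / h 2 \<in> \<rat>"
  proof -
    have "d 1 / d 2 = h 1 / h 2 \<or> d 1 / d 2 = - (h 1 / h 2)" unfolding dh by (auto simp: abs_if)
    then show ?thesis by (metis Rats_minus_iff)
  qed
  have "does_gabor_phase_retrieval \<Lambda>" if "d 1 / d 2 \<notin> \<rat>" "Max {a 1, a 2, a 3} < 1"
    unfolding does_gabor_phase_retrieval_def
  proof (intro allI impI)
    fix f1 f2
    assume sq: "square_integrable f1" "square_integrable f2"
      and eq: "\<forall>p\<in>\<Lambda>. cmod (gabor_transform f1 p) = cmod (gabor_transform f2 p)"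
    show "\<exists>\<alpha>::real. AE x in lebesgue. f1 x = exp (\<i> * of_real \<alpha>) * f2 x"
    proof (rule phase_retrieval_three_lines[OF sq lam_pos lam_mono lam_lim])
      show "a l < 1" if "l \<in> {1, 2, 3}" for l using that \<open>Max {a 1, a 2, a 3} < 1\<close> by auto
      show "((t 1 - t 3) * cos \<theta>\<^sub>0 - (\<omega> 1 - \<omega> 3) * sin \<theta>\<^sub>0) / ((t 2 - t 3) * cos \<theta>\<^sub>0 - (\<omega> 2 - \<omega> 3) * sin \<theta>\<^sub>0) \<notin> \<rat>"
        using that rat by (simp add: h_def)
      fix l n :: nat assume "l \<in> {1, 2, 3}" "n \<ge> 1"
      then show "cmod (gabor_transform f1 ((t l, \<omega> l) + lam n l *\<^sub>R (sin \<theta>\<^sub>0, cos \<theta>\<^sub>0)))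
        = cmod (gabor_transform f2 ((t l, \<omega> l) + lam n l *\<^sub>R (sin \<theta>\<^sub>0, cos \<theta>\<^sub>0)))"
        by (intro bspec[OF eq]) (unfold Lambda, blast)
    qed
  qed
  moreover have "\<not> does_gabor_phase_retrieval \<Lambda>" if "d 1 / d 2 \<in> \<rat>"
  proof -
    have "h 2 \<noteq> 0" using d_pos[of 2] dh by simp
    then have "\<not> does_gabor_phase_retrieval (\<Union>l\<in>{1, 2, 3}. range (\<lambda>s. (t l, \<omega> l) + s *\<^sub>R (sin \<theta>\<^sub>0, cos \<theta>\<^sub>0)))"
      using no_phase_retrieval_commensurable_lines[of t \<theta>\<^sub>0 \<omega>] that rat by (simp add: h_def)
    moreover have "\<Lambda> \<subseteq> (\<Union>l\<in>{1, 2, 3}. range (\<lambda>s. (t l, \<omega> l) + s *\<^sub>R (sin \<theta>\<^sub>0, cos \<theta>\<^sub>0)))"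
    proof
      fix p assume "p \<in> \<Lambda>"
      then obtain l n where l: "l \<in> {1, 2, 3}"
        and p: "p = (t l, \<omega> l) + lam n l *\<^sub>R (sin \<theta>\<^sub>0, cos \<theta>\<^sub>0) \<or> p = (t l, \<omega> l) - lam n l *\<^sub>R (sin \<theta>\<^sub>0, cos \<theta>\<^sub>0)"
        unfolding Lambda by blast
      have "(t l, \<omega> l) - lam n l *\<^sub>R (sin \<theta>\<^sub>0, cos \<theta>\<^sub>0) = (t l, \<omega> l) + (- lam n l) *\<^sub>R (sin \<theta>\<^sub>0, cos \<theta>\<^sub>0)" by simp
      with p have "p \<in> range (\<lambda>s. (t l, \<omega> l) + s *\<^sub>R (sin \<theta>\<^sub>0, cos \<theta>\<^sub>0))" by (metis rangeI)
      with l show "p \<in> (\<Union>l\<in>{1, 2, 3}. range (\<lambda>s. (t l, \<omega> l) + s *\<^sub>R (sin \<theta>\<^sub>0, cos \<theta>\<^sub>0)))" by blast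
    qed
    ultimately show ?thesis using does_gabor_phase_retrieval_mono by blast
  qed
  moreover have "\<not> does_gabor_phase_retrieval \<Lambda>"
    if s: "inverse_square (a 1) + inverse_square (a 2) + inverse_square (a 3) < 1 / 2"
  proof -
    have nn: "a l \<ge> 0" if "l \<in> {1, 2, 3}" for l
      by (rule tendsto_lowerbound[OF lam_lim[OF that]])
        (auto intro!: eventually_sequentiallyI[of 1] divide_nonneg_nonneg less_imp_le[OF lam_pos[OF that]])
    \<comment> \<open>A vanishing limit would make the extended sum infinite.\<close>
    have nz: "a 1 \<noteq> 0" "a 2 \<noteq> 0" "a 3 \<noteq> 0"
      using s by (auto simp: inverse_square_def split: if_splits)
    have half: "(1 / 2 :: ereal) = ereal (1 / 2)" by (simp add: divide_ereal_def one_ereal_def)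
    have "1 / (a 1)\<^sup>2 + 1 / (a 2)\<^sup>2 + 1 / (a 3)\<^sup>2 < 1 / 2"
      using s nz unfolding half by (simp add: inverse_square_def)
    then have sum: "(\<Sum>l\<in>{1, 2, 3}. 1 / (a l)\<^sup>2) < 1 / 2" by simp
    have a0: "a l > 0" if "l \<in> {1, 2, 3}" for l
      using nn[OF that] nz that by (auto simp: order_less_le)
    show ?thesis
      unfolding Lambda by (rule no_phase_retrieval_sparse[OF lam_pos lam_lim a0 sum])
  qed
  ultimately show ?thesis by blast
qed

end
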